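(* Let $C_0$ be a copula satisfying the nondegeneracy condition ($C_0^{\mathbb{S},2}(\sigma,\sigma)-C_0^{\mathbb{S}}(\sigma)^2\neq0$ for some $\sigma\in\mathbb{S}$), fix $\alpha\in(0,1)$, and for a random permutation $\Pi_n$ generated by an i.i.d. sample of size $n$ from a copula $C$ let $\mathrm{KS}^{GF}_n=\sqrt{n}\max_{\sigma\in\mathbb{S}^{\le}_n}p_\sigma^{1/2}|\sigma|^{-1}\bigl|t(\Pi_n,\sigma)-C_0^{\mathbb{S}}(\sigma)\bigr|$, with $q_{n,\alpha}=\inf\{t:P_{C_0}(\mathrm{KS}^{GF}_n>t)\le\alpha\}$ its upper $\alpha$-quantile when $C=C_0$. Then $\lim_{n\to\infty}P_{C_0}(\mathrm{KS}^{GF}_n\ge q_{n,\alpha})=\alpha$ and $\lim_{n\to\infty}P_C(\mathrm{KS}^{GF}_n\ge q_{n,\alpha})=1$ for every copula $C\neq C_0$.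
   Context: $\mathbb{S}_k$: permutations of $[k]$; $\mathbb{S}=\bigsqcup_k\mathbb{S}_k$; $|\sigma|=k$ for $\sigma\in\mathbb{S}_k$; $\mathbb{S}^{\le}_n=\bigsqcup_{j=1}^n\mathbb{S}_j$. For $\pi\in\mathbb{S}_n$, $\sigma\in\mathbb{S}_j$ ($j\le n$), $t(\pi,\sigma)$ is the proportion of $j$-element subsets $\{i_1<\dots<i_j\}\subset[n]$ with $(\pi(i_1),\dots,\pi(i_j))$ order-isomorphic to $(\sigma(1),\dots,\sigma(j))$. A copula is the distribution function of a probability measure on $[0,1]^2$ with uniform marginals. For points $(u_i,v_i)$, $i\le n$, without ties in either coordinate, $\Pi_n$ is the unique $\pi\in\mathbb{S}_n$ with $u_i<u_j\iff v_{\pi(i)}<v_{\pi(j)}$. For a copula $C$ and independent $Z_1,Z_2,Z_2',\dots$ with distribution function $C$: $C^{\mathbb{S}}(\sigma)=\mathbb{P}(\Pi_k(Z_1,\dots,Z_k)=\sigma)$ and $C^{\mathbb{S},2}(\sigma,\tau)=\mathbb{P}(\Pi_k(Z_1,Z_2,\dots,Z_k)=\sigma,\Pi_j(Z_1,Z_2',\dots,Z_j')=\tau)$. Weights $p_\sigma=\gamma\,|\sigma|!^{-2}2^{-|\sigma|}$, $\gamma=e^{-1/2}(1-e^{-1/2})^{-1}$.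
   Formalization: Π_n is taken as the permutation whose graph is order-isomorphic to the sample points; the literal rule u_i<u_j iff v_{π(i)}<v_{π(j)} depends on the labelling and gives C_0 and its transpose the same law, so consistency would fail. *)

theory Defs
  imports "HOL-Probability.Probability"
begin

(* Permutations of [k], represented 0-indexed as lists: sigma = [sigma(1)-1, ..., sigma(k)-1].
   The size |sigma| is the length of the list. *)
definition perms :: "nat \<Rightarrow> nat list set" where
  "perms k = {\<sigma>. length \<sigma> = k \<and> set \<sigma> = {..<k}}"

definition order_iso :: "nat list \<Rightarrow> nat list \<Rightarrow> bool" where
  "order_iso xs ys \<longleftrightarrow> length xs = length ys \<and>
     (\<forall>a<length xs. \<forall>b<length xs. (xs ! a < xs ! b) \<longleftrightarrow> (ys ! a < ys ! b))"

definition pdens :: "nat list \<Rightarrow> nat list \<Rightarrow> real" where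
  "pdens \<pi> \<sigma> =
     real (card {I. I \<subseteq> {..<length \<pi>} \<and> card I = length \<sigma> \<and>
                    order_iso (map (\<lambda>i. \<pi> ! i) (sorted_list_of_set I)) \<sigma>})
     / real (length \<pi> choose length \<sigma>)"

(* Pi_n(z_0,...,z_{n-1}): the permutation whose point set {(i,pi(i))} is order-isomorphic
   to the point set {(u_i,v_i)} (unique if there are no ties). *)
definition pattern :: "nat \<Rightarrow> (nat \<Rightarrow> real \<times> real) \<Rightarrow> nat list" where
  "pattern n z = (THE \<pi>. \<pi> \<in> perms n \<and>
     (\<exists>f. bij_betw f {..<n} {..<n} \<and>
        (\<forall>i<n. \<forall>j<n. (fst (z i) < fst (z j) \<longleftrightarrow> f i < f j) \<and>
                      (snd (z i) < snd (z j) \<longleftrightarrow> \<pi> ! (f i) < \<pi> ! (f j)))))"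

definition copula_measure :: "(real \<times> real) measure \<Rightarrow> bool" where
  "copula_measure \<mu> \<longleftrightarrow> prob_space \<mu> \<and> sets \<mu> = sets borel \<and>
     distr \<mu> lborel fst = uniform_measure lborel {0..1} \<and>
     distr \<mu> lborel snd = uniform_measure lborel {0..1}"

definition copula_cdf :: "(real \<times> real) measure \<Rightarrow> real \<Rightarrow> real \<Rightarrow> real" where
  "copula_cdf \<mu> = (\<lambda>u v. measure \<mu> ({..u} \<times> {..v}))"

definition is_copula :: "(real \<Rightarrow> real \<Rightarrow> real) \<Rightarrow> bool" where
  "is_copula C \<longleftrightarrow> (\<exists>\<mu>. copula_measure \<mu> \<and> C = copula_cdf \<mu>)"

definition copula_law :: "(real \<Rightarrow> real \<Rightarrow> real) \<Rightarrow> (real \<times> real) measure" where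
  "copula_law C = (SOME \<mu>. copula_measure \<mu> \<and> C = copula_cdf \<mu>)"

definition sample :: "nat \<Rightarrow> (real \<Rightarrow> real \<Rightarrow> real) \<Rightarrow> (nat \<Rightarrow> real \<times> real) measure" where
  "sample n C = PiM {..<n} (\<lambda>_. copula_law C)"

definition CS :: "(real \<Rightarrow> real \<Rightarrow> real) \<Rightarrow> nat list \<Rightarrow> real" where
  "CS C \<sigma> = measure (sample (length \<sigma>) C)
     {z \<in> space (sample (length \<sigma>) C). pattern (length \<sigma>) z = \<sigma>}"

(* C^{S,2}(sigma,tau): the first sample is z_0,...,z_{k-1}; the second one shares z_0 and
   uses fresh points z_k, ..., z_{k+j-2}. *)
definition CS2 :: "(real \<Rightarrow> real \<Rightarrow> real) \<Rightarrow> nat list \<Rightarrow> nat list \<Rightarrow> real" where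
  "CS2 C \<sigma> \<tau> = (let k = length \<sigma>; j = length \<tau>; M = sample (k + j) C in
     measure M {z \<in> space M. pattern k z = \<sigma> \<and>
                  pattern j (\<lambda>i. if i = 0 then z 0 else z (k + i - 1)) = \<tau>})"

definition gamma_w :: real where
  "gamma_w = exp (-1/2) / (1 - exp (-1/2))"

definition weight :: "nat list \<Rightarrow> real" where
  "weight \<sigma> = gamma_w / ((fact (length \<sigma>))\<^sup>2 * 2 ^ length \<sigma>)"

definition KS :: "(real \<Rightarrow> real \<Rightarrow> real) \<Rightarrow> nat \<Rightarrow> nat list \<Rightarrow> real" where
  "KS C0 n \<pi> = sqrt (real n) *
     Max ((\<lambda>\<sigma>. sqrt (weight \<sigma>) / real (length \<sigma>) * \<bar>pdens \<pi> \<sigma> - CS C0 \<sigma>\<bar>)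
          ` (\<Union>j\<in>{1..n}. perms j))"

definition ks_prob_gt :: "(real \<Rightarrow> real \<Rightarrow> real) \<Rightarrow> (real \<Rightarrow> real \<Rightarrow> real) \<Rightarrow> nat \<Rightarrow> real \<Rightarrow> real" where
  "ks_prob_gt C0 C n t = measure (sample n C)
     {z \<in> space (sample n C). KS C0 n (pattern n z) > t}"

definition ks_prob_ge :: "(real \<Rightarrow> real \<Rightarrow> real) \<Rightarrow> (real \<Rightarrow> real \<Rightarrow> real) \<Rightarrow> nat \<Rightarrow> real \<Rightarrow> real" where
  "ks_prob_ge C0 C n t = measure (sample n C)
     {z \<in> space (sample n C). KS C0 n (pattern n z) \<ge> t}"

definition ks_quantile :: "(real \<Rightarrow> real \<Rightarrow> real) \<Rightarrow> real \<Rightarrow> nat \<Rightarrow> real" where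
  "ks_quantile C0 \<alpha> n = Inf {t. ks_prob_gt C0 C0 n t \<le> \<alpha>}"

end

(*
  Since q_n is the upper quantile, alpha <= P(KS_n >= q_n) <= alpha + P(KS_n = q_n), so the level
  statement only needs sup_t P(KS_n = t) -> 0.  This needs no limit process: if KS_n = t, then some
  pattern sigma attains the value t, and the union bound splits according to sigma.  For the finitely
  many short nondegenerate patterns, Hoeffding's projection and the univariate central limit theorem
  bound the concentration of sqrt n (t(Pi_n, sigma) - C_0(sigma)); the short degenerate patterns and the
  long ones have small second moments, whereas KS_n itself dominates the statistic of one nondegenerate
  pattern and is therefore bounded away from 0 with high probability.

  For consistency, Chebyshev's inequality bounds the quantiles, and some pattern has a density that
  differs under C and C_0: the law of Pi_n determines the law of the normalised ranks of one sample
  point, which converges to the copula.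

  All samples live on one infinite product space P.  Independence is used through a single tool: a
  sample point keeps its law if the coordinates in a set D are replaced by those of an independent copy.
*)
theory Submission
  imports Defs "HOL-Real_Asymp.Real_Asymp"
begin

section \<open>Infinite i.i.d. sequences and averages over subsets\<close>


text \<open>The weights make a union bound possible although the number of patterns grows with n.
  The statistic of a pattern of length k has variance at most k^2 / n, so multiplied by sqrt n and
  by \<open>sqrt (weight \<sigma>) / k\<close> it has second moment at most
  \<open>weight \<sigma>\<close>, for every n; and the weights are summable, because k! permutations
  share a weight of order k!^-2 2^-k. The obstacle for the level is that t varies with n and that
  the maximum can inherit an atom from any of its terms: a degenerate pattern concentrates at 0
  after scaling by sqrt n, and the long patterns are too many for a term by term bound on their
  atoms. Hence a threshold \<delta>. It is fixed by one nondegenerate pattern, before the length K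
  that separates short from long is chosen in terms of \<delta>; patterns of either problematic kind
  would have to reach \<delta> in order to attain the maximum. No joint law of several patterns is
  ever considered, so a one-dimensional central limit theorem, made uniform in the position of a
  window, is enough.\<close>

locale iid_sequence = M: prob_space \<mu> for \<mu> :: "'a measure" +
  assumes space_base: "space \<mu> = UNIV"
begin

text \<open>Because \<open>space \<mu>\<close> is all of the type, every sequence is a point of
  \<open>P\<close>; resampled and updated sequences then need no membership or extensionality
  conditions.\<close>

definition P :: "(nat \<Rightarrow> 'a) measure" where "P = PiM UNIV (\<lambda>_. \<mu>)"

sublocale prod: product_prob_space "\<lambda>_. \<mu>" "UNIV :: nat set"
  by unfold_locales

sublocale P: prob_space P
  unfolding P_def by (rule prob_space_PiM) (rule M.prob_space_axioms)

lemma space_P [simp]: "space P = UNIV"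
  by (simp add: P_def space_PiM space_base PiE_UNIV_domain)

lemma sets_P [measurable_cong]: "sets P = sets (PiM UNIV (\<lambda>_. \<mu>))"
  by (simp add: P_def)

lemma measurable_coord [measurable]: "(\<lambda>z. z i) \<in> measurable P \<mu>"
  unfolding P_def by simp

lemma distr_coord: "distr P \<mu> (\<lambda>z. z i) = \<mu>"
  unfolding P_def using prod.PiM_component[of i] by simp

lemma measurable_into_P:
  assumes "\<And>i. (\<lambda>x. f x i) \<in> measurable N \<mu>"
  shows "f \<in> measurable N P"
  unfolding P_def by (rule measurable_PiM_single') (use assms in \<open>auto simp: space_base\<close>)

lemma distr_reindex:
  assumes "inj \<phi>"
  shows "distr P P (\<lambda>z. z \<circ> \<phi>) = P"
proof -
  have "distr (PiM UNIV (\<lambda>_. \<mu>)) (PiM UNIV (\<lambda>_. \<mu>)) (\<lambda>\<omega>. \<lambda>n\<in>UNIV. \<omega> (\<phi> n)) = PiM UNIV (\<lambda>_. \<mu>)"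
    by (rule distr_PiM_reindex) (use assms M.prob_space_axioms in auto)
  then show ?thesis
    by (simp add: P_def comp_def restrict_UNIV)
qed

text \<open>Stands in for conditioning: with z fixed, the integral of f (mix D z z') over z' is the
  conditional expectation of f given the coordinates outside D, in a version defined at every
  z.\<close>

definition mix :: "nat set \<Rightarrow> (nat \<Rightarrow> 'a) \<Rightarrow> (nat \<Rightarrow> 'a) \<Rightarrow> nat \<Rightarrow> 'a" where
  "mix D z z' = (\<lambda>i. if i \<in> D then z' i else z i)"

lemma measurable_mix [measurable]: "(\<lambda>p. mix D (fst p) (snd p)) \<in> measurable (P \<Otimes>\<^sub>M P) P"
  unfolding mix_def by (rule measurable_into_P) auto

text \<open>Product measures are determined by finite rectangles, and \<open>mix\<close> pulls a
  rectangle over J back to one over J - D in the first copy times one over J \<inter> D in the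
  second; the two products of factors recombine to the product over J.\<close>

lemma distr_mix: "distr (P \<Otimes>\<^sub>M P) P (\<lambda>p. mix D (fst p) (snd p)) = P"
proof -
  interpret PP: pair_prob_space P P ..
  have "distr (P \<Otimes>\<^sub>M P) P (\<lambda>p. mix D (fst p) (snd p)) = PiM UNIV (\<lambda>_. \<mu>)"
  proof (rule prod.PiM_eq)
    show "sets (distr (P \<Otimes>\<^sub>M P) P (\<lambda>p. mix D (fst p) (snd p))) = sets (PiM UNIV (\<lambda>_. \<mu>))"
      by (simp add: sets_P)
    fix J :: "nat set" and F assume J: "finite J" and F: "\<And>j. j \<in> J \<Longrightarrow> F j \<in> sets \<mu>"
    define E where "E K = {z. \<forall>j\<in>K. z j \<in> F j}" for K
    have E_sets: "E K \<in> sets P" and E_meas: "emeasure P (E K) = (\<Prod>j\<in>K. emeasure \<mu> (F j))" if "K \<subseteq> J" for K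
    proof -
      have K: "finite K" using J that by (rule rev_finite_subset)
      have "{z \<in> space P. \<forall>j\<in>K. z j \<in> F j} \<in> sets P"
        using K F[OF subsetD[OF that]] by measurable
      then show "E K \<in> sets P" by (simp add: E_def)
      show "emeasure P (E K) = (\<Prod>j\<in>K. emeasure \<mu> (F j))"
        using prod.emeasure_PiM_Collect[of K F] K F that unfolding P_def E_def
        by (simp add: space_PiM space_base PiE_UNIV_domain subset_eq)
    qed
    have emb: "prod_emb UNIV (\<lambda>_. \<mu>) J (Pi\<^sub>E J F) = E J"
      by (auto simp: prod_emb_def E_def space_PiM space_base Pi_iff)
    have vim: "(\<lambda>p. mix D (fst p) (snd p)) -` E J \<inter> space (P \<Otimes>\<^sub>M P) = E (J - D) \<times> E (J \<inter> D)"
      by (auto simp: E_def mix_def space_pair_measure split: if_splits)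
    have "emeasure (distr (P \<Otimes>\<^sub>M P) P (\<lambda>p. mix D (fst p) (snd p))) (E J) = emeasure (P \<Otimes>\<^sub>M P) (E (J - D) \<times> E (J \<inter> D))"
      by (subst emeasure_distr) (auto simp: vim E_sets)
    also have "\<dots> = emeasure P (E (J - D)) * emeasure P (E (J \<inter> D))"
      by (rule P.emeasure_pair_measure_Times) (auto intro!: E_sets)
    also have "\<dots> = (\<Prod>j\<in>J - D. emeasure \<mu> (F j)) * (\<Prod>j\<in>J \<inter> D. emeasure \<mu> (F j))"
      by (subst (1 2) E_meas) auto
    also have "\<dots> = (\<Prod>j\<in>J. emeasure \<mu> (F j))"
      using J by (subst prod.union_disjoint[symmetric]) (auto intro!: prod.cong)
    finally show "emeasure (distr (P \<Otimes>\<^sub>M P) P (\<lambda>p. mix D (fst p) (snd p)))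
        (prod_emb UNIV (\<lambda>_. \<mu>) J (Pi\<^sub>E J F)) = (\<Prod>j\<in>J. emeasure \<mu> (F j))"
      by (simp add: emb)
  qed
  then show ?thesis by (simp add: P_def)
qed

lemma measurable_reindex [measurable]: "(\<lambda>z. z \<circ> \<phi>) \<in> measurable P P"
  by (rule measurable_into_P) auto

lemma integral_reindex:
  fixes f :: "(nat \<Rightarrow> 'a) \<Rightarrow> real"
  assumes "f \<in> borel_measurable P" "inj \<phi>"
  shows "(\<integral>z. f (z \<circ> \<phi>) \<partial>P) = (\<integral>z. f z \<partial>P)"
proof -
  have "(\<integral>z. f z \<partial>distr P P (\<lambda>z. z \<circ> \<phi>)) = (\<integral>z. f (z \<circ> \<phi>) \<partial>P)"
    by (rule integral_distr) (use assms in auto)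
  then show ?thesis by (simp add: distr_reindex assms)
qed

lemma integral_coord:
  fixes f :: "'a \<Rightarrow> real"
  assumes "f \<in> borel_measurable \<mu>"
  shows "(\<integral>z. f (z i) \<partial>P) = (\<integral>x. f x \<partial>\<mu>)"
  using integral_distr[of "\<lambda>z. z i" P \<mu> f] assms by (simp add: distr_coord)

lemma integral_mix:
  fixes f :: "(nat \<Rightarrow> 'a) \<Rightarrow> real"
  assumes [measurable]: "f \<in> borel_measurable P" and bd: "\<And>z. \<bar>f z\<bar> \<le> B"
  shows "(\<integral>z. f z \<partial>P) = (\<integral>z. \<integral>z'. f (mix D z z') \<partial>P \<partial>P)"
proof -
  interpret PP: pair_prob_space P P ..
  have "(\<integral>z. f z \<partial>P) = (\<integral>p. f (mix D (fst p) (snd p)) \<partial>(P \<Otimes>\<^sub>M P))"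
    using integral_distr[of "\<lambda>p. mix D (fst p) (snd p)" "P \<Otimes>\<^sub>M P" P f] by (simp add: distr_mix)
  also have "\<dots> = (\<integral>z. \<integral>z'. f (mix D (fst (z, z')) (snd (z, z'))) \<partial>P \<partial>P)"
    by (rule PP.integral_fst'[symmetric]) (rule PP.P.integrable_const_bound[of _ B], use bd in auto)
  finally show ?thesis by simp
qed

text \<open>Given the coordinates outside D, f is constant and g has mean zero, so the product
  already vanishes in the inner integral. Uniform bounds take the place of integrability
  assumptions, since all kernels in use are bounded.\<close>

lemma integral_orthogonal:
  fixes f g :: "(nat \<Rightarrow> 'a) \<Rightarrow> real"
  assumes [measurable]: "f \<in> borel_measurable P" "g \<in> borel_measurable P"
    and bd: "\<And>z. \<bar>f z\<bar> \<le> B" "\<And>z. \<bar>g z\<bar> \<le> B"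
    and f: "\<And>z z'. f (mix D z z') = f z"
    and g: "\<And>z. (\<integral>z'. g (mix D z z') \<partial>P) = 0"
  shows "(\<integral>z. f z * g z \<partial>P) = 0"
proof -
  have "\<bar>f z * g z\<bar> \<le> B * B" for z
    unfolding abs_mult using bd[of z] by (intro mult_mono) auto
  then have "(\<integral>z. f z * g z \<partial>P) = (\<integral>z. \<integral>z'. f (mix D z z') * g (mix D z z') \<partial>P \<partial>P)"
    by (intro integral_mix) auto
  then show ?thesis by (simp add: f g)
qed

end

section \<open>Second moments of averages over k-element subsets\<close>

lemma card_subsets_superset:
  assumes T: "T \<subseteq> {..<n}" "card T = r" "r \<le> k" "k \<le> n"
  shows "card {I. I \<subseteq> {..<n::nat} \<and> card I = k \<and> T \<subseteq> I} = (n - r) choose (k - r)"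
proof -
  have finT: "finite T" using T(1) finite_subset by blast
  have "bij_betw (\<lambda>I. I - T) {I. I \<subseteq> {..<n} \<and> card I = k \<and> T \<subseteq> I} {J. J \<subseteq> {..<n} - T \<and> card J = k - r}"
  proof (rule bij_betwI[where g = "\<lambda>J. J \<union> T"])
    show "(\<lambda>I. I - T) \<in> {I. I \<subseteq> {..<n} \<and> card I = k \<and> T \<subseteq> I} \<rightarrow> {J. J \<subseteq> {..<n} - T \<and> card J = k - r}"
      using T finT by (auto simp: card_Diff_subset)
    show "(\<lambda>J. J \<union> T) \<in> {J. J \<subseteq> {..<n} - T \<and> card J = k - r} \<rightarrow> {I. I \<subseteq> {..<n} \<and> card I = k \<and> T \<subseteq> I}"
    proof (clarsimp, intro conjI)
      fix J assume J: "J \<subseteq> {..<n} - T" "card J = k - r"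
      show "J \<subseteq> {..<n}" "T \<subseteq> {..<n}" using J T by auto
      have "finite J" using J(1) finite_subset[of J "{..<n}"] by auto
      then have "card (J \<union> T) = card J + card T"
        using J finT by (intro card_Un_disjoint) auto
      then show "card (J \<union> T) = k" using J T by simp
    qed
  qed auto
  then have "card {I. I \<subseteq> {..<n} \<and> card I = k \<and> T \<subseteq> I} = card {J. J \<subseteq> {..<n} - T \<and> card J = k - r}"
    by (rule bij_betw_same_card)
  also have "\<dots> = card ({..<n} - T) choose (k - r)"
    by (rule n_subsets) auto
  also have "card ({..<n} - T) = n - r" using T finT by (simp add: card_Diff_subset)
  finally show ?thesis .
qed

text \<open>Every such pair contains a common r-set T. Summing over T counts a pair several times
  when the intersection is larger, which an upper bound can afford.\<close>

lemma card_intersecting_pairs: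
  defines "Sub n k \<equiv> {I. I \<subseteq> {..<n::nat} \<and> card I = k}"
  assumes "r \<le> k" "k \<le> n"
  shows "card {(I, J) \<in> Sub n k \<times> Sub n k. r \<le> card (I \<inter> J)}
    \<le> (n choose r) * ((n - r) choose (k - r))\<^sup>2"
proof -
  have fin: "finite (Sub n k)" for n k unfolding Sub_def by simp
  have "{(I, J) \<in> Sub n k \<times> Sub n k. r \<le> card (I \<inter> J)}
      \<subseteq> (\<Union>T\<in>Sub n r. {I \<in> Sub n k. T \<subseteq> I} \<times> {I \<in> Sub n k. T \<subseteq> I})"
  proof clarsimp
    fix I J assume IJ: "I \<in> Sub n k" "J \<in> Sub n k" "r \<le> card (I \<inter> J)"
    then obtain T where "T \<subseteq> I \<inter> J" "card T = r"
      by (meson obtain_subset_with_card_n)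
    with IJ show "\<exists>T\<in>Sub n r. T \<subseteq> I \<and> T \<subseteq> J" by (auto simp: Sub_def intro!: exI[of _ T])
  qed
  then have "card {(I, J) \<in> Sub n k \<times> Sub n k. r \<le> card (I \<inter> J)}
      \<le> card (\<Union>T\<in>Sub n r. {I \<in> Sub n k. T \<subseteq> I} \<times> {I \<in> Sub n k. T \<subseteq> I})"
    by (rule card_mono[rotated]) (auto simp: fin)
  also have "\<dots> \<le> (\<Sum>T\<in>Sub n r. card ({I \<in> Sub n k. T \<subseteq> I} \<times> {I \<in> Sub n k. T \<subseteq> I}))"
    by (rule card_UN_le) (rule fin)
  also have "\<dots> = (\<Sum>T\<in>Sub n r. ((n - r) choose (k - r))\<^sup>2)"
  proof (rule sum.cong)
    fix T assume "T \<in> Sub n r"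
    then have "card {I \<in> Sub n k. T \<subseteq> I} = (n - r) choose (k - r)"
      using card_subsets_superset[of T n r k] assms by (simp add: Sub_def conj_assoc)
    then show "card ({I \<in> Sub n k. T \<subseteq> I} \<times> {I \<in> Sub n k. T \<subseteq> I}) = ((n - r) choose (k - r))\<^sup>2"
      by (simp add: card_cartesian_product power2_eq_square)
  qed simp
  also have "\<dots> = (n choose r) * ((n - r) choose (k - r))\<^sup>2"
    using n_subsets[of "{..<n}" r] by (simp add: Sub_def)
  finally show ?thesis .
qed

text \<open>With \<open>r = 1\<close> this gives the order $1/n$ of the variance of a U-statistic, with \<open>r = 2\<close> the order
  $1/n^2$ of the remainder in its Hoeffding projection.\<close>

lemma (in prob_space) second_moment_subset_average:
  fixes G :: "nat set \<Rightarrow> 'a \<Rightarrow> real"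
  defines "Sub n k \<equiv> {I. I \<subseteq> {..<n::nat} \<and> card I = k}"
  assumes kn: "k \<le> n"
    and meas [measurable]: "\<And>I. I \<in> Sub n k \<Longrightarrow> G I \<in> borel_measurable M"
    and bd: "\<And>I z. I \<in> Sub n k \<Longrightarrow> \<bar>G I z\<bar> \<le> B"
    and orth: "\<And>I J. I \<in> Sub n k \<Longrightarrow> J \<in> Sub n k \<Longrightarrow> card (I \<inter> J) < r \<Longrightarrow> expectation (\<lambda>z. G I z * G J z) = 0"
  shows "expectation (\<lambda>z. ((\<Sum>I\<in>Sub n k. G I z) / real (n choose k))\<^sup>2) \<le> B\<^sup>2 * (real (k choose r))\<^sup>2 / real (n choose r)"
proof -
  have fin: "finite (Sub n k)" unfolding Sub_def by simp
  have int: "integrable M (\<lambda>z. G I z * G J z)" and bdIJ: "\<bar>expectation (\<lambda>z. G I z * G J z)\<bar> \<le> B\<^sup>2"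
    if "I \<in> Sub n k" "J \<in> Sub n k" for I J
  proof -
    have b: "\<bar>G I z * G J z\<bar> \<le> B\<^sup>2" for z
      unfolding abs_mult power2_eq_square using bd[OF that(1), of z] bd[OF that(2), of z]
      by (intro mult_mono) auto
    show i: "integrable M (\<lambda>z. G I z * G J z)"
      by (rule integrable_const_bound[of _ "B\<^sup>2"]) (use b that in auto)
    have "\<bar>expectation (\<lambda>z. G I z * G J z)\<bar> \<le> expectation (\<lambda>z. \<bar>G I z * G J z\<bar>)"
      by (rule integral_abs_bound)
    also have "\<dots> \<le> expectation (\<lambda>z. B\<^sup>2)"
      using i b by (intro integral_mono) auto
    finally show "\<bar>expectation (\<lambda>z. G I z * G J z)\<bar> \<le> B\<^sup>2" by (simp add: prob_space)
  qed
  define E where "E I J = expectation (\<lambda>z. G I z * G J z)" for I J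
  define Q where "Q = {(I, J) \<in> Sub n k \<times> Sub n k. r \<le> card (I \<inter> J)}"
  have "expectation (\<lambda>z. ((\<Sum>I\<in>Sub n k. G I z) / real (n choose k))\<^sup>2)
      = expectation (\<lambda>z. (\<Sum>I\<in>Sub n k. \<Sum>J\<in>Sub n k. G I z * G J z) / (real (n choose k))\<^sup>2)"
    by (simp add: power_divide power2_eq_square sum_product)
  also have "\<dots> = (\<Sum>I\<in>Sub n k. \<Sum>J\<in>Sub n k. E I J) / (real (n choose k))\<^sup>2"
    by (simp add: E_def int integral_sum)
  also have "(\<Sum>I\<in>Sub n k. \<Sum>J\<in>Sub n k. E I J) = (\<Sum>(I, J)\<in>Sub n k \<times> Sub n k. E I J)"
    by (rule sum.cartesian_product)
  also have "\<dots> = (\<Sum>(I, J)\<in>Q. E I J)"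
    by (rule sum.mono_neutral_right) (use orth fin in \<open>auto simp: Q_def E_def simp flip: not_less\<close>)
  also have "\<dots> \<le> (\<Sum>p\<in>Q. B\<^sup>2)"
  proof (rule sum_mono)
    fix p assume "p \<in> Q"
    then show "(case p of (I, J) \<Rightarrow> E I J) \<le> B\<^sup>2"
      using bdIJ by (auto simp: Q_def E_def dest!: abs_le_D1 split: prod.splits)
  qed
  also have "(\<Sum>p\<in>Q. B\<^sup>2) = real (card Q) * B\<^sup>2" by simp
  finally have *: "expectation (\<lambda>z. ((\<Sum>I\<in>Sub n k. G I z) / real (n choose k))\<^sup>2)
      \<le> real (card Q) * B\<^sup>2 / (real (n choose k))\<^sup>2"
    by (simp add: divide_right_mono)
  show ?thesis
  proof (cases "r \<le> k")
    case True
    define a b c d where "a = real (n choose r)" and "b = real ((n - r) choose (k - r))"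
      and "c = real (n choose k)" and "d = real (k choose r)"
    have pos: "a > 0" "c > 0" using True kn by (auto simp: a_def c_def)
    \<comment> \<open>Both sides count the pairs of an r-set inside a k-set of
      \<open>{..<n}\<close>. The identity turns the bound on \<open>card Q\<close> into the fraction
      (k choose r)^2 / (n choose r) of all pairs of k-sets.\<close>
    have "a * b = c * d"
      using choose_mult[of r k n] True kn unfolding a_def b_def c_def d_def
      by (simp flip: of_nat_mult)
    have "real (card Q) \<le> a * b\<^sup>2"
      using card_intersecting_pairs[of r k n] True kn unfolding a_def b_def Q_def Sub_def
      by (simp flip: of_nat_mult of_nat_power)
    also have "a * b\<^sup>2 = (a * b)\<^sup>2 / a" using pos by (simp add: power2_eq_square)
    also have "\<dots> = c\<^sup>2 * d\<^sup>2 / a" by (simp add: \<open>a * b = c * d\<close> power_mult_distrib)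
    finally have "real (card Q) * B\<^sup>2 / c\<^sup>2 \<le> c\<^sup>2 * d\<^sup>2 / a * B\<^sup>2 / c\<^sup>2"
      by (intro divide_right_mono mult_right_mono) auto
    also have "\<dots> = B\<^sup>2 * d\<^sup>2 / a" using pos by simp
    finally show ?thesis using * unfolding a_def c_def d_def by linarith
  next
    \<comment> \<open>A k-set cannot share r > k elements with another set, so no pair contributes,
      and \<open>k choose r\<close> is 0 as well. The case occurs for patterns of length 1 with r =
      2.\<close>
    case False
    have "card (I \<inter> J) \<le> k" if "I \<in> Sub n k" for I J
      using that card_mono[of I "I \<inter> J"] finite_subset[of I "{..<n}"] by (auto simp: Sub_def)
    then have "\<not> r \<le> card (I \<inter> J)" if "I \<in> Sub n k" for I J
      using False that by (meson order_trans)
    then have "Q = {}" by (auto simp: Q_def)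
    with * False show ?thesis by (simp add: binomial_eq_0)
  qed
qed

section \<open>Ranks and patterns\<close>


definition rank_in :: "('i \<Rightarrow> real) \<Rightarrow> 'i set \<Rightarrow> 'i \<Rightarrow> nat" where
  "rank_in u I i = card {j \<in> I. u j < u i}"

lemma rank_less_card: "finite I \<Longrightarrow> i \<in> I \<Longrightarrow> rank_in u I i < card I"
  unfolding rank_in_def by (rule psubset_card_mono) auto

lemma rank_less_iff:
  assumes "finite I" "i \<in> I" "j \<in> I"
  shows "rank_in u I i < rank_in u I j \<longleftrightarrow> u i < u j"
proof
  assume "u i < u j"
  then show "rank_in u I i < rank_in u I j"
    unfolding rank_in_def using assms by (intro psubset_card_mono) (auto intro: less_trans)
next
  assume *: "rank_in u I i < rank_in u I j"
  have "rank_in u I j \<le> rank_in u I i" if "u j \<le> u i"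
    unfolding rank_in_def using assms that by (intro card_mono) auto
  with * show "u i < u j" by (meson not_le)
qed

lemma bij_betw_rank:
  assumes "finite I" "inj_on u I"
  shows "bij_betw (rank_in u I) I {..<card I}"
proof -
  have "inj_on (rank_in u I) I"
  proof (rule inj_onI)
    fix i j assume "i \<in> I" "j \<in> I" "rank_in u I i = rank_in u I j"
    then have "\<not> u i < u j" "\<not> u j < u i"
      using rank_less_iff[OF assms(1), of i j u] rank_less_iff[OF assms(1), of j i u] by auto
    with \<open>i \<in> I\<close> \<open>j \<in> I\<close> show "i = j" using assms(2) by (auto dest: inj_onD)
  qed
  moreover have "rank_in u I ` I \<subseteq> {..<card I}"
    using rank_less_card[OF assms(1)] by auto
  ultimately show ?thesis
    unfolding bij_betw_def by (simp add: card_image card_subset_eq)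
qed

text \<open>f maps the points below i bijectively onto \<open>{..<f i}\<close>, so counting them
  returns f i. This is how the bijections in \<open>pattern\<close> are identified with
  ranks.\<close>

lemma rank_unique:
  assumes "finite I" and f: "bij_betw f I {..<card I}"
    and "\<And>i j. i \<in> I \<Longrightarrow> j \<in> I \<Longrightarrow> u i < u j \<longleftrightarrow> f i < f j" and i: "i \<in> I"
  shows "rank_in u I i = f i"
proof -
  have "f ` {j \<in> I. u j < u i} = {..<f i}"
  proof
    show "f ` {j \<in> I. u j < u i} \<subseteq> {..<f i}" using assms by auto
    show "{..<f i} \<subseteq> f ` {j \<in> I. u j < u i}"
    proof
      fix a assume a: "a \<in> {..<f i}"
      moreover have "f i \<in> {..<card I}" using i f by (auto simp: bij_betw_def)
      ultimately have "a \<in> {..<card I}" using a by simp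
      then have "a \<in> f ` I" using f by (simp add: bij_betw_def)
      then obtain j where "j \<in> I" "f j = a" by auto
      then show "a \<in> f ` {j \<in> I. u j < u i}" using a assms by auto
    qed
  qed
  moreover have "inj_on f {j \<in> I. u j < u i}"
    using f by (auto simp: bij_betw_def intro: inj_on_subset)
  ultimately have "card {j \<in> I. u j < u i} = card {..<f i}"
    by (metis card_image)
  then show ?thesis by (simp add: rank_in_def)
qed

lemma rank_reindex:
  assumes "inj_on \<phi> I" "i \<in> I"
  shows "rank_in u (\<phi> ` I) (\<phi> i) = rank_in (u \<circ> \<phi>) I i"
proof -
  have "{j \<in> \<phi> ` I. u j < u (\<phi> i)} = \<phi> ` {j \<in> I. (u \<circ> \<phi>) j < (u \<circ> \<phi>) i}" by auto
  moreover have "inj_on \<phi> {j \<in> I. (u \<circ> \<phi>) j < (u \<circ> \<phi>) i}"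
    using assms by (auto intro: inj_on_subset)
  ultimately show ?thesis by (simp add: rank_in_def card_image)
qed

lemma sorted_list_of_set_nth_card_less:
  assumes "finite A" "a \<in> A"
  shows "sorted_list_of_set A ! card {b \<in> A. b < a} = (a::nat)"
proof -
  let ?s = "sorted_list_of_set A"
  obtain i where i: "i < length ?s" "?s ! i = a"
    using assms by (metis in_set_conv_nth set_sorted_list_of_set)
  have inj: "inj_on (\<lambda>j. ?s ! j) {..<i}"
    using i by (auto simp: inj_on_def nth_eq_iff_index_eq)
  have sw: "sorted_wrt (<) ?s" using strict_sorted_list_of_set by blast
  have "{b \<in> A. b < a} = (\<lambda>j. ?s ! j) ` {..<i}"
  proof (intro equalityI subsetI)
    fix b assume b: "b \<in> {b \<in> A. b < a}"
    then obtain j where j: "j < length ?s" "?s ! j = b"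
      using assms by (metis (no_types, lifting) in_set_conv_nth mem_Collect_eq set_sorted_list_of_set)
    have "j < i"
    proof (rule ccontr)
      assume "\<not> j < i"
      then have "?s ! i \<le> ?s ! j"
        using sorted_nth_mono[of ?s i j] j by simp
      then show False using b i j by simp
    qed
    then show "b \<in> (\<lambda>j. ?s ! j) ` {..<i}" using j by auto
  next
    fix b assume "b \<in> (\<lambda>j. ?s ! j) ` {..<i}"
    then obtain j where j: "j < i" "b = ?s ! j" by auto
    then have "b < a" using sorted_wrt_nth_less[OF sw, of j i] i by simp
    moreover have "b \<in> A" using j i assms by (metis nth_mem less_trans set_sorted_list_of_set)
    ultimately show "b \<in> {b \<in> A. b < a}" by simp
  qed
  then have "card {b \<in> A. b < a} = i" using inj by (simp add: card_image)
  then show ?thesis using i by simp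
qed

section \<open>Patterns of points without ties\<close>

definition tie_free :: "'i set \<Rightarrow> ('i \<Rightarrow> real \<times> real) \<Rightarrow> bool" where
  "tie_free I z \<longleftrightarrow> inj_on (\<lambda>i. fst (z i)) I \<and> inj_on (\<lambda>i. snd (z i)) I"

text \<open>The pattern of the points indexed by \<open>I\<close>. It agrees with \<open>pattern\<close> when there are no ties, but
  unlike \<open>pattern\<close>, which is then \<open>THE\<close> on an empty predicate, it is false when there are ties; this
  makes it invariant under injective reindexing without an almost-everywhere clause.\<close>

definition occ :: "nat list \<Rightarrow> 'i set \<Rightarrow> ('i \<Rightarrow> real \<times> real) \<Rightarrow> bool" where
  "occ \<sigma> I z \<longleftrightarrow> tie_free I z \<and>
    (\<forall>i\<in>I. \<sigma> ! rank_in (\<lambda>i. fst (z i)) I i = rank_in (\<lambda>i. snd (z i)) I i)"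

lemma perms_bij_betw: "\<sigma> \<in> perms k \<Longrightarrow> bij_betw ((!) \<sigma>) {..<k} {..<k}"
proof -
  assume "\<sigma> \<in> perms k"
  then have l: "length \<sigma> = k" and s: "set \<sigma> = {..<k}" by (auto simp: perms_def)
  then have "distinct \<sigma>" by (intro card_distinct) simp
  then have "bij_betw ((!) \<sigma>) {..<length \<sigma>} (set \<sigma>)" by (rule bij_betw_nth) auto
  then show ?thesis by (simp add: l s)
qed

lemma finite_perms: "finite (perms k)"
  unfolding perms_def by (rule finite_subset[OF _ finite_lists_length_eq[of "{..<k}" k]]) auto

lemma card_perms: "card (perms k) = fact k"
proof -
  have "perms k = permutations_of_set {..<k}"
  proof (intro equalityI subsetI)
    fix xs assume "xs \<in> perms k"
    then show "xs \<in> permutations_of_set {..<k}"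
      by (intro permutations_of_setI card_distinct) (simp_all add: perms_def)
  next
    fix xs assume "xs \<in> permutations_of_set {..<k}"
    then have "set xs = {..<k}" "distinct xs" by (simp_all add: permutations_of_set_def)
    then show "xs \<in> perms k" using distinct_card[of xs] by (simp add: perms_def)
  qed
  then show ?thesis by simp
qed

text \<open>\<sigma> after the first rank is a bijection onto \<open>{..<card I}\<close>; if it
  orders the points as their second coordinates do, it equals the second rank by
  \<open>rank_unique\<close>. This links \<open>occ\<close> to the order conditions in
  \<open>pattern\<close> and \<open>order_iso\<close>.\<close>

lemma occ_iff_order:
  assumes "finite I" "\<sigma> \<in> perms (card I)" "tie_free I z"
  shows "occ \<sigma> I z \<longleftrightarrow> (\<forall>i\<in>I. \<forall>j\<in>I. snd (z i) < snd (z j) \<longleftrightarrow>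
    \<sigma> ! rank_in (\<lambda>i. fst (z i)) I i < \<sigma> ! rank_in (\<lambda>i. fst (z i)) I j)"
proof
  assume "occ \<sigma> I z"
  then show "\<forall>i\<in>I. \<forall>j\<in>I. snd (z i) < snd (z j) \<longleftrightarrow>
      \<sigma> ! rank_in (\<lambda>i. fst (z i)) I i < \<sigma> ! rank_in (\<lambda>i. fst (z i)) I j"
    using rank_less_iff[OF assms(1), of _ _ "\<lambda>i. snd (z i)"] by (simp add: occ_def)
next
  assume *: "\<forall>i\<in>I. \<forall>j\<in>I. snd (z i) < snd (z j) \<longleftrightarrow>
      \<sigma> ! rank_in (\<lambda>i. fst (z i)) I i < \<sigma> ! rank_in (\<lambda>i. fst (z i)) I j"
  have "bij_betw (\<lambda>i. \<sigma> ! rank_in (\<lambda>i. fst (z i)) I i) I {..<card I}"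
    using bij_betw_trans[OF bij_betw_rank perms_bij_betw[OF assms(2)], of "\<lambda>i. fst (z i)"] assms
    by (simp add: tie_free_def comp_def)
  then have "rank_in (\<lambda>i. snd (z i)) I i = \<sigma> ! rank_in (\<lambda>i. fst (z i)) I i" if "i \<in> I" for i
    by (rule rank_unique[OF assms(1)]) (use * that in auto)
  then show "occ \<sigma> I z" using assms by (simp add: occ_def)
qed

lemma occ_unique:
  assumes "finite I" "\<sigma> \<in> perms (card I)" "\<tau> \<in> perms (card I)" "occ \<sigma> I z" "occ \<tau> I z"
  shows "\<sigma> = \<tau>"
proof (rule nth_equalityI)
  show "length \<sigma> = length \<tau>" using assms by (simp add: perms_def)
  fix a assume "a < length \<sigma>"
  then have "a \<in> {..<card I}" using assms by (simp add: perms_def)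
  moreover have "rank_in (\<lambda>i. fst (z i)) I ` I = {..<card I}"
    using bij_betw_rank[of I "\<lambda>i. fst (z i)"] assms by (simp add: bij_betw_def occ_def tie_free_def)
  ultimately obtain i where "i \<in> I" "a = rank_in (\<lambda>i. fst (z i)) I i"
    by (metis imageE)
  then show "\<sigma> ! a = \<tau> ! a" using assms by (simp add: occ_def)
qed

lemma occ_exists:
  assumes "finite I" "tie_free I z"
  shows "\<exists>\<sigma>\<in>perms (card I). occ \<sigma> I z"
proof -
  let ?u = "rank_in (\<lambda>i. fst (z i)) I" and ?v = "rank_in (\<lambda>i. snd (z i)) I"
  have u: "bij_betw ?u I {..<card I}" and v: "bij_betw ?v I {..<card I}"
    using assms by (auto intro!: bij_betw_rank simp: tie_free_def)
  \<comment> \<open>The only possible choice: the second rank after the inverse of the first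
    rank.\<close>
  define \<sigma> where "\<sigma> = map (\<lambda>a. ?v (inv_into I ?u a)) [0..<card I]"
  have nth: "\<sigma> ! ?u i = ?v i" if "i \<in> I" for i
    using that u rank_less_card[OF assms(1) that] by (simp add: \<sigma>_def bij_betw_inv_into_left)
  have "set \<sigma> = ?v ` inv_into I ?u ` {..<card I}"
    by (auto simp: \<sigma>_def image_image lessThan_atLeast0)
  also have "\<dots> = {..<card I}"
    using bij_betw_inv_into[OF u] v by (simp add: bij_betw_def)
  finally have "\<sigma> \<in> perms (card I)" by (simp add: perms_def \<sigma>_def)
  then show ?thesis using nth assms(2) by (auto simp: occ_def)
qed

lemma tie_free_reindex: "inj_on \<phi> I \<Longrightarrow> tie_free (\<phi> ` I) z \<longleftrightarrow> tie_free I (z \<circ> \<phi>)"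
  by (auto simp: tie_free_def comp_def inj_on_def)

lemma occ_reindex:
  assumes "inj_on \<phi> I"
  shows "occ \<sigma> (\<phi> ` I) z \<longleftrightarrow> occ \<sigma> I (z \<circ> \<phi>)"
  using rank_reindex[OF assms] tie_free_reindex[OF assms]
  by (simp add: occ_def comp_def)

lemma occ_cong:
  assumes "\<And>i. i \<in> I \<Longrightarrow> z i = z' i"
  shows "occ \<sigma> I z \<longleftrightarrow> occ \<sigma> I z'"
proof -
  have "rank_in (\<lambda>i. fst (z i)) I i = rank_in (\<lambda>i. fst (z' i)) I i"
    "rank_in (\<lambda>i. snd (z i)) I i = rank_in (\<lambda>i. snd (z' i)) I i" if "i \<in> I" for i
    using assms that unfolding rank_in_def by (metis (mono_tags, lifting))+
  moreover have "tie_free I z = tie_free I z'"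
    using assms by (simp add: tie_free_def inj_on_def)
  ultimately show ?thesis by (simp add: occ_def)
qed

text \<open>The existential bijection must be the rank in the first coordinate, and \<pi> after it
  the rank in the second. Its existence excludes ties, because points with equal coordinates would
  have equal images.\<close>

lemma pattern_cond_iff_occ:
  assumes "\<pi> \<in> perms n"
  shows "(\<exists>f. bij_betw f {..<n} {..<n} \<and>
        (\<forall>i<n. \<forall>j<n. (fst (z i) < fst (z j) \<longleftrightarrow> f i < f j) \<and>
                      (snd (z i) < snd (z j) \<longleftrightarrow> \<pi> ! (f i) < \<pi> ! (f j)))) \<longleftrightarrow> occ \<pi> {..<n} z"
    (is "(\<exists>f. ?P f) \<longleftrightarrow> _")
proof
  assume "\<exists>f. ?P f"
  then obtain f where f: "bij_betw f {..<n} {..<n}" and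
    u: "\<And>i j. i < n \<Longrightarrow> j < n \<Longrightarrow> fst (z i) < fst (z j) \<longleftrightarrow> f i < f j" and
    v: "\<And>i j. i < n \<Longrightarrow> j < n \<Longrightarrow> snd (z i) < snd (z j) \<longleftrightarrow> \<pi> ! (f i) < \<pi> ! (f j)" by auto
  have g: "bij_betw (\<lambda>i. \<pi> ! f i) {..<n} {..<n}"
    using bij_betw_trans[OF f perms_bij_betw[OF assms]] by (simp add: comp_def)
  have "inj_on (\<lambda>i. fst (z i)) {..<n}"
  proof (rule inj_onI)
    fix i j assume "i \<in> {..<n}" "j \<in> {..<n}" "fst (z i) = fst (z j)"
    then have "f i = f j" using u[of i j] u[of j i] by simp
    then show "i = j" using f \<open>i \<in> {..<n}\<close> \<open>j \<in> {..<n}\<close> by (auto simp: bij_betw_def dest: inj_onD)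
  qed
  moreover have "inj_on (\<lambda>i. snd (z i)) {..<n}"
  proof (rule inj_onI)
    fix i j assume "i \<in> {..<n}" "j \<in> {..<n}" "snd (z i) = snd (z j)"
    then have "\<pi> ! f i = \<pi> ! f j" using v[of i j] v[of j i] by simp
    then show "i = j" using g \<open>i \<in> {..<n}\<close> \<open>j \<in> {..<n}\<close> by (auto simp: bij_betw_def dest: inj_onD)
  qed
  moreover have "rank_in (\<lambda>i. fst (z i)) {..<n} i = f i" if "i < n" for i
    by (rule rank_unique) (use f u that in auto)
  moreover have "rank_in (\<lambda>i. snd (z i)) {..<n} i = \<pi> ! f i" if "i < n" for i
    by (rule rank_unique) (use g v that in auto)
  ultimately show "occ \<pi> {..<n} z" by (simp add: occ_def tie_free_def)
next
  assume o: "occ \<pi> {..<n} z"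
  then have "bij_betw (rank_in (\<lambda>i. fst (z i)) {..<n}) {..<n} {..<n}"
    using bij_betw_rank[of "{..<n}" "\<lambda>i. fst (z i)"] by (simp add: occ_def tie_free_def)
  then show "\<exists>f. ?P f"
    using o occ_iff_order[of "{..<n}" \<pi> z] assms rank_less_iff[of "{..<n}" _ _ "\<lambda>i. fst (z i)"]
    by (intro exI[of _ "rank_in (\<lambda>i. fst (z i)) {..<n}"]) (simp add: occ_def)
qed

lemma pattern_alt: "pattern n z = (THE \<pi>. \<pi> \<in> perms n \<and> occ \<pi> {..<n} z)"
  unfolding pattern_def using pattern_cond_iff_occ[of _ n z] by (metis (no_types, lifting))

lemma pattern_tie_free:
  assumes "tie_free {..<n} z"
  shows "pattern n z \<in> perms n" "occ (pattern n z) {..<n} z"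
proof -
  have "\<exists>!\<pi>. \<pi> \<in> perms n \<and> occ \<pi> {..<n} z"
    using occ_exists[of "{..<n}" z] occ_unique[of "{..<n}" _ _ z] assms by auto
  from theI'[OF this] show "pattern n z \<in> perms n" "occ (pattern n z) {..<n} z"
    by (simp_all add: pattern_alt)
qed

lemma pattern_eq_iff:
  assumes "tie_free {..<n} z" "\<sigma> \<in> perms n"
  shows "pattern n z = \<sigma> \<longleftrightarrow> occ \<sigma> {..<n} z"
  using pattern_tie_free[OF assms(1)] assms(2) occ_unique[of "{..<n}"] by auto

lemma pattern_tie:
  assumes "\<not> tie_free {..<n} z"
  shows "pattern n z = (THE \<pi>. False)"
  using assms by (simp add: pattern_alt occ_def)

lemma pattern_cong:
  assumes "\<And>i. i < n \<Longrightarrow> z i = z' i"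
  shows "pattern n z = pattern n z'"
proof -
  have "occ \<pi> {..<n} z \<longleftrightarrow> occ \<pi> {..<n} z'" for \<pi> by (rule occ_cong) (use assms in auto)
  then show ?thesis by (simp add: pattern_alt)
qed

lemma tie_free_subset: "tie_free I z \<Longrightarrow> J \<subseteq> I \<Longrightarrow> tie_free J z"
  by (auto simp: tie_free_def intro: inj_on_subset)

text \<open>F sends a sample index to its position in the permutation. The point with rank a inside
  J occupies the a-th smallest position in the image of J, so both sides compare \<sigma> with the
  same order of second coordinates.\<close>

lemma order_iso_sorted_iff_occ:
  assumes z: "tie_free {..<n} z" and \<pi>: "\<pi> \<in> perms n" "occ \<pi> {..<n} z"
    and J: "J \<subseteq> {..<n}" and \<sigma>: "\<sigma> \<in> perms (card J)"
  defines "F \<equiv> rank_in (\<lambda>i. fst (z i)) {..<n}"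
  shows "order_iso (map (\<lambda>i. \<pi> ! i) (sorted_list_of_set (F ` J))) \<sigma> \<longleftrightarrow> occ \<sigma> J z"
proof -
  have fin: "finite J" using J finite_subset by blast
  let ?s = "sorted_list_of_set (F ` J)" and ?r = "rank_in (\<lambda>i. fst (z i)) J"
  have zJ: "tie_free J z" using z J by (rule tie_free_subset)
  have F: "bij_betw F {..<n} {..<n}"
    using bij_betw_rank[of "{..<n}" "\<lambda>i. fst (z i)"] z by (simp add: F_def tie_free_def)
  have injF: "inj_on F J" using F J by (auto simp: bij_betw_def intro: inj_on_subset)
  have r: "bij_betw ?r J {..<card J}"
    using bij_betw_rank[of J "\<lambda>i. fst (z i)"] zJ fin by (simp add: tie_free_def)
  have less: "F i < F j \<longleftrightarrow> fst (z i) < fst (z j)" if "i \<in> J" "j \<in> J" for i j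
    using rank_less_iff[of "{..<n}" i j "\<lambda>i. fst (z i)"] that J by (auto simp: F_def)
  have s_nth: "?s ! ?r i = F i" if "i \<in> J" for i
  proof -
    have "{b \<in> F ` J. b < F i} = F ` {j \<in> J. fst (z j) < fst (z i)}"
      using less that by auto
    then have "card {b \<in> F ` J. b < F i} = ?r i"
      using injF by (simp add: rank_in_def card_image inj_on_subset)
    then show ?thesis using sorted_list_of_set_nth_card_less[of "F ` J" "F i"] fin that by simp
  qed
  have \<pi>F: "\<pi> ! F i = rank_in (\<lambda>i. snd (z i)) {..<n} i" if "i \<in> J" for i
    using \<pi> that J by (auto simp: occ_def F_def)
  have \<pi>less: "\<pi> ! F i < \<pi> ! F j \<longleftrightarrow> snd (z i) < snd (z j)" if "i \<in> J" "j \<in> J" for i j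
    using rank_less_iff[of "{..<n}" i j "\<lambda>i. snd (z i)"] that J by (simp add: \<pi>F subset_eq)
  have len: "length ?s = card J" "length \<sigma> = card J"
    using injF \<sigma> by (simp_all add: card_image perms_def)
  have "order_iso (map (\<lambda>i. \<pi> ! i) ?s) \<sigma> \<longleftrightarrow>
      (\<forall>a\<in>{..<card J}. \<forall>b\<in>{..<card J}. \<pi> ! (?s ! a) < \<pi> ! (?s ! b) \<longleftrightarrow> \<sigma> ! a < \<sigma> ! b)"
    using len by (auto simp: order_iso_def)
  also have "{..<card J} = ?r ` J" using r by (simp add: bij_betw_def)
  also have "(\<forall>a\<in>?r ` J. \<forall>b\<in>?r ` J. \<pi> ! (?s ! a) < \<pi> ! (?s ! b) \<longleftrightarrow> \<sigma> ! a < \<sigma> ! b) \<longleftrightarrow>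
     (\<forall>i\<in>J. \<forall>j\<in>J. snd (z i) < snd (z j) \<longleftrightarrow> \<sigma> ! ?r i < \<sigma> ! ?r j)"
    by (simp add: s_nth \<pi>less)
  also have "\<dots> \<longleftrightarrow> occ \<sigma> J z" using occ_iff_order[OF fin \<sigma> zJ] by simp
  finally show ?thesis .
qed

text \<open>Taking images under the first rank is a bijection between k-sets of sample indices and
  k-sets of positions. So the pattern density, a function of the ranks only, is a U-statistic of the
  sample.\<close>

lemma pdens_pattern:
  assumes z: "tie_free {..<n} z" and \<sigma>: "\<sigma> \<in> perms k"
  shows "pdens (pattern n z) \<sigma> = (\<Sum>I | I \<subseteq> {..<n} \<and> card I = k. of_bool (occ \<sigma> I z)) / real (n choose k)"
proof -
  let ?\<pi> = "pattern n z"
  note \<pi> = pattern_tie_free[OF z]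
  have len: "length ?\<pi> = n" "length \<sigma> = k" using \<pi> \<sigma> by (auto simp: perms_def)
  define F where "F = rank_in (\<lambda>i. fst (z i)) {..<n}"
  have F: "bij_betw F {..<n} {..<n}"
    using bij_betw_rank[of "{..<n}" "\<lambda>i. fst (z i)"] z by (simp add: F_def tie_free_def)
  have cardF: "card (F ` J) = card J" if "J \<subseteq> {..<n}" for J
    using F that by (auto simp: bij_betw_def intro!: card_image intro: inj_on_subset)
  have iso: "order_iso (map (\<lambda>i. ?\<pi> ! i) (sorted_list_of_set (F ` J))) \<sigma> \<longleftrightarrow> occ \<sigma> J z"
    if "J \<subseteq> {..<n}" "card J = k" for J
    using order_iso_sorted_iff_occ[OF z \<pi> that(1), of \<sigma>] that \<sigma> by (simp add: F_def)
  let ?A = "{J. J \<subseteq> {..<n} \<and> card J = k \<and> occ \<sigma> J z}"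
  let ?B = "{I. I \<subseteq> {..<n} \<and> card I = k \<and> order_iso (map (\<lambda>i. ?\<pi> ! i) (sorted_list_of_set I)) \<sigma>}"
  have img: "(`) F ` ?A = ?B"
  proof (intro equalityI subsetI)
    fix I assume "I \<in> (`) F ` ?A"
    then obtain J where J: "J \<subseteq> {..<n}" "card J = k" "occ \<sigma> J z" "I = F ` J" by auto
    moreover have "F ` J \<subseteq> {..<n}" using J F by (auto simp: bij_betw_def)
    ultimately show "I \<in> ?B" using iso cardF by auto
  next
    fix I assume I: "I \<in> ?B"
    then obtain J where "J \<subseteq> {..<n}" "I = F ` J"
      using F by (metis (no_types, lifting) bij_betw_def mem_Collect_eq subset_image_iff)
    then show "I \<in> (`) F ` ?A" using I iso cardF by auto
  qed
  have "inj_on ((`) F) ?A"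
    using F inj_on_image_Pow[of F "{..<n}"] by (auto simp: bij_betw_def elim: inj_on_subset)
  then have "card ((`) F ` ?A) = card ?A" by (rule card_image)
  then have "card ?B = card ?A" by (simp only: img)
  also have "real (card ?A) = (\<Sum>I | I \<subseteq> {..<n} \<and> card I = k. of_bool (occ \<sigma> I z))"
    by (simp add: sum.If_cases of_bool_def Int_def conj_assoc)
  finally show ?thesis by (simp add: pdens_def len)
qed

section \<open>Pattern statistics of a copula sample\<close>


lemma borel_measurable_fst_real [measurable]: "fst \<in> borel_measurable (borel :: (real \<times> real) measure)"
  and borel_measurable_snd_real [measurable]: "snd \<in> borel_measurable (borel :: (real \<times> real) measure)"
  by (intro borel_measurable_continuous_onI continuous_intros)+

lemma measurable_tie_free:
  fixes N :: "(nat \<Rightarrow> real \<times> real) measure"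
  assumes "finite I" and [measurable]: "\<And>i. i \<in> I \<Longrightarrow> (\<lambda>z. z i) \<in> borel_measurable N"
  shows "Measurable.pred N (\<lambda>z. tie_free I z)"
proof -
  have m: "(\<lambda>z. fst (z i)) \<in> borel_measurable N" "(\<lambda>z. snd (z i)) \<in> borel_measurable N" if "i \<in> I" for i
    using that by (auto intro!: measurable_compose[OF assms(2)])
  have [measurable]: "Measurable.pred N (\<lambda>z. fst (z i) = fst (z j))"
    "Measurable.pred N (\<lambda>z. snd (z i) = snd (z j))" if "i \<in> I" "j \<in> I" for i j
    using that m by (auto simp: pred_def)
  show ?thesis
    unfolding tie_free_def inj_on_def using assms(1) by measurable
qed

lemma measurable_occ:
  fixes N :: "(nat \<Rightarrow> real \<times> real) measure"
  assumes "finite I" and [measurable]: "\<And>i. i \<in> I \<Longrightarrow> (\<lambda>z. z i) \<in> borel_measurable N"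
  shows "Measurable.pred N (\<lambda>z. occ \<sigma> I z)"
proof -
  note measurable_tie_free[OF assms, measurable]
  have rank [measurable]: "(\<lambda>z. rank_in (\<lambda>j. q (z j)) I i) \<in> measurable N (count_space UNIV)"
    if i: "i \<in> I" and [measurable]: "q \<in> borel_measurable borel" for i and q :: "real \<times> real \<Rightarrow> real"
  proof -
    have "Measurable.pred N (\<lambda>z. j \<in> {j \<in> I. q (z j) < q (z i)})" for j
    proof (cases "j \<in> I")
      case True then show ?thesis using i by measurable
    qed simp
    then have "(\<lambda>z. card {j \<in> I. q (z j) < q (z i)}) \<in> measurable N (count_space UNIV)"
      by (intro measurable_card) (auto simp: pred_def)
    then show ?thesis by (simp add: rank_in_def)
  qed
  note rank[OF _ borel_measurable_fst_real, measurable] rank[OF _ borel_measurable_snd_real, measurable]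
  show ?thesis
    unfolding occ_def using assms(1) by measurable
qed

text \<open>Reindexing the infinite product needs an injection defined on all natural numbers, hence
  the continuation past \<open>Max I\<close>. The transposition moves the distinguished i to 0, the
  coordinate that \<open>first_proj\<close> holds fixed.\<close>

lemma ex_inj_enumeration:
  assumes "finite I" "card I = k" "i \<in> I"
  shows "\<exists>\<phi>::nat \<Rightarrow> nat. inj \<phi> \<and> \<phi> ` {..<k} = I \<and> \<phi> 0 = i"
proof -
  obtain e where e: "bij_betw e {0..<k} I"
    using ex_bij_betw_nat_finite[OF assms(1)] assms(2) by auto
  obtain a where a: "a < k" "e a = i" using e assms(3) by (auto simp: bij_betw_def)
  define f where "f = e \<circ> Transposition.transpose 0 a"
  have "bij_betw (Transposition.transpose 0 a) {0..<k} {0..<k}"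
    using a by (intro bij_betwI[where g = "Transposition.transpose 0 a"])
      (auto simp: Transposition.transpose_def)
  then have f: "bij_betw f {0..<k} I" unfolding f_def by (rule bij_betw_trans) (rule e)
  have f0: "f 0 = i" using a by (simp add: f_def)
  define \<phi> where "\<phi> j = (if j < k then f j else Suc (Max I) + j)" for j
  have le: "f j \<le> Max I" if "j < k" for j
    using f assms(1) that by (intro Max_ge) (auto simp: bij_betw_def)
  have "inj \<phi>"
  proof (rule injI)
    fix x y assume *: "\<phi> x = \<phi> y"
    show "x = y"
    proof (cases "x < k"; cases "y < k")
      assume "x < k" "y < k"
      then show ?thesis using * f by (auto simp: \<phi>_def bij_betw_def dest: inj_onD)
    qed (use * le[of x] le[of y] in \<open>auto simp: \<phi>_def\<close>)
  qed
  moreover have "\<phi> ` {..<k} = f ` {0..<k}" by (auto simp: \<phi>_def)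
  moreover have "\<phi> 0 = i" using a f0 by (simp add: \<phi>_def)
  ultimately show ?thesis using f by (auto simp: bij_betw_def)
qed

text \<open>Each i lies in \<open>(n - 1) choose (k - 1)\<close> of the k-sets. Applied to the
  projected kernels, this produces the factor k / n of the linear term in the Hoeffding
  decomposition.\<close>

lemma sum_over_subsets:
  fixes a :: "nat \<Rightarrow> real"
  assumes "1 \<le> k" "k \<le> n"
  shows "(\<Sum>I | I \<subseteq> {..<n} \<and> card I = k. \<Sum>i\<in>I. a i) = real (n choose k) * (real k / real n) * (\<Sum>i<n. a i)"
proof -
  let ?S = "{I. I \<subseteq> {..<n} \<and> card I = k}"
  have "(\<Sum>I\<in>?S. \<Sum>i\<in>I. a i) = (\<Sum>I\<in>?S. \<Sum>i<n. of_bool (i \<in> I) * a i)"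
    by (intro sum.cong refl sum.mono_neutral_cong_left) auto
  also have "\<dots> = (\<Sum>i<n. \<Sum>I\<in>?S. of_bool (i \<in> I) * a i)" by (rule sum.swap)
  also have "\<dots> = (\<Sum>i<n. real ((n - 1) choose (k - 1)) * a i)"
  proof (rule sum.cong)
    fix i assume "i \<in> {..<n}"
    then have "card {I \<in> ?S. i \<in> I} = (n - 1) choose (k - 1)"
      using card_subsets_superset[of "{i}" n 1 k] assms by (simp add: conj_assoc)
    then show "(\<Sum>I\<in>?S. of_bool (i \<in> I) * a i) = real ((n - 1) choose (k - 1)) * a i"
      by (simp add: sum_distrib_right[symmetric] sum.If_cases of_bool_def Int_def)
  qed simp
  also have "real ((n - 1) choose (k - 1)) = real (n choose k) * (real k / real n)"
    using times_binomial_minus1_eq[of k n] assms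
    by (simp add: field_simps flip: of_nat_mult)
  finally show ?thesis by (simp add: sum_distrib_left)
qed

section \<open>Absence of ties, measurability and the passage to finite samples\<close>

locale copula_sample =
  fixes \<mu> :: "(real \<times> real) measure"
  assumes copula: "copula_measure \<mu>"
begin

lemma sets_mu [measurable_cong]: "sets \<mu> = sets borel"
  using copula by (simp add: copula_measure_def)

sublocale iid_sequence \<mu>
proof -
  interpret prob_space \<mu> using copula by (simp add: copula_measure_def)
  show "iid_sequence \<mu>"
    by unfold_locales (use sets_eq_imp_space_eq[OF sets_mu] in simp)
qed

lemma prob_P_UNIV: "P.prob UNIV = 1"
  using P.prob_space by simp

lemma sets_Collect_P: "Measurable.pred P Q \<Longrightarrow> {z. Q z} \<in> sets P"
  by (simp add: pred_def)

lemma measurable_coord_borel [measurable]: "(\<lambda>z. z i) \<in> borel_measurable P"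
  using measurable_coord[of i] by (simp cong: measurable_cong_sets add: sets_mu)

text \<open>Covers \<open>fst\<close> and \<open>snd\<close> at once, so that the facts on ties and
  ranks are proved for one real coordinate.\<close>

definition uniform_projection :: "(real \<times> real \<Rightarrow> real) \<Rightarrow> bool" where
  "uniform_projection q \<longleftrightarrow> q \<in> borel_measurable borel \<and> distr \<mu> lborel q = uniform_measure lborel {0..1}"

lemma uniform_projection_fst: "uniform_projection fst"
  and uniform_projection_snd: "uniform_projection snd"
  using copula by (auto simp: uniform_projection_def copula_measure_def)

lemma measure_uniform_projection:
  assumes "uniform_projection q" and [measurable]: "A \<in> sets borel"
  shows "measure \<mu> {x. q x \<in> A} = measure lborel ({0..1} \<inter> A)"
proof -
  have [measurable]: "q \<in> borel_measurable borel" "q \<in> borel_measurable \<mu>"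
    using assms measurable_cong_sets[OF sets_mu refl] by (auto simp: uniform_projection_def)
  have "measure \<mu> {x. q x \<in> A} = measure (distr \<mu> lborel q) A"
    by (subst measure_distr) (auto simp: space_base vimage_def)
  also have "\<dots> = measure lborel ({0..1} \<inter> A)"
    using assms by (simp add: uniform_projection_def measure_uniform_measure)
  finally show ?thesis .
qed

text \<open>Only coordinate j is resampled: given z i, a tie means that a uniform variable hits a
  fixed number.\<close>

lemma AE_no_tie:
  assumes q: "uniform_projection q" and "i \<noteq> j"
  shows "AE z in P. q (z i) \<noteq> q (z j)"
proof -
  have [measurable]: "q \<in> borel_measurable borel" "q \<in> borel_measurable \<mu>"
    using assms measurable_cong_sets[OF sets_mu refl] by (auto simp: uniform_projection_def)
  define f where "f z = (of_bool (q (z i) = q (z j)) :: real)" for z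
  have q_coord: "(\<lambda>z. q (z i)) \<in> borel_measurable P" for i
    by (rule measurable_compose[OF measurable_coord_borel]) measurable
  have [measurable]: "Measurable.pred P (\<lambda>z. q (z i) = q (z j))"
    using borel_measurable_eq[OF q_coord[of i] q_coord[of j]] by (simp add: pred_def)
  have [measurable]: "f \<in> borel_measurable P" unfolding f_def by measurable
  have "(\<integral>z. f z \<partial>P) = (\<integral>z. \<integral>z'. f (mix {j} z z') \<partial>P \<partial>P)"
    by (rule integral_mix[where B = 1]) (auto simp: f_def)
  also have "(\<lambda>z. \<integral>z'. f (mix {j} z z') \<partial>P) = (\<lambda>z. 0)"
  proof
    fix z
    have "(\<integral>z'. f (mix {j} z z') \<partial>P) = (\<integral>z'. indicator {x. q x \<in> {q (z i)}} (z' j) \<partial>P)"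
      using \<open>i \<noteq> j\<close> by (intro Bochner_Integration.integral_cong) (auto simp: f_def mix_def indicator_def)
    also have "\<dots> = (\<integral>x. indicator {x. q x \<in> {q (z i)}} x \<partial>\<mu>)"
      by (rule integral_coord) measurable
    also have "\<dots> = measure \<mu> {x. q x \<in> {q (z i)}}" by (simp add: space_base)
    also have "\<dots> = 0"
      by (subst measure_uniform_projection[OF q]) (auto simp: measure_def emeasure_lborel_countable)
    finally show "(\<integral>z'. f (mix {j} z z') \<partial>P) = 0" .
  qed
  finally have "(\<integral>z. f z \<partial>P) = 0" by simp
  then have "AE z in P. f z = 0"
    by (subst (asm) integral_nonneg_eq_0_iff_AE) (auto simp: f_def intro!: P.integrable_const_bound[where B = 1])
  then show ?thesis by eventually_elim (auto simp: f_def)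
qed

lemma AE_tie_free: "finite I \<Longrightarrow> AE z in P. tie_free I z"
proof -
  assume I: "finite I"
  have "AE z in P. fst (z i) = fst (z j) \<longrightarrow> i = j" "AE z in P. snd (z i) = snd (z j) \<longrightarrow> i = j" for i j
    using AE_no_tie[OF uniform_projection_fst, of i j] AE_no_tie[OF uniform_projection_snd, of i j]
    by (cases "i = j"; simp)+
  then have "AE z in P. \<forall>i\<in>I. \<forall>j\<in>I. (fst (z i) = fst (z j) \<longrightarrow> i = j) \<and> (snd (z i) = snd (z j) \<longrightarrow> i = j)"
    using I by (simp add: AE_finite_all)
  then show ?thesis by eventually_elim (auto simp: tie_free_def inj_on_def)
qed

lemma measurable_occ_P [measurable]: "finite I \<Longrightarrow> Measurable.pred P (\<lambda>z. occ \<sigma> I z)"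
  by (rule measurable_occ) auto

text \<open>Lists of naturals form a countable type, so singletons suffice; with ties the value is
  unspecified but the same for all z, by \<open>pattern_tie\<close>. N is arbitrary because the
  finite samples and \<open>P\<close> both need the fact.\<close>

lemma measurable_pattern:
  assumes "\<And>i. i < n \<Longrightarrow> (\<lambda>z. z i) \<in> borel_measurable N"
  shows "pattern n \<in> measurable N (count_space UNIV)"
proof -
  have t: "Measurable.pred N (\<lambda>z. tie_free {..<n} z)" and o: "Measurable.pred N (\<lambda>z. occ \<sigma> {..<n} z)" for \<sigma>
    by (intro measurable_tie_free measurable_occ; use assms in auto)+
  have "Measurable.pred N (\<lambda>z. pattern n z = \<pi>)" for \<pi>
  proof -
    have "pattern n z = \<pi> \<longleftrightarrow> (if tie_free {..<n} z then \<pi> \<in> perms n \<and> occ \<pi> {..<n} z else \<pi> = (THE \<pi>. False))" for z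
      using pattern_tie_free[of n z] pattern_eq_iff[of n z \<pi>] pattern_tie[of n z] by auto
    then show ?thesis using t o by simp
  qed
  then have "pattern n -` {\<pi>} \<inter> space N \<in> sets N" for \<pi>
    by (simp add: pred_def vimage_def Int_def conj_commute)
  then show ?thesis
    by (subst measurable_count_space_eq_countable) auto
qed

lemma measurable_pattern_P [measurable]: "pattern n \<in> measurable P (count_space UNIV)"
  by (rule measurable_pattern) auto

text \<open>The finite product is the image of \<open>P\<close> under restriction. Invariance of Q
  under restriction lets the same formula be read on both spaces.\<close>

lemma measure_finite_sample:
  assumes S: "S = PiM {..<n} (\<lambda>_. \<mu>)" and meas: "Measurable.pred S Q"
    and Q: "\<And>z. Q (restrict z {..<n}) \<longleftrightarrow> Q z"
  shows "measure S {z \<in> space S. Q z} = P.prob {z. Q z}"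
proof -
  have "S = distr P S (\<lambda>\<omega>. restrict \<omega> {..<n})"
    using prod.distr_PiM_restrict_finite[of "{..<n}"] S by (simp add: P_def)
  then have "measure S {z \<in> space S. Q z} = measure (distr P S (\<lambda>\<omega>. restrict \<omega> {..<n})) {z \<in> space S. Q z}"
    by simp
  also have "\<dots> = P.prob ((\<lambda>\<omega>. restrict \<omega> {..<n}) -` {z \<in> space S. Q z} \<inter> space P)"
  proof (rule measure_distr)
    show "(\<lambda>\<omega>. restrict \<omega> {..<n}) \<in> measurable P S"
      unfolding S P_def by (rule measurable_restrict_subset) auto
    show "{z \<in> space S. Q z} \<in> sets S" using meas by (simp add: pred_def)
  qed
  also have "(\<lambda>\<omega>. restrict \<omega> {..<n}) -` {z \<in> space S. Q z} \<inter> space P = {z. Q z}"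
    using Q by (auto simp: S space_PiM space_base)
  finally show ?thesis .
qed

lemma measure_pattern:
  assumes S: "S = PiM {..<n} (\<lambda>_. \<mu>)"
  shows "measure S {z \<in> space S. Q (pattern n z)} = P.prob {z. Q (pattern n z)}"
proof (rule measure_finite_sample[OF S])
  have "pattern n \<in> measurable S (count_space UNIV)"
  proof (rule measurable_pattern)
    fix i assume "i < n"
    then have "(\<lambda>z. z i) \<in> measurable S \<mu>" by (simp add: S)
    then show "(\<lambda>z. z i) \<in> borel_measurable S" by (simp add: measurable_cong_sets[OF refl sets_mu])
  qed
  then show "Measurable.pred S (\<lambda>z. Q (pattern n z))"
    by (rule measurable_compose) simp
  show "Q (pattern n (restrict z {..<n})) \<longleftrightarrow> Q (pattern n z)" for z
    by (rule arg_cong[of _ _ Q], rule pattern_cong) auto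
qed

text \<open>\<open>\<theta>\<close> and, below, \<open>\<kappa>\<close> are $C^{S}(\sigma)$ and $C^{S,2}(\sigma,\sigma) - C^{S}(\sigma)^2$ on
  the infinite product space.\<close>

definition \<theta> :: "nat list \<Rightarrow> real" where
  "\<theta> \<sigma> = P.prob {z. occ \<sigma> {..<length \<sigma>} z}"

section \<open>Hoeffding projection of the pattern indicators\<close>

definition hit :: "nat list \<Rightarrow> nat set \<Rightarrow> (nat \<Rightarrow> real \<times> real) \<Rightarrow> real" where
  "hit \<sigma> I z = of_bool (occ \<sigma> I z)"

text \<open>The conditional probability of \<sigma> given that sample point 0 equals x; after
  centring by \<theta> it is the first-order Hoeffding projection of the kernel. Overwriting
  coordinate 0 gives a version defined for every x.\<close>

definition first_proj :: "nat list \<Rightarrow> real \<times> real \<Rightarrow> real" where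
  "first_proj \<sigma> x = (\<integral>z. hit \<sigma> {..<length \<sigma>} (z(0 := x)) \<partial>P)"

lemma hit_bounds: "0 \<le> hit \<sigma> I z" "hit \<sigma> I z \<le> 1" "\<bar>hit \<sigma> I z\<bar> \<le> 1"
  by (auto simp: hit_def)

lemma measurable_hit [measurable]: "finite I \<Longrightarrow> hit \<sigma> I \<in> borel_measurable P"
  unfolding hit_def[abs_def] by measurable

lemma measurable_update [measurable]: "(\<lambda>z. z(i := x)) \<in> measurable P P"
  by (rule measurable_into_P) (auto simp: space_base)

lemma measurable_hit_update [measurable]: "finite I \<Longrightarrow> (\<lambda>z. hit \<sigma> I (z(i := x))) \<in> borel_measurable P"
  by (rule measurable_compose[OF measurable_update measurable_hit])

lemma integrable_hit_update: "finite I \<Longrightarrow> integrable P (\<lambda>z. hit \<sigma> I (z(i := x)))"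
  by (rule P.integrable_const_bound[of _ 1]) (auto simp: hit_bounds)

lemma integrable_hit: "finite I \<Longrightarrow> integrable P (hit \<sigma> I)"
  by (rule P.integrable_const_bound[of _ 1]) (auto simp: hit_bounds)

lemma measurable_first_proj [measurable]: "first_proj \<sigma> \<in> borel_measurable \<mu>"
proof -
  have "(\<lambda>p. (snd p)(0 := fst p)) \<in> measurable (\<mu> \<Otimes>\<^sub>M P) P"
    by (rule measurable_into_P) auto
  then have "(\<lambda>p. hit \<sigma> {..<length \<sigma>} ((snd p)(0 := fst p))) \<in> borel_measurable (\<mu> \<Otimes>\<^sub>M P)"
    by (rule measurable_compose) auto
  then show ?thesis
    unfolding first_proj_def[abs_def]
    by (intro P.borel_measurable_lebesgue_integral) (simp add: case_prod_beta')
qed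

lemma first_proj_bounds: "0 \<le> first_proj \<sigma> x" "first_proj \<sigma> x \<le> 1"
proof -
  show "0 \<le> first_proj \<sigma> x" unfolding first_proj_def by (simp add: hit_bounds)
  have "first_proj \<sigma> x \<le> (\<integral>z. 1 \<partial>P)"
    unfolding first_proj_def by (intro integral_mono integrable_hit_update) (auto simp: hit_bounds)
  then show "first_proj \<sigma> x \<le> 1" by (simp add: prob_P_UNIV)
qed

lemma theta_eq: "\<theta> \<sigma> = (\<integral>z. hit \<sigma> {..<length \<sigma>} z \<partial>P)"
proof -
  have "hit \<sigma> {..<length \<sigma>} = indicator {z. occ \<sigma> {..<length \<sigma>} z}"
    by (auto simp: hit_def indicator_def)
  then show ?thesis by (simp add: \<theta>_def)
qed

lemma theta_bounds: "0 \<le> \<theta> \<sigma>" "\<theta> \<sigma> \<le> 1"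
  by (auto simp: \<theta>_def)

lemma hit_cong: "(\<And>i. i \<in> I \<Longrightarrow> z i = z' i) \<Longrightarrow> hit \<sigma> I z = hit \<sigma> I z'"
  unfolding hit_def by (subst occ_cong[of I z z']) auto

lemma integral_hit:
  assumes "finite I" "card I = length \<sigma>" "I \<noteq> {}"
  shows "(\<integral>z. hit \<sigma> I z \<partial>P) = \<theta> \<sigma>"
proof -
  obtain i where "i \<in> I" using assms by auto
  then obtain \<phi> where \<phi>: "inj \<phi>" "\<phi> ` {..<length \<sigma>} = I"
    using ex_inj_enumeration[OF assms(1,2)] by blast
  have "hit \<sigma> I z = hit \<sigma> {..<length \<sigma>} (z \<circ> \<phi>)" for z
    using occ_reindex[of \<phi> "{..<length \<sigma>}" \<sigma> z] \<phi> by (simp add: hit_def inj_on_subset)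
  then show ?thesis using integral_reindex[of "hit \<sigma> {..<length \<sigma>}" \<phi>] \<phi> by (simp add: theta_eq)
qed

text \<open>Exchangeability: the enumeration of I that starts at i carries the fixed point to
  coordinate 0, and \<open>occ\<close> does not depend on the labelling of the points.\<close>

lemma integral_hit_update:
  assumes "finite I" "card I = length \<sigma>" "i \<in> I"
  shows "(\<integral>z. hit \<sigma> I (z(i := x)) \<partial>P) = first_proj \<sigma> x"
proof -
  obtain \<phi> where \<phi>: "inj \<phi>" "\<phi> ` {..<length \<sigma>} = I" "\<phi> 0 = i"
    using ex_inj_enumeration[OF assms(1,2,3)] by blast
  have "(z(i := x)) \<circ> \<phi> = (z \<circ> \<phi>)(0 := x)" for z :: "nat \<Rightarrow> real \<times> real"
    using \<phi> by (auto simp: fun_eq_iff inj_def)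
  then have "hit \<sigma> I (z(i := x)) = hit \<sigma> {..<length \<sigma>} ((z \<circ> \<phi>)(0 := x))" for z
    using occ_reindex[of \<phi> "{..<length \<sigma>}" \<sigma> "z(i := x)"] \<phi> by (simp add: hit_def inj_on_subset)
  then show ?thesis
    using integral_reindex[of "\<lambda>z. hit \<sigma> {..<length \<sigma>} (z(0 := x))" \<phi>] \<phi>
    by (simp add: first_proj_def)
qed

text \<open>Tower property: everything except coordinate 0 is resampled.\<close>

lemma integral_first_proj: "(\<integral>z. first_proj \<sigma> (z i) \<partial>P) = \<theta> \<sigma>"
proof -
  have "mix (- {0}) z z' = z'(0 := z 0)" for z z' :: "nat \<Rightarrow> real \<times> real"
    by (auto simp: mix_def fun_eq_iff)
  moreover have "\<theta> \<sigma> = (\<integral>z. \<integral>z'. hit \<sigma> {..<length \<sigma>} (mix (- {0}) z z') \<partial>P \<partial>P)"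
    unfolding theta_eq by (rule integral_mix[where B = 1]) (auto simp: hit_bounds)
  ultimately have "\<theta> \<sigma> = (\<integral>z. first_proj \<sigma> (z 0) \<partial>P)" by (simp add: first_proj_def)
  then show ?thesis by (simp add: integral_coord)
qed

lemma integrable_first_proj: "integrable P (\<lambda>z. first_proj \<sigma> (z i))"
  by (rule P.integrable_const_bound[of _ 1]) (auto simp: first_proj_bounds)

text \<open>The part of the centred kernel that is orthogonal to all functions of a single point;
  its average over the k-sets is the error of the linearisation.\<close>

definition hoeffding_resid :: "nat list \<Rightarrow> nat set \<Rightarrow> (nat \<Rightarrow> real \<times> real) \<Rightarrow> real" where
  "hoeffding_resid \<sigma> I z = hit \<sigma> I z - \<theta> \<sigma> - (\<Sum>i\<in>I. first_proj \<sigma> (z i) - \<theta> \<sigma>)"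

lemma measurable_hoeffding_resid [measurable]: "finite I \<Longrightarrow> hoeffding_resid \<sigma> I \<in> borel_measurable P"
  unfolding hoeffding_resid_def[abs_def] by measurable

lemma hoeffding_resid_bound: "\<bar>hoeffding_resid \<sigma> I z\<bar> \<le> real (card I) + 1"
proof -
  have b: "\<bar>first_proj \<sigma> x - \<theta> \<sigma>\<bar> \<le> 1" for x
    using first_proj_bounds[of \<sigma> x] theta_bounds[of \<sigma>] by linarith
  have "\<bar>\<Sum>i\<in>I. first_proj \<sigma> (z i) - \<theta> \<sigma>\<bar> \<le> (\<Sum>i\<in>I. 1)"
    by (rule order_trans[OF sum_abs]) (intro sum_mono b)
  moreover have "\<bar>hit \<sigma> I z - \<theta> \<sigma>\<bar> \<le> 1"
    using hit_bounds[of \<sigma> I z] theta_bounds[of \<sigma>] by linarith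
  ultimately show ?thesis by (simp add: hoeffding_resid_def)
qed

text \<open>With point i frozen at x, the other linear terms have mean zero and the i-th one cancels
  the mean of the indicator. The residual is thus degenerate: its conditional mean given any one of
  its points vanishes.\<close>

lemma integral_hoeffding_resid_update:
  assumes "finite I" "card I = length \<sigma>" "i \<in> I"
  shows "(\<integral>z. hoeffding_resid \<sigma> I (z(i := x)) \<partial>P) = 0"
proof -
  have eq: "hoeffding_resid \<sigma> I (z(i := x)) = hit \<sigma> I (z(i := x)) - first_proj \<sigma> x
      - (\<Sum>j\<in>I - {i}. first_proj \<sigma> (z j) - \<theta> \<sigma>)" for z
    unfolding hoeffding_resid_def using assms by (simp add: sum.remove[OF assms(1,3)])
  show ?thesis
    unfolding eq using assms
    by (simp add: integrable_hit_update integrable_first_proj integral_hit_update integral_first_proj prob_P_UNIV)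
qed

text \<open>The index sets share at most one point i. Resampling J - {i} leaves the factor of I
  unchanged and averages the factor of J to zero, by degeneracy.\<close>

lemma integral_hoeffding_resid_orthogonal:
  assumes I: "finite I" and J: "finite J" "card J = length \<sigma>" "J \<noteq> {}" and IJ: "card (I \<inter> J) < 2"
  shows "(\<integral>z. hoeffding_resid \<sigma> I z * hoeffding_resid \<sigma> J z \<partial>P) = 0"
proof -
  \<comment> \<open>For disjoint sets any element of J serves.\<close>
  have "\<exists>i\<in>J. I \<inter> J \<subseteq> {i}"
  proof (cases "I \<inter> J = {}")
    case False
    then have "0 < card (I \<inter> J)" using I by (simp add: card_gt_0_iff)
    then have "card (I \<inter> J) = 1" using IJ by linarith
    then show ?thesis by (auto simp: card_1_singleton_iff)
  qed (use J in auto)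
  then obtain i where i: "i \<in> J" "I \<inter> J \<subseteq> {i}" by auto
  define B where "B = real (card I) + real (card J) + 1"
  show ?thesis
  proof (rule integral_orthogonal[where B = B and D = "J - {i}"])
    show "\<bar>hoeffding_resid \<sigma> I z\<bar> \<le> B" "\<bar>hoeffding_resid \<sigma> J z\<bar> \<le> B" for z
      using hoeffding_resid_bound[of \<sigma> I z] hoeffding_resid_bound[of \<sigma> J z] by (auto simp: B_def)
    show "hoeffding_resid \<sigma> I (mix (J - {i}) z z') = hoeffding_resid \<sigma> I z" for z z'
      using i by (auto simp: hoeffding_resid_def mix_def intro!: arg_cong2[of _ _ _ _ "(-)"] sum.cong hit_cong)
    show "(\<integral>z'. hoeffding_resid \<sigma> J (mix (J - {i}) z z') \<partial>P) = 0" for z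
    proof -
      have "hoeffding_resid \<sigma> J (mix (J - {i}) z z') = hoeffding_resid \<sigma> J (z'(i := z i))" for z'
        by (auto simp: hoeffding_resid_def mix_def intro!: arg_cong2[of _ _ _ _ "(-)"] sum.cong hit_cong)
      then show ?thesis using integral_hoeffding_resid_update[OF J(1,2) i(1)] by simp
    qed
  qed (use I J in auto)
qed

text \<open>Agrees with \<open>pdens\<close> of the sample's pattern when there are no ties, but is
  built from the kernels for every sample, so that its moments need no exceptional set.\<close>

definition ustat :: "nat list \<Rightarrow> nat \<Rightarrow> (nat \<Rightarrow> real \<times> real) \<Rightarrow> real" where
  "ustat \<sigma> n z = (\<Sum>I | I \<subseteq> {..<n} \<and> card I = length \<sigma>. hit \<sigma> I z) / real (n choose length \<sigma>)"

lemma finite_sub: "I \<subseteq> {..<n::nat} \<Longrightarrow> finite I"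
  by (rule finite_subset) auto

lemma measurable_ustat [measurable]: "ustat \<sigma> n \<in> borel_measurable P"
  unfolding ustat_def[abs_def] by (intro borel_measurable_divide borel_measurable_sum) (auto intro: finite_sub measurable_hit)

lemma ustat_bounds: "0 \<le> ustat \<sigma> n z" "ustat \<sigma> n z \<le> 1"
proof -
  show "0 \<le> ustat \<sigma> n z" unfolding ustat_def by (intro divide_nonneg_nonneg sum_nonneg) (auto simp: hit_bounds)
  have "(\<Sum>I | I \<subseteq> {..<n} \<and> card I = length \<sigma>. hit \<sigma> I z) \<le> (\<Sum>I | I \<subseteq> {..<n} \<and> card I = length \<sigma>. 1)"
    by (intro sum_mono) (auto simp: hit_bounds)
  also have "\<dots> = real (n choose length \<sigma>)" using n_subsets[of "{..<n}" "length \<sigma>"] by simp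
  finally show "ustat \<sigma> n z \<le> 1" unfolding ustat_def by (auto simp: divide_le_eq_1)
qed

lemma ustat_sub:
  assumes "length \<sigma> \<le> n"
  shows "(\<Sum>I | I \<subseteq> {..<n} \<and> card I = length \<sigma>. hit \<sigma> I z - c) / real (n choose length \<sigma>) = ustat \<sigma> n z - c"
  using n_subsets[of "{..<n}" "length \<sigma>"] assms
  by (simp add: ustat_def sum_subtractf diff_divide_distrib)

text \<open>Centred indicators over disjoint index sets are uncorrelated, so r = 1 applies, with B =
  1.\<close>

lemma second_moment_ustat:
  assumes "1 \<le> length \<sigma>" "length \<sigma> \<le> n"
  shows "(\<integral>z. (ustat \<sigma> n z - \<theta> \<sigma>)\<^sup>2 \<partial>P) \<le> (real (length \<sigma>))\<^sup>2 / real n"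
proof -
  have "(\<integral>z. ((\<Sum>I | I \<subseteq> {..<n} \<and> card I = length \<sigma>. hit \<sigma> I z - \<theta> \<sigma>) / real (n choose length \<sigma>))\<^sup>2 \<partial>P)
      \<le> 1\<^sup>2 * (real (length \<sigma> choose 1))\<^sup>2 / real (n choose 1)"
  proof (rule P.second_moment_subset_average)
    fix I J assume IJ: "I \<in> {I. I \<subseteq> {..<n} \<and> card I = length \<sigma>}" "J \<in> {I. I \<subseteq> {..<n} \<and> card I = length \<sigma>}"
      and d: "card (I \<inter> J) < 1"
    then have fin: "finite I" "finite J" by (auto intro: finite_sub)
    have disj: "I \<inter> J = {}" using d fin by simp
    have J: "J \<noteq> {}" using IJ assms by auto
    show "(\<integral>z. (hit \<sigma> I z - \<theta> \<sigma>) * (hit \<sigma> J z - \<theta> \<sigma>) \<partial>P) = 0"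
    proof (rule integral_orthogonal[where D = J and B = 1])
      show "hit \<sigma> I (mix J z z') - \<theta> \<sigma> = hit \<sigma> I z - \<theta> \<sigma>" for z z'
        using disj by (intro arg_cong2[of _ _ _ _ "(-)"] hit_cong) (auto simp: mix_def)
      show "(\<integral>z'. hit \<sigma> J (mix J z z') - \<theta> \<sigma> \<partial>P) = 0" for z
      proof -
        have "hit \<sigma> J (mix J z z') = hit \<sigma> J z'" for z'
          by (rule hit_cong) (auto simp: mix_def)
        then show ?thesis
          using IJ J fin by (simp add: integral_hit integrable_hit prob_P_UNIV)
      qed
      show "\<bar>hit \<sigma> I z - \<theta> \<sigma>\<bar> \<le> 1" "\<bar>hit \<sigma> J z - \<theta> \<sigma>\<bar> \<le> 1" for z
        using hit_bounds[of \<sigma> I z] hit_bounds[of \<sigma> J z] theta_bounds[of \<sigma>] by linarith+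
    qed (use fin in auto)
  next
    fix I z
    show "\<bar>hit \<sigma> I z - \<theta> \<sigma>\<bar> \<le> 1"
      using hit_bounds[of \<sigma> I z] theta_bounds[of \<sigma>] by linarith
  qed (use assms in \<open>auto intro!: borel_measurable_diff measurable_hit intro: finite_sub\<close>)
  then show ?thesis using assms by (simp add: ustat_sub)
qed

text \<open>The average of the residuals is the statistic minus its linearisation, by
  \<open>sum_over_subsets\<close>. Residuals over sets with at most one common point are orthogonal,
  so r = 2 applies, and B = k + 1 comes from \<open>hoeffding_resid_bound\<close>.\<close>

lemma second_moment_projection:
  assumes "1 \<le> length \<sigma>" "length \<sigma> \<le> n"
  shows "(\<integral>z. (ustat \<sigma> n z - \<theta> \<sigma> - real (length \<sigma>) / real n * (\<Sum>i<n. first_proj \<sigma> (z i) - \<theta> \<sigma>))\<^sup>2 \<partial>P)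
    \<le> (real (length \<sigma>) + 1)\<^sup>2 * (real (length \<sigma> choose 2))\<^sup>2 / real (n choose 2)"
proof -
  have "(\<Sum>I | I \<subseteq> {..<n} \<and> card I = length \<sigma>. hoeffding_resid \<sigma> I z) / real (n choose length \<sigma>) =
      ustat \<sigma> n z - \<theta> \<sigma> - real (length \<sigma>) / real n * (\<Sum>i<n. first_proj \<sigma> (z i) - \<theta> \<sigma>)" for z
    using assms sum_over_subsets[OF assms, of "\<lambda>i. first_proj \<sigma> (z i) - \<theta> \<sigma>"] ustat_sub[OF assms(2), of z "\<theta> \<sigma>"]
    by (simp add: hoeffding_resid_def sum_subtractf[of "\<lambda>I. hit \<sigma> I z - \<theta> \<sigma>"] diff_divide_distrib)
  moreover have "(\<integral>z. ((\<Sum>I | I \<subseteq> {..<n} \<and> card I = length \<sigma>. hoeffding_resid \<sigma> I z) / real (n choose length \<sigma>))\<^sup>2 \<partial>P)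
      \<le> (real (length \<sigma>) + 1)\<^sup>2 * (real (length \<sigma> choose 2))\<^sup>2 / real (n choose 2)"
  proof (rule P.second_moment_subset_average)
    fix I J assume IJ: "I \<in> {I. I \<subseteq> {..<n} \<and> card I = length \<sigma>}" "J \<in> {I. I \<subseteq> {..<n} \<and> card I = length \<sigma>}"
      and d: "card (I \<inter> J) < 2"
    then show "(\<integral>z. hoeffding_resid \<sigma> I z * hoeffding_resid \<sigma> J z \<partial>P) = 0"
      using assms by (intro integral_hoeffding_resid_orthogonal) (auto intro: finite_sub)
  next
    fix I z assume "I \<in> {I. I \<subseteq> {..<n} \<and> card I = length \<sigma>}"
    then show "\<bar>hoeffding_resid \<sigma> I z\<bar> \<le> real (length \<sigma>) + 1" using hoeffding_resid_bound[of \<sigma> I z] by simp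
  qed (use assms in \<open>auto intro: finite_sub measurable_hoeffding_resid\<close>)
  ultimately show ?thesis by simp
qed

definition \<kappa> :: "nat list \<Rightarrow> real" where
  "\<kappa> \<sigma> = (\<integral>x. (first_proj \<sigma> x - \<theta> \<sigma>)\<^sup>2 \<partial>\<mu>)"

text \<open>Given the shared point z 0, both patterns occur independently, each with probability
  \<open>first_proj \<sigma> (z 0)\<close>. The joint probability is therefore the second moment of
  \<open>first_proj\<close>, which is its variance plus its squared mean.\<close>

lemma prob_double_pattern:
  assumes "\<sigma> \<in> perms (length \<sigma>)" "1 \<le> length \<sigma>"
  defines "k \<equiv> length \<sigma>"
  shows "P.prob {z. pattern k z = \<sigma> \<and> pattern k (\<lambda>i. if i = 0 then z 0 else z (k + i - 1)) = \<sigma>} = \<kappa> \<sigma> + (\<theta> \<sigma>)\<^sup>2"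
proof -
  \<comment> \<open>Indices of the second sample: 0, and then k, ..., 2k - 2.\<close>
  define \<phi> where "\<phi> i = (if i = 0 then 0 else k + i - 1)" for i :: nat
  have \<phi>: "inj_on \<phi> {..<k}" using assms by (auto simp: inj_on_def \<phi>_def)
  have comp: "(\<lambda>i. if i = 0 then z 0 else z (k + i - 1)) = z \<circ> \<phi>" for z :: "nat \<Rightarrow> real \<times> real"
    by (auto simp: \<phi>_def)
  let ?J = "\<phi> ` {..<k}"
  have J: "finite ?J" "card ?J = length \<sigma>" "0 \<in> ?J"
  proof -
    show "card ?J = length \<sigma>" using \<phi> by (subst card_image) (auto simp: k_def)
    show "0 \<in> ?J" using assms by (intro image_eqI[of _ _ 0]) (auto simp: \<phi>_def)
  qed simp
  have J0: "?J \<inter> {..<k} = {0}" using assms by (auto simp: \<phi>_def)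
  have [measurable]: "(\<lambda>z. pattern k (z \<circ> \<phi>)) \<in> measurable P (count_space UNIV)"
    by (rule measurable_compose[OF measurable_into_P measurable_pattern_P]) auto
  have "AE z in P. tie_free {..<k} z \<and> tie_free ?J z"
    using AE_tie_free[of "{..<k}"] AE_tie_free[OF J(1)] by simp
  then have ae: "AE z in P. pattern k z = \<sigma> \<and> pattern k (z \<circ> \<phi>) = \<sigma> \<longleftrightarrow> occ \<sigma> {..<k} z \<and> occ \<sigma> ?J z"
  proof eventually_elim
    fix z assume "tie_free {..<k} z \<and> tie_free ?J z"
    then have "tie_free {..<k} z" "tie_free {..<k} (z \<circ> \<phi>)"
      by (simp_all add: tie_free_reindex[OF \<phi>])
    moreover have "\<sigma> \<in> perms k" using assms by simp
    ultimately show "pattern k z = \<sigma> \<and> pattern k (z \<circ> \<phi>) = \<sigma> \<longleftrightarrow> occ \<sigma> {..<k} z \<and> occ \<sigma> ?J z"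
      by (simp only: pattern_eq_iff occ_reindex[OF \<phi>])
  qed
  have "P.prob {z. pattern k z = \<sigma> \<and> pattern k (z \<circ> \<phi>) = \<sigma>} = P.prob {z. occ \<sigma> {..<k} z \<and> occ \<sigma> ?J z}"
  proof (rule P.finite_measure_eq_AE)
    show "{z. pattern k z = \<sigma> \<and> pattern k (z \<circ> \<phi>) = \<sigma>} \<in> sets P"
      by (intro sets_Collect_P pred_intros_logic pred_eq_const1[where N = "count_space UNIV"]) auto
    show "{z. occ \<sigma> {..<k} z \<and> occ \<sigma> ?J z} \<in> sets P"
      using J(1) by (intro sets_Collect_P pred_intros_logic measurable_occ_P) auto
  qed (use ae in auto)
  also have "\<dots> = (\<integral>z. indicator {z. occ \<sigma> {..<k} z \<and> occ \<sigma> ?J z} z \<partial>P)" by simp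
  also have "\<dots> = (\<integral>z. hit \<sigma> {..<k} z * hit \<sigma> ?J z \<partial>P)"
    by (intro Bochner_Integration.integral_cong) (auto simp: hit_def indicator_def)
  \<comment> \<open>Integrates out the fresh points of the second sample.\<close>
  also have "\<dots> = (\<integral>z. \<integral>z'. hit \<sigma> {..<k} (mix (?J - {0}) z z') * hit \<sigma> ?J (mix (?J - {0}) z z') \<partial>P \<partial>P)"
    using J by (intro integral_mix[where B = 1]) (auto simp: hit_def)
  also have "\<dots> = (\<integral>z. hit \<sigma> {..<k} z * first_proj \<sigma> (z 0) \<partial>P)"
  proof (rule Bochner_Integration.integral_cong)
    fix z
    have "hit \<sigma> {..<k} (mix (?J - {0}) z z') = hit \<sigma> {..<k} z" for z'
    proof (rule hit_cong)
      fix i assume "i \<in> {..<k}"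
      then have "i \<notin> ?J - {0}" using J0 by blast
      then show "mix (?J - {0}) z z' i = z i" unfolding mix_def by (rule if_not_P)
    qed
    moreover have "hit \<sigma> ?J (mix (?J - {0}) z z') = hit \<sigma> ?J (z'(0 := z 0))" for z'
      by (rule hit_cong) (simp add: mix_def)
    ultimately show "(\<integral>z'. hit \<sigma> {..<k} (mix (?J - {0}) z z') * hit \<sigma> ?J (mix (?J - {0}) z z') \<partial>P)
        = hit \<sigma> {..<k} z * first_proj \<sigma> (z 0)"
      using integral_hit_update[OF J] by simp
  qed simp
  \<comment> \<open>Integrates out the first sample except for the shared point.\<close>
  also have "\<dots> = (\<integral>z. \<integral>z'. hit \<sigma> {..<k} (mix (- {0}) z z') * first_proj \<sigma> (mix (- {0}) z z' 0) \<partial>P \<partial>P)"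
    by (intro integral_mix[where B = 1])
      (auto simp: abs_mult hit_bounds first_proj_bounds mult_le_one)
  also have "\<dots> = (\<integral>z. first_proj \<sigma> (z 0) * first_proj \<sigma> (z 0) \<partial>P)"
  proof (rule Bochner_Integration.integral_cong)
    fix z :: "nat \<Rightarrow> real \<times> real"
    have "mix (- {0}) z z' = z'(0 := z 0)" for z' by (auto simp: mix_def fun_eq_iff)
    then show "(\<integral>z'. hit \<sigma> {..<k} (mix (- {0}) z z') * first_proj \<sigma> (mix (- {0}) z z' 0) \<partial>P)
        = first_proj \<sigma> (z 0) * first_proj \<sigma> (z 0)"
      by (simp add: first_proj_def k_def)
  qed simp
  also have "\<dots> = (\<integral>z. (first_proj \<sigma> (z 0) - \<theta> \<sigma>)\<^sup>2 + 2 * \<theta> \<sigma> * first_proj \<sigma> (z 0) - (\<theta> \<sigma>)\<^sup>2 \<partial>P)"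
    by (simp add: power2_eq_square algebra_simps)
  also have "\<dots> = (\<integral>z. (first_proj \<sigma> (z 0) - \<theta> \<sigma>)\<^sup>2 \<partial>P) + 2 * \<theta> \<sigma> * \<theta> \<sigma> - (\<theta> \<sigma>)\<^sup>2"
  proof -
    have "integrable P (\<lambda>z. (first_proj \<sigma> (z 0) - \<theta> \<sigma>)\<^sup>2)"
    proof (rule P.integrable_const_bound[of _ 1])
      have "\<bar>first_proj \<sigma> x - \<theta> \<sigma>\<bar> \<le> 1" for x
        using first_proj_bounds[of \<sigma> x] theta_bounds[of \<sigma>] by linarith
      then show "AE z in P. norm ((first_proj \<sigma> (z 0) - \<theta> \<sigma>)\<^sup>2) \<le> 1"
        by (simp add: abs_square_le_1)
    qed measurable
    then show ?thesis by (simp add: integrable_first_proj integral_first_proj prob_P_UNIV)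
  qed
  also have "(\<integral>z. (first_proj \<sigma> (z 0) - \<theta> \<sigma>)\<^sup>2 \<partial>P) = \<kappa> \<sigma>"
    unfolding \<kappa>_def by (rule integral_coord[of "\<lambda>x. (first_proj \<sigma> x - \<theta> \<sigma>)\<^sup>2" 0]) measurable
  also have "\<kappa> \<sigma> + 2 * \<theta> \<sigma> * \<theta> \<sigma> - (\<theta> \<sigma>)\<^sup>2 = \<kappa> \<sigma> + (\<theta> \<sigma>)\<^sup>2"
    by (simp add: power2_eq_square)
  finally show ?thesis unfolding comp .
qed

end

section \<open>Quantiles and concentration\<close>


lemma (in prob_space) prob_abs_ge_second_moment:
  fixes f :: "'a \<Rightarrow> real"
  assumes [measurable]: "f \<in> borel_measurable M" and "integrable M (\<lambda>x. (f x)\<^sup>2)" and "0 < \<delta>"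
  shows "prob {x \<in> space M. \<delta> \<le> \<bar>f x\<bar>} \<le> expectation (\<lambda>x. (f x)\<^sup>2) / \<delta>\<^sup>2"
proof -
  have "{x \<in> space M. \<delta> \<le> \<bar>f x\<bar>} = {x \<in> space M. \<delta>\<^sup>2 \<le> (f x)\<^sup>2}"
    using \<open>0 < \<delta>\<close> abs_le_square_iff[of \<delta>] by auto
  then show ?thesis
    using integral_Markov_inequality_measure[OF assms(2), of "{}" "\<delta>\<^sup>2"] \<open>0 < \<delta>\<close> by simp
qed

text \<open>q is the infimum of the set where the distribution function is at least 1 - \<alpha>.
  Right continuity keeps this inequality at q itself, and the left limit at q, which is P(X < q), is
  at most 1 - \<alpha>. The limits 0 and 1 of the distribution function, with 0 < \<alpha> < 1, make
  the set bounded below and nonempty, so that \<open>Inf\<close> is meaningful.\<close>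

lemma (in prob_space) quantile_bounds:
  fixes X :: "'a \<Rightarrow> real"
  assumes X [measurable]: "X \<in> borel_measurable M" and \<alpha>: "0 < \<alpha>" "\<alpha> < 1"
  defines "q \<equiv> Inf {t. prob {x \<in> space M. t < X x} \<le> \<alpha>}"
  shows prob_gt_quantile: "prob {x \<in> space M. q < X x} \<le> \<alpha>"
    and prob_ge_quantile: "\<alpha> \<le> prob {x \<in> space M. q \<le> X x}"
    and quantile_le: "prob {x \<in> space M. t < X x} \<le> \<alpha> \<Longrightarrow> q \<le> t"
proof -
  let ?D = "distr M borel X"
  interpret D: real_distribution ?D by (rule real_distribution_distr) (rule X)
  have gt: "prob {x \<in> space M. t < X x} = 1 - cdf ?D t" for t
  proof -
    have "cdf ?D t = prob {x \<in> space M. X x \<le> t}"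
      unfolding cdf_def by (subst measure_distr) (auto intro!: arg_cong[of _ _ prob])
    moreover have "prob {x \<in> space M. \<not> X x \<le> t} = 1 - prob {x \<in> space M. X x \<le> t}"
      by (rule prob_neg) measurable
    ultimately show ?thesis by (simp add: not_le)
  qed
  have ge: "prob {x \<in> space M. t \<le> X x} = 1 - measure ?D {..<t}" for t
  proof -
    have "measure ?D {..<t} = prob {x \<in> space M. X x < t}"
      by (subst measure_distr) (auto intro!: arg_cong[of _ _ prob])
    moreover have "prob {x \<in> space M. \<not> X x < t} = 1 - prob {x \<in> space M. X x < t}"
      by (rule prob_neg) measurable
    ultimately show ?thesis by (simp add: not_less)
  qed
  define S where "S = {t. 1 - \<alpha> \<le> cdf ?D t}"
  have q: "q = Inf S" unfolding q_def S_def gt by (simp add: algebra_simps)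
  have "eventually (\<lambda>t. 1 - \<alpha> < cdf ?D t) at_top"
    using D.cdf_lim_at_top_prob \<alpha> by (intro order_tendstoD(1)) auto
  then obtain t1 where "1 - \<alpha> < cdf ?D t1" by (metis eventually_at_top_linorder order_refl)
  then have ne: "S \<noteq> {}" by (auto simp: S_def intro!: exI[of _ t1])
  have "eventually (\<lambda>t. cdf ?D t < 1 - \<alpha>) at_bot"
    using D.cdf_lim_at_bot \<alpha> by (intro order_tendstoD(2)) auto
  then obtain t0 where t0: "cdf ?D t0 < 1 - \<alpha>" by (metis eventually_at_bot_linorder order_refl)
  have bdd: "bdd_below S"
  proof (rule bdd_belowI)
    fix t assume "t \<in> S"
    then show "t0 \<le> t" using t0 D.cdf_nondecreasing[of t t0] by (force simp: S_def)
  qed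
  have above: "1 - \<alpha> \<le> cdf ?D t" if "q < t" for t
  proof -
    obtain s where "s \<in> S" "s < t" using \<open>q < t\<close> cInf_less_iff[OF ne bdd, of t] unfolding q by blast
    then show ?thesis using D.cdf_nondecreasing[of s t] by (simp add: S_def)
  qed
  have below: "cdf ?D t \<le> 1 - \<alpha>" if "t < q" for t
  proof (rule ccontr)
    assume "\<not> cdf ?D t \<le> 1 - \<alpha>"
    then have "q \<le> t" unfolding q by (intro cInf_lower bdd) (simp add: S_def)
    with that show False by simp
  qed
  have "1 - \<alpha> \<le> cdf ?D q"
  proof (rule tendsto_lowerbound)
    show "(cdf ?D \<longlongrightarrow> cdf ?D q) (at_right q)" using D.cdf_is_right_cont[of q] by (simp add: continuous_within)
    show "eventually (\<lambda>t. 1 - \<alpha> \<le> cdf ?D t) (at_right q)"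
      using above by (auto simp: eventually_at_filter)
  qed simp
  then show "prob {x \<in> space M. q < X x} \<le> \<alpha>" by (simp add: gt)
  have "measure ?D {..<q} \<le> 1 - \<alpha>"
  proof (rule tendsto_upperbound)
    show "(cdf ?D \<longlongrightarrow> measure ?D {..<q}) (at_left q)" by (rule D.cdf_at_left)
    show "eventually (\<lambda>t. cdf ?D t \<le> 1 - \<alpha>) (at_left q)"
      using below by (auto simp: eventually_at_filter)
  qed simp
  then show "\<alpha> \<le> prob {x \<in> space M. q \<le> X x}" by (simp add: ge)
  show "q \<le> t" if "prob {x \<in> space M. t < X x} \<le> \<alpha>"
    unfolding q by (rule cInf_lower[OF _ bdd]) (use that in \<open>simp add: S_def gt\<close>)
qed

section \<open>Uniform concentration bounds under convergence to the standard normal law\<close>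

lemma std_normal_interval_bound:
  assumes "a \<le> b"
  shows "measure std_normal_distribution {a<..b} \<le> b - a"
proof -
  have "std_normal_density x \<le> 1" for x
  proof -
    have "exp (- x\<^sup>2 / 2) \<le> 1" by simp
    moreover have "1 \<le> sqrt (2 * pi)" using pi_ge_two by (intro real_le_rsqrt) simp
    ultimately have "exp (- x\<^sup>2 / 2) / sqrt (2 * pi) \<le> 1 / 1"
      by (intro frac_le) auto
    then show ?thesis by (simp add: std_normal_density_def)
  qed
  then have "ennreal (std_normal_density x) * indicator {a<..b} x \<le> indicator {a<..b} x" for x
    by (cases "x \<in> {a<..b}") (simp_all add: ennreal_le_1)
  then have "(\<integral>\<^sup>+x. ennreal (std_normal_density x) * indicator {a<..b} x \<partial>lborel) \<le> (\<integral>\<^sup>+x. indicator {a<..b} x \<partial>lborel)"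
    by (rule nn_integral_mono)
  then have "emeasure std_normal_distribution {a<..b} \<le> (\<integral>\<^sup>+x. indicator {a<..b} x \<partial>lborel)"
    by (simp add: emeasure_density)
  also have "\<dots> = ennreal (b - a)" using assms by simp
  finally show ?thesis using assms by (simp add: measure_def enn2real_leI)
qed

text \<open>Weak convergence gives only pointwise convergence of distribution functions, but
  closeness at finitely many grid points controls all windows at once: a window in the bulk is
  enclosed by two grid points, and any other window lies in a tail that is small under the limit
  law.\<close>

lemma weak_conv_std_normal_concentration:
  assumes F: "\<And>n. real_distribution (F n)" and conv: "weak_conv_m F std_normal_distribution" and "0 < \<eta>"
  shows "\<exists>\<delta>>0. \<forall>\<^sub>F n in sequentially. \<forall>x. measure (F n) {x - \<delta>..x + \<delta>} \<le> \<eta>"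
proof -
  let ?N = "std_normal_distribution"
  interpret N: real_distribution ?N by (rule real_dist_normal_dist)
  \<comment> \<open>A window of radius \<delta> is enclosed in four grid cells of width \<delta>, of
    normal mass at most 4 \<delta> = \<eta>/2; two errors of \<eta>/8 at the grid points still leave
    room.\<close>
  define \<delta> where "\<delta> = \<eta> / 8"
  have \<delta>: "\<delta> > 0" using \<open>0 < \<eta>\<close> by (simp add: \<delta>_def)
  have diffN: "cdf ?N b - cdf ?N a \<le> b - a" if "a \<le> b" for a b
    using std_normal_interval_bound[OF that] N.cdf_diff_eq[of a b] that by (cases "a = b") auto
  have cont: "isCont (cdf ?N) x" for x
  proof -
    have "measure ?N {x} \<le> e" if "e > 0" for e
    proof -
      have "measure ?N {x} \<le> measure ?N {x - e<..x}" using that by (intro N.finite_measure_mono) auto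
      also have "\<dots> \<le> e" using std_normal_interval_bound[of "x - e" x] that by simp
      finally show ?thesis .
    qed
    then have "measure ?N {x} \<le> 0" by - (rule field_le_epsilon, simp)
    then show ?thesis using N.isCont_cdf[of x] by (simp add: measure_le_0_iff)
  qed
  then have lim: "(\<lambda>n. cdf (F n) x) \<longlonglongrightarrow> cdf ?N x" for x
    using conv by (simp add: weak_conv_m_def weak_conv_def)
  have "eventually (\<lambda>t. cdf ?N t < \<eta> / 4) at_bot"
    using N.cdf_lim_at_bot \<open>0 < \<eta>\<close> by (intro order_tendstoD(2)) auto
  then obtain T1 where T1: "\<And>t. t \<le> T1 \<Longrightarrow> cdf ?N t < \<eta> / 4" by (auto simp: eventually_at_bot_linorder)
  have "eventually (\<lambda>t. 1 - \<eta> / 4 < cdf ?N t) at_top"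
    using N.cdf_lim_at_top_prob \<open>0 < \<eta>\<close> by (intro order_tendstoD(1)) auto
  then obtain T2 where T2: "\<And>t. t \<ge> T2 \<Longrightarrow> 1 - \<eta> / 4 < cdf ?N t" by (auto simp: eventually_at_top_linorder)
  obtain J :: nat where J: "real J > max \<bar>T1\<bar> \<bar>T2\<bar> / \<delta>" using reals_Archimedean2 by blast
  then have J': "real J * \<delta> > max \<bar>T1\<bar> \<bar>T2\<bar>" using \<delta> by (simp add: pos_divide_less_eq)
  define y where "y i = of_int i * \<delta>" for i :: int
  \<comment> \<open>The margin 4 ensures that the grid indices m - 2 and m + 2 belong to G whenever
    neither tail case applies.\<close>
  define G where "G = {- int J - 4..int J + 4}"
  have "\<forall>\<^sub>F n in sequentially. \<forall>i\<in>G. \<bar>cdf (F n) (y i) - cdf ?N (y i)\<bar> < \<eta> / 8"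
  proof (rule eventually_ball_finite)
    show "\<forall>i\<in>G. \<forall>\<^sub>F n in sequentially. \<bar>cdf (F n) (y i) - cdf ?N (y i)\<bar> < \<eta> / 8"
    proof
      fix i
      show "\<forall>\<^sub>F n in sequentially. \<bar>cdf (F n) (y i) - cdf ?N (y i)\<bar> < \<eta> / 8"
        using tendstoD[OF lim[of "y i"], of "\<eta> / 8"] \<open>0 < \<eta>\<close> by (simp add: dist_real_def)
    qed
  qed (simp add: G_def)
  then have "\<forall>\<^sub>F n in sequentially. \<forall>x. measure (F n) {x - \<delta>..x + \<delta>} \<le> \<eta>"
  proof eventually_elim
    fix n assume close: "\<forall>i\<in>G. \<bar>cdf (F n) (y i) - cdf ?N (y i)\<bar> < \<eta> / 8"
    interpret Fn: real_distribution "F n" by (rule F)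
    show "\<forall>x. measure (F n) {x - \<delta>..x + \<delta>} \<le> \<eta>"
    proof
      fix x
      define m where "m = \<lfloor>x / \<delta>\<rfloor>"
      have "of_int m \<le> x / \<delta>" "x / \<delta> < of_int m + 1" unfolding m_def by linarith+
      then have m: "y m \<le> x" "x < y m + \<delta>"
        using \<delta> by (simp_all add: y_def field_simps)
      have sub: "{x - \<delta>..x + \<delta>} \<subseteq> {y (m - 2)<..y (m + 2)}"
        using m \<delta> by (auto simp: y_def algebra_simps)
      have y_le: "y i \<le> y j \<longleftrightarrow> i \<le> j" for i j using \<delta> by (simp add: y_def)
      have "m + 2 \<le> - int J \<or> int J \<le> m - 2 \<or> (m - 2 \<in> G \<and> m + 2 \<in> G)"
        unfolding G_def atLeastAtMost_iff by linarith
      then consider "m + 2 \<le> - int J" | "int J \<le> m - 2" | "m - 2 \<in> G" "m + 2 \<in> G"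
        by blast
      then show "measure (F n) {x - \<delta>..x + \<delta>} \<le> \<eta>"
      proof cases
        case 1
        then have "y (m + 2) \<le> y (- int J)" by (simp add: y_le)
        then have "{x - \<delta>..x + \<delta>} \<subseteq> {..y (- int J)}" by (intro subset_trans[OF sub]) auto
        then have "measure (F n) {x - \<delta>..x + \<delta>} \<le> cdf (F n) (y (- int J))"
          unfolding cdf_def by (intro Fn.finite_measure_mono) auto
        moreover have "cdf ?N (y (- int J)) < \<eta> / 4"
          using J' by (intro T1) (auto simp: y_def)
        moreover have "- int J \<in> G" by (simp add: G_def)
        ultimately show ?thesis using close[rule_format, of "- int J"] \<open>0 < \<eta>\<close> by linarith
      next
        case 2
        then have "y (int J) \<le> y (m - 2)" by (simp add: y_le)
        then have "{x - \<delta>..x + \<delta>} \<subseteq> {y (int J)<..}" by (intro subset_trans[OF sub]) auto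
        then have "measure (F n) {x - \<delta>..x + \<delta>} \<le> measure (F n) {y (int J)<..}"
          by (intro Fn.finite_measure_mono) auto
        also have "{y (int J)<..} = space (F n) - {..y (int J)}" by (auto simp: not_le)
        also have "measure (F n) \<dots> = 1 - cdf (F n) (y (int J))"
          unfolding cdf_def by (intro Fn.prob_compl) simp
        finally have "measure (F n) {x - \<delta>..x + \<delta>} \<le> 1 - cdf (F n) (y (int J))" .
        moreover have "1 - \<eta> / 4 < cdf ?N (y (int J))"
          using J' by (intro T2) (auto simp: y_def)
        moreover have "int J \<in> G" by (simp add: G_def)
        ultimately show ?thesis using close[rule_format, of "int J"] \<open>0 < \<eta>\<close> by linarith
      next
        case 3
        have lt: "y (m - 2) < y (m + 2)" using \<delta> by (simp add: y_def)
        have "measure (F n) {x - \<delta>..x + \<delta>} \<le> measure (F n) {y (m - 2)<..y (m + 2)}"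
          using sub by (intro Fn.finite_measure_mono) auto
        also have "\<dots> = cdf (F n) (y (m + 2)) - cdf (F n) (y (m - 2))"
          using Fn.cdf_diff_eq[OF lt] by simp
        also have "\<dots> \<le> cdf ?N (y (m + 2)) - cdf ?N (y (m - 2)) + \<eta> / 4"
          using close[rule_format, OF 3(1)] close[rule_format, OF 3(2)] by linarith
        also have "\<dots> \<le> 4 * \<delta> + \<eta> / 4"
          using diffN[of "y (m - 2)" "y (m + 2)"] lt by (simp add: y_def algebra_simps)
        also have "\<dots> \<le> \<eta>" using \<open>0 < \<eta>\<close> by (simp add: \<delta>_def)
        finally show ?thesis .
      qed
    qed
  qed
  with \<delta> show ?thesis by blast
qed

section \<open>Asymptotics of the pattern statistics\<close>


context copula_sample
begin

text \<open>The family of all coordinates is the identity map, whose law is the product measure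
  itself.\<close>

lemma indep_coords: "P.indep_vars (\<lambda>_. \<mu>) (\<lambda>i z. z i) UNIV"
proof -
  have "(\<lambda>z. \<lambda>i\<in>UNIV. z i) = (\<lambda>z :: nat \<Rightarrow> real \<times> real. z)" by (simp add: restrict_UNIV)
  moreover have "distr P (PiM UNIV (\<lambda>_. \<mu>)) (\<lambda>z. z) = P"
    using sets_P by (intro distr_id2) simp
  ultimately show ?thesis
    by (subst P.indep_vars_iff_distr_eq_PiM') (auto simp: distr_coord P_def[symmetric])
qed

lemma kappa_nonneg: "0 \<le> \<kappa> \<sigma>"
  by (simp add: \<kappa>_def)

lemma first_proj_dev_bound: "(first_proj \<sigma> x - \<theta> \<sigma>)\<^sup>2 \<le> 1"
  using first_proj_bounds[of \<sigma> x] theta_bounds[of \<sigma>]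
  by (intro abs_square_le_1[THEN iffD2]) (auto simp: abs_le_iff)

lemma projection_clt:
  assumes "\<kappa> \<sigma> > 0"
  shows "weak_conv_m (\<lambda>n. distr P borel (\<lambda>z. (\<Sum>i<n. first_proj \<sigma> (z i) - \<theta> \<sigma>) / sqrt (real n * \<kappa> \<sigma>)))
    std_normal_distribution"
proof -
  let ?X = "\<lambda>i z. first_proj \<sigma> (z i) - \<theta> \<sigma>"
  have "weak_conv_m (\<lambda>n. distr P borel (\<lambda>z. (\<Sum>i<n. ?X i z) / sqrt (real n * (sqrt (\<kappa> \<sigma>))\<^sup>2))) std_normal_distribution"
  proof (rule P.central_limit_theorem_zero_mean)
    show "P.indep_vars (\<lambda>_. borel) ?X UNIV"
      by (rule P.indep_vars_compose2[OF indep_coords]) measurable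
    show mean: "(\<integral>z. ?X i z \<partial>P) = 0" for i
      by (simp add: integrable_first_proj integral_first_proj prob_P_UNIV)
    show "0 < sqrt (\<kappa> \<sigma>)" using assms by simp
    show "integrable P (\<lambda>z. (?X i z)\<^sup>2)" for i
      by (rule P.integrable_const_bound[of _ 1]) (use first_proj_dev_bound in auto)
    have "(\<integral>z. (?X i z)\<^sup>2 \<partial>P) = \<kappa> \<sigma>" for i
      unfolding \<kappa>_def by (rule integral_coord[of "\<lambda>x. (first_proj \<sigma> x - \<theta> \<sigma>)\<^sup>2" i]) measurable
    then show "(\<integral>z. (?X i z - (\<integral>z. ?X i z \<partial>P))\<^sup>2 \<partial>P) = (sqrt (\<kappa> \<sigma>))\<^sup>2" for i
      unfolding mean using assms by simp
    show "distr P borel (?X i) = distr \<mu> borel (\<lambda>x. first_proj \<sigma> x - \<theta> \<sigma>)" for i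
    proof -
      have "distr \<mu> borel (\<lambda>x. first_proj \<sigma> x - \<theta> \<sigma>) = distr (distr P \<mu> (\<lambda>z. z i)) borel (\<lambda>x. first_proj \<sigma> x - \<theta> \<sigma>)"
        by (simp add: distr_coord)
      also have "\<dots> = distr P borel (?X i)"
        by (subst distr_distr) (auto simp: comp_def)
      finally show ?thesis by simp
    qed
  qed
  then show ?thesis using assms by simp
qed

definition remainder :: "nat list \<Rightarrow> nat \<Rightarrow> (nat \<Rightarrow> real \<times> real) \<Rightarrow> real" where
  "remainder \<sigma> n z = ustat \<sigma> n z - \<theta> \<sigma> - real (length \<sigma>) / real n * (\<Sum>i<n. first_proj \<sigma> (z i) - \<theta> \<sigma>)"

lemma measurable_remainder [measurable]: "remainder \<sigma> n \<in> borel_measurable P"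
  unfolding remainder_def[abs_def] by measurable

lemma remainder_bound: "\<bar>remainder \<sigma> n z\<bar> \<le> 1 + real (length \<sigma>)"
proof -
  have b: "\<bar>first_proj \<sigma> x - \<theta> \<sigma>\<bar> \<le> 1" for x
    using first_proj_bounds[of \<sigma> x] theta_bounds[of \<sigma>] by linarith
  have "\<bar>\<Sum>i<n. first_proj \<sigma> (z i) - \<theta> \<sigma>\<bar> \<le> (\<Sum>i<n. 1)"
    by (rule order_trans[OF sum_abs]) (intro sum_mono b)
  then have "real (length \<sigma>) / real n * \<bar>\<Sum>i<n. first_proj \<sigma> (z i) - \<theta> \<sigma>\<bar> \<le> real (length \<sigma>) / real n * real n"
    by (intro mult_left_mono) auto
  also have "\<dots> \<le> real (length \<sigma>)" by simp
  finally have "\<bar>real (length \<sigma>) / real n * (\<Sum>i<n. first_proj \<sigma> (z i) - \<theta> \<sigma>)\<bar> \<le> real (length \<sigma>)"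
    by (simp add: abs_mult)
  moreover have "\<bar>ustat \<sigma> n z - \<theta> \<sigma>\<bar> \<le> 1"
    using ustat_bounds[of \<sigma> n z] theta_bounds[of \<sigma>] by linarith
  ultimately show ?thesis unfolding remainder_def by linarith
qed

text \<open>The second moment of the remainder is of order 1/n^2, so it still tends to 0 after
  multiplication by n, and Chebyshev's inequality applies.\<close>

lemma remainder_tendsto_0:
  assumes "1 \<le> length \<sigma>" "0 < \<delta>"
  shows "(\<lambda>n. P.prob {z. \<delta> \<le> \<bar>sqrt (real n) * remainder \<sigma> n z\<bar>}) \<longlonglongrightarrow> 0"
proof -
  define c where "c = (real (length \<sigma>) + 1)\<^sup>2 * (real (length \<sigma> choose 2))\<^sup>2"
  have bound: "P.prob {z. \<delta> \<le> \<bar>sqrt (real n) * remainder \<sigma> n z\<bar>} \<le> real n * (c / real (n choose 2)) / \<delta>\<^sup>2"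
    if n: "length \<sigma> \<le> n" for n
  proof -
    have "(sqrt (real n) * remainder \<sigma> n z)\<^sup>2 \<le> real n * (1 + real (length \<sigma>))\<^sup>2" for z
      using remainder_bound[of \<sigma> n z] power_mono[of "\<bar>remainder \<sigma> n z\<bar>" "1 + real (length \<sigma>)" 2]
      by (simp add: power_mult_distrib mult_left_mono)
    then have "integrable P (\<lambda>z. (sqrt (real n) * remainder \<sigma> n z)\<^sup>2)"
      by (intro P.integrable_const_bound[where B = "real n * (1 + real (length \<sigma>))\<^sup>2"]) auto
    then have "P.prob {z \<in> space P. \<delta> \<le> \<bar>sqrt (real n) * remainder \<sigma> n z\<bar>}
        \<le> (\<integral>z. (sqrt (real n) * remainder \<sigma> n z)\<^sup>2 \<partial>P) / \<delta>\<^sup>2"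
      using assms by (intro P.prob_abs_ge_second_moment) auto
    also have "(\<integral>z. (sqrt (real n) * remainder \<sigma> n z)\<^sup>2 \<partial>P) = real n * (\<integral>z. (remainder \<sigma> n z)\<^sup>2 \<partial>P)"
      by (simp add: power_mult_distrib)
    also have "\<dots> / \<delta>\<^sup>2 \<le> real n * (c / real (n choose 2)) / \<delta>\<^sup>2"
      using second_moment_projection[OF assms(1) n] unfolding remainder_def c_def
      by (intro divide_right_mono mult_left_mono) auto
    finally show ?thesis by simp
  qed
  have "(\<lambda>n. 2 * c / \<delta>\<^sup>2 * (1 / (real n - 1))) \<longlonglongrightarrow> 2 * c / \<delta>\<^sup>2 * 0"
    by (intro tendsto_mult tendsto_const) real_asymp
  then have "(\<lambda>n. 2 * c / \<delta>\<^sup>2 * (1 / (real n - 1))) \<longlonglongrightarrow> 0" by simp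
  moreover have "2 * c / \<delta>\<^sup>2 * (1 / (real n - 1)) = real n * (c / real (n choose 2)) / \<delta>\<^sup>2" if "2 \<le> n" for n
  proof -
    have choose: "real (n choose 2) = real n * (real n - 1) / 2"
      using choose_two[of n] that
      by (simp add: real_of_nat_div even_mult_iff algebra_simps of_nat_diff)
    have "real n * (c / (real n * (real n - 1) / 2)) = 2 * c / (real n - 1)"
      using that by simp
    then show ?thesis unfolding choose by simp
  qed
  ultimately have lim: "(\<lambda>n. real n * (c / real (n choose 2)) / \<delta>\<^sup>2) \<longlonglongrightarrow> 0"
    by (rule Lim_transform_eventually[OF _ eventually_sequentiallyI[of 2]])
  show ?thesis
  proof (rule tendsto_sandwich[OF _ _ tendsto_const lim])
    show "\<forall>\<^sub>F n in sequentially. 0 \<le> P.prob {z. \<delta> \<le> \<bar>sqrt (real n) * remainder \<sigma> n z\<bar>}" by simp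
    show "\<forall>\<^sub>F n in sequentially. P.prob {z. \<delta> \<le> \<bar>sqrt (real n) * remainder \<sigma> n z\<bar>}
        \<le> real n * (c / real (n choose 2)) / \<delta>\<^sup>2"
      by (rule eventually_sequentiallyI[of "length \<sigma>"]) (rule bound)
  qed
qed

text \<open>The linear part is b = k sqrt(\<kappa>) times an asymptotically normal sum. If the
  scaled statistic is within \<delta> of x and the scaled remainder is below \<delta>, then the
  normalised sum is within 2 \<delta> / b of x / b, and this radius is the \<delta>0 provided by the
  central limit theorem.\<close>

lemma ustat_concentration:
  assumes "1 \<le> length \<sigma>" "\<kappa> \<sigma> > 0" "0 < \<eta>"
  shows "\<exists>\<delta>>0. \<forall>\<^sub>F n in sequentially. \<forall>x. P.prob {z. \<bar>sqrt (real n) * (ustat \<sigma> n z - \<theta> \<sigma>) - x\<bar> \<le> \<delta>} \<le> \<eta>"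
proof -
  let ?S = "\<lambda>n z. (\<Sum>i<n. first_proj \<sigma> (z i) - \<theta> \<sigma>) / sqrt (real n * \<kappa> \<sigma>)"
  define b where "b = real (length \<sigma>) * sqrt (\<kappa> \<sigma>)"
  have b: "b > 0" using assms unfolding b_def by (intro mult_pos_pos) auto
  have [measurable]: "?S n \<in> borel_measurable P" for n by measurable
  obtain \<delta>0 where \<delta>0: "\<delta>0 > 0"
    "\<forall>\<^sub>F n in sequentially. \<forall>x. measure (distr P borel (?S n)) {x - \<delta>0..x + \<delta>0} \<le> \<eta> / 2"
    using weak_conv_std_normal_concentration[OF _ projection_clt[OF assms(2)], of "\<eta> / 2"] assms(3)
    by (auto intro!: P.real_distribution_distr)
  define \<delta> where "\<delta> = \<delta>0 * b / 2"
  have \<delta>: "\<delta> > 0" using \<delta>0 b by (simp add: \<delta>_def)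
  have "\<forall>\<^sub>F n in sequentially. P.prob {z. \<delta> \<le> \<bar>sqrt (real n) * remainder \<sigma> n z\<bar>} < \<eta> / 2"
    by (rule order_tendstoD(2)[OF remainder_tendsto_0[OF assms(1) \<delta>]]) (use assms(3) in simp)
  then have "\<forall>\<^sub>F n in sequentially. \<forall>x. P.prob {z. \<bar>sqrt (real n) * (ustat \<sigma> n z - \<theta> \<sigma>) - x\<bar> \<le> \<delta>} \<le> \<eta>"
    using \<delta>0(2) eventually_gt_at_top[of 0]
  proof eventually_elim
    case (elim n)
    have dec: "sqrt (real n) * (ustat \<sigma> n z - \<theta> \<sigma>) = b * ?S n z + sqrt (real n) * remainder \<sigma> n z" for z
    proof -
      have "b * ?S n z = real (length \<sigma>) * (\<Sum>i<n. first_proj \<sigma> (z i) - \<theta> \<sigma>) / sqrt (real n)"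
        using assms elim by (simp add: b_def real_sqrt_mult)
      also have "\<dots> = sqrt (real n) * (real (length \<sigma>) / real n * (\<Sum>i<n. first_proj \<sigma> (z i) - \<theta> \<sigma>))"
        using elim real_sqrt_mult_self[of "real n"] by (simp add: field_simps)
      finally show ?thesis by (simp add: remainder_def algebra_simps)
    qed
    show ?case
    proof
      fix x
      have "{z. \<bar>sqrt (real n) * (ustat \<sigma> n z - \<theta> \<sigma>) - x\<bar> \<le> \<delta>} \<subseteq>
          {z. ?S n z \<in> {x / b - \<delta>0..x / b + \<delta>0}} \<union> {z. \<delta> \<le> \<bar>sqrt (real n) * remainder \<sigma> n z\<bar>}"
      proof clarify
        fix z assume z: "\<bar>sqrt (real n) * (ustat \<sigma> n z - \<theta> \<sigma>) - x\<bar> \<le> \<delta>" "\<not> \<delta> \<le> \<bar>sqrt (real n) * remainder \<sigma> n z\<bar>"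
        moreover have "\<delta> + \<delta> = b * \<delta>0" by (simp add: \<delta>_def)
        ultimately have "\<bar>b * ?S n z - x\<bar> \<le> b * \<delta>0" using dec[of z] by linarith
        then have "b * (x / b - \<delta>0) \<le> b * ?S n z" "b * ?S n z \<le> b * (x / b + \<delta>0)"
          using b by (simp_all add: algebra_simps abs_le_iff)
        then show "?S n z \<in> {x / b - \<delta>0..x / b + \<delta>0}"
          by (simp only: atLeastAtMost_iff mult_le_cancel_left_pos[OF b])
      qed
      then have "P.prob {z. \<bar>sqrt (real n) * (ustat \<sigma> n z - \<theta> \<sigma>) - x\<bar> \<le> \<delta>} \<le>
          P.prob ({z. ?S n z \<in> {x / b - \<delta>0..x / b + \<delta>0}} \<union> {z. \<delta> \<le> \<bar>sqrt (real n) * remainder \<sigma> n z\<bar>})"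
        by (intro P.finite_measure_mono sets.Un sets_Collect_P) measurable
      also have "\<dots> \<le> P.prob {z. ?S n z \<in> {x / b - \<delta>0..x / b + \<delta>0}} + P.prob {z. \<delta> \<le> \<bar>sqrt (real n) * remainder \<sigma> n z\<bar>}"
        by (intro measure_Un_le sets_Collect_P) measurable
      also have "P.prob {z. ?S n z \<in> {x / b - \<delta>0..x / b + \<delta>0}} = measure (distr P borel (?S n)) {x / b - \<delta>0..x / b + \<delta>0}"
        by (subst measure_distr) (auto simp: vimage_def)
      also have "\<dots> + P.prob {z. \<delta> \<le> \<bar>sqrt (real n) * remainder \<sigma> n z\<bar>} \<le> \<eta> / 2 + \<eta> / 2"
        using elim by (intro add_mono) auto
      finally show "P.prob {z. \<bar>sqrt (real n) * (ustat \<sigma> n z - \<theta> \<sigma>) - x\<bar> \<le> \<delta>} \<le> \<eta>" by simp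
    qed
  qed
  with \<delta> show ?thesis by blast
qed

text \<open>Zero variance makes \<open>first_proj\<close> constant almost everywhere, so the linear
  part vanishes almost surely and only the remainder is left.\<close>

lemma ustat_degenerate:
  assumes "1 \<le> length \<sigma>" "\<kappa> \<sigma> = 0" "0 < \<delta>"
  shows "(\<lambda>n. P.prob {z. \<delta> \<le> \<bar>sqrt (real n) * (ustat \<sigma> n z - \<theta> \<sigma>)\<bar>}) \<longlonglongrightarrow> 0"
proof -
  have "AE x in \<mu>. (first_proj \<sigma> x - \<theta> \<sigma>)\<^sup>2 = 0"
    using assms(2) first_proj_dev_bound[of \<sigma>] unfolding \<kappa>_def
    by (subst (asm) integral_nonneg_eq_0_iff_AE) (auto intro!: M.integrable_const_bound[where B = 1])
  then have "AE x in \<mu>. first_proj \<sigma> x = \<theta> \<sigma>" by simp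
  then have "AE z in P. first_proj \<sigma> (z i) = \<theta> \<sigma>" for i
    by (intro AE_distrD[OF measurable_coord[of i], unfolded distr_coord])
  then have ae: "AE z in P. \<forall>i. first_proj \<sigma> (z i) = \<theta> \<sigma>" by (simp add: AE_all_countable)
  have "P.prob {z. \<delta> \<le> \<bar>sqrt (real n) * (ustat \<sigma> n z - \<theta> \<sigma>)\<bar>} = P.prob {z. \<delta> \<le> \<bar>sqrt (real n) * remainder \<sigma> n z\<bar>}" for n
  proof (rule P.finite_measure_eq_AE)
    show "AE z in P. z \<in> {z. \<delta> \<le> \<bar>sqrt (real n) * (ustat \<sigma> n z - \<theta> \<sigma>)\<bar>} \<longleftrightarrow> z \<in> {z. \<delta> \<le> \<bar>sqrt (real n) * remainder \<sigma> n z\<bar>}"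
      using ae by eventually_elim (simp add: remainder_def)
    show "{z. \<delta> \<le> \<bar>sqrt (real n) * (ustat \<sigma> n z - \<theta> \<sigma>)\<bar>} \<in> sets P"
      by (rule sets_Collect_P) measurable
    show "{z. \<delta> \<le> \<bar>sqrt (real n) * remainder \<sigma> n z\<bar>} \<in> sets P"
      by (rule sets_Collect_P) measurable
  qed
  then show ?thesis using remainder_tendsto_0[OF assms(1,3)] by simp
qed

end

section \<open>Pattern densities determine the copula\<close>


text \<open>The distribution function at (u, v) of the uniform law on the points (a / n, \<pi>(a) /
  n), that is, of an empirical copula in zero-based ranks.\<close>

definition grid_mass :: "nat \<Rightarrow> real \<Rightarrow> real \<Rightarrow> nat list \<Rightarrow> real" where
  "grid_mass n u v \<pi> = (\<Sum>a<n. of_bool (real a \<le> real n * u \<and> real (\<pi> ! a) \<le> real n * v)) / real n"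

lemma grid_mass_pattern:
  assumes "tie_free {..<n} z"
  shows "grid_mass n u v (pattern n z) = (\<Sum>i<n. of_bool
    (real (rank_in (\<lambda>j. fst (z j)) {..<n} i) \<le> real n * u \<and> real (rank_in (\<lambda>j. snd (z j)) {..<n} i) \<le> real n * v)) / real n"
proof -
  let ?f = "rank_in (\<lambda>j. fst (z j)) {..<n}"
  have "bij_betw ?f {..<n} {..<n}"
    using bij_betw_rank[of "{..<n}" "\<lambda>j. fst (z j)"] assms by (simp add: tie_free_def)
  then have "(\<Sum>a<n. of_bool (real a \<le> real n * u \<and> real (pattern n z ! a) \<le> real n * v))
      = (\<Sum>i<n. of_bool (real (?f i) \<le> real n * u \<and> real (pattern n z ! ?f i) \<le> real n * v) :: real)"
    by (rule sum.reindex_bij_betw[symmetric])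
  also have "\<dots> = (\<Sum>i<n. of_bool (real (?f i) \<le> real n * u \<and> real (rank_in (\<lambda>j. snd (z j)) {..<n} i) \<le> real n * v))"
    using pattern_tie_free(2)[OF assms] unfolding occ_def by (intro sum.cong) auto
  finally show ?thesis unfolding grid_mass_def by (rule arg_cong)
qed

context copula_sample
begin

section \<open>Normalised ranks as approximations of the coordinates\<close>

lemma measurable_uniform_projection:
  assumes "uniform_projection q"
  shows "q \<in> borel_measurable borel" "q \<in> borel_measurable \<mu>"
    "(\<lambda>z. q (z i)) \<in> borel_measurable P"
proof -
  show q: "q \<in> borel_measurable borel" using assms by (simp add: uniform_projection_def)
  then show "q \<in> borel_measurable \<mu>" using measurable_cong_sets[OF sets_mu refl] by auto
  show "(\<lambda>z. q (z i)) \<in> borel_measurable P" by (rule measurable_compose[OF measurable_coord_borel q])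
qed

lemma measure_projection_less:
  assumes "uniform_projection q"
  shows "measure \<mu> {x. q x < t} = max 0 (min 1 t)"
proof -
  have "{0..1} \<inter> {..<t} = (if t \<le> 0 then {} else if t \<le> 1 then {0..<t} else {0..1})" by auto
  then show ?thesis
    using measure_uniform_projection[OF assms, of "{..<t}"] by (auto simp: max_def min_def)
qed

lemma AE_projection_unit:
  assumes "uniform_projection q"
  shows "AE z in P. 0 \<le> q (z i) \<and> q (z i) \<le> 1"
proof -
  note [measurable] = measurable_uniform_projection[OF assms]
  have "M.prob {x \<in> space \<mu>. 0 \<le> q x \<and> q x \<le> 1} = 1"
    using measure_uniform_projection[OF assms, of "{0..1}"] by (simp add: space_base)
  then have "AE x in \<mu>. 0 \<le> q x \<and> q x \<le> 1"
    by (subst (asm) M.prob_Collect_eq_1) auto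
  then show ?thesis
    by (intro AE_distrD[OF measurable_coord[of i], unfolded distr_coord])
qed

text \<open>Given z i, the indicator of every other point has as its mean the uniform distribution
  function at q (z i), written \<open>max 0 (min 1 (q (z i)))\<close> because q may leave the unit
  interval on a null set. The centred indicators are orthogonal, so averaging over singletons, with
  k = r = 1, gives 1/n.\<close>

lemma rank_second_moment:
  assumes q: "uniform_projection q" and i: "i < n"
  shows "(\<integral>z. (real (rank_in (\<lambda>j. q (z j)) {..<n} i) / real n - max 0 (min 1 (q (z i))))\<^sup>2 \<partial>P) \<le> 1 / real n"
proof -
  note [measurable] = measurable_uniform_projection[OF q]
  define T where "T j z = of_bool (q (z j) < q (z i)) - max 0 (min 1 (q (z i)))" for j z
  have T_meas [measurable]: "T j \<in> borel_measurable P" for j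
    unfolding T_def[abs_def] by measurable
  have T_bd: "\<bar>T j z\<bar> \<le> 1" for j z by (auto simp: T_def)
  have orth: "(\<integral>z. T j z * T l z \<partial>P) = 0" if "j \<noteq> l" "l \<noteq> i" for j l
  proof (rule integral_orthogonal[where D = "{l}" and B = 1])
    show "T j (mix {l} z z') = T j z" for z z' using that by (simp add: T_def mix_def)
    show "(\<integral>z'. T l (mix {l} z z') \<partial>P) = 0" for z
    proof -
      have "(\<integral>z'. T l (mix {l} z z') \<partial>P) = (\<integral>z'. indicator {x. q x < q (z i)} (z' l) - max 0 (min 1 (q (z i))) \<partial>P)"
        using that by (intro Bochner_Integration.integral_cong) (auto simp: T_def mix_def indicator_def)
      also have "\<dots> = (\<integral>x. indicator {x. q x < q (z i)} x - max 0 (min 1 (q (z i))) \<partial>\<mu>)"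
        by (rule integral_coord) (auto simp: space_base[symmetric])
      also have "\<dots> = measure \<mu> {x. q x < q (z i)} - max 0 (min 1 (q (z i)))"
      proof -
        have "{x. q x < q (z i)} \<in> sets \<mu>"
          using measurable_sets[of q \<mu> borel "{..<q (z i)}"] by (simp add: space_base vimage_def)
        then show ?thesis
          using M.prob_space by (simp add: space_base M.emeasure_eq_measure)
      qed
      finally show ?thesis by (simp add: measure_projection_less[OF q])
    qed
  qed (auto simp: T_bd)
  have "(\<integral>z. ((\<Sum>I | I \<subseteq> {..<n} \<and> card I = 1. T (the_elem I) z) / real (n choose 1))\<^sup>2 \<partial>P) \<le> 1\<^sup>2 * (real (1 choose 1))\<^sup>2 / real (n choose 1)"
  proof (rule P.second_moment_subset_average)
    fix I J assume "I \<in> {I. I \<subseteq> {..<n} \<and> card I = 1}" "J \<in> {I. I \<subseteq> {..<n} \<and> card I = 1}" and c: "card (I \<inter> J) < 1"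
    then obtain j l where jl: "I = {j}" "J = {l}" by (auto simp: card_1_singleton_iff)
    then have "j \<noteq> l" using c by auto
    \<comment> \<open>\<open>T i\<close> itself is not centred given z i, but in a pair of distinct
      indices one differs from i, and that one is resampled.\<close>
    then have "(\<integral>z. T j z * T l z \<partial>P) = 0"
      using orth[of j l] orth[of l j] by (cases "l = i") (auto simp: mult.commute)
    then show "(\<integral>z. T (the_elem I) z * T (the_elem J) z \<partial>P) = 0" by (simp add: jl)
  qed (use i T_bd in auto)
  moreover have "(\<Sum>I | I \<subseteq> {..<n} \<and> card I = 1. T (the_elem I) z) / real (n choose 1)
      = real (rank_in (\<lambda>j. q (z j)) {..<n} i) / real n - max 0 (min 1 (q (z i)))" for z
  proof -
    have "{I. I \<subseteq> {..<n} \<and> card I = 1} = (\<lambda>j. {j}) ` {..<n}" by (auto simp: card_1_singleton_iff)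
    then have "(\<Sum>I | I \<subseteq> {..<n} \<and> card I = 1. T (the_elem I) z) = (\<Sum>j<n. T j z)"
      by (simp add: sum.reindex)
    also have "\<dots> = real (rank_in (\<lambda>j. q (z j)) {..<n} i) - real n * max 0 (min 1 (q (z i)))"
      by (simp add: T_def sum_subtractf rank_in_def of_bool_def sum.If_cases Int_def)
    finally show ?thesis using i by (simp add: diff_divide_distrib)
  qed
  ultimately show ?thesis by simp
qed

lemma rank_close:
  assumes q: "uniform_projection q" and i: "i < n" and "0 < \<delta>"
  shows "P.prob {z. \<delta> \<le> \<bar>real (rank_in (\<lambda>j. q (z j)) {..<n} i) / real n - q (z i)\<bar>} \<le> 1 / (real n * \<delta>\<^sup>2)"
proof -
  note [measurable] = measurable_uniform_projection[OF q]
  let ?r = "\<lambda>z. real (rank_in (\<lambda>j. q (z j)) {..<n} i) / real n"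
  have r_sum: "?r z = (\<Sum>j<n. of_bool (q (z j) < q (z i))) / real n" for z
    by (simp add: rank_in_def of_bool_def sum.If_cases Int_def)
  have r [measurable]: "?r \<in> borel_measurable P"
    unfolding r_sum by measurable
  have r01: "0 \<le> ?r z" "?r z \<le> 1" for z
    using rank_less_card[of "{..<n}" i "\<lambda>j. q (z j)"] i by (auto simp: divide_le_eq_1)
  \<comment> \<open>Almost surely the coordinate lies in the unit interval, where the truncation
    changes nothing.\<close>
  have "P.prob {z. \<delta> \<le> \<bar>?r z - q (z i)\<bar>} = P.prob {z \<in> space P. \<delta> \<le> \<bar>?r z - max 0 (min 1 (q (z i)))\<bar>}"
  proof (rule P.finite_measure_eq_AE)
    show "AE z in P. z \<in> {z. \<delta> \<le> \<bar>?r z - q (z i)\<bar>} \<longleftrightarrow> z \<in> {z \<in> space P. \<delta> \<le> \<bar>?r z - max 0 (min 1 (q (z i)))\<bar>}"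
      using AE_projection_unit[OF q, of i] by eventually_elim simp
    show "{z. \<delta> \<le> \<bar>?r z - q (z i)\<bar>} \<in> sets P" by (rule sets_Collect_P) measurable
  qed measurable
  also have "\<dots> \<le> (\<integral>z. (?r z - max 0 (min 1 (q (z i))))\<^sup>2 \<partial>P) / \<delta>\<^sup>2"
  proof (rule P.prob_abs_ge_second_moment)
    have "\<bar>?r z - max 0 (min 1 (q (z i)))\<bar> \<le> 1" for z
      using r01[of z] min.cobounded1[of 1 "q (z i)"] max.cobounded1[of 0 "min 1 (q (z i))"]
      by (simp only: abs_le_iff) linarith
    then show "integrable P (\<lambda>z. (?r z - max 0 (min 1 (q (z i))))\<^sup>2)"
      by (intro P.integrable_const_bound[of _ 1]) (auto simp: abs_square_le_1)
  qed (use \<open>0 < \<delta>\<close> in auto)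
  also have "\<dots> \<le> 1 / real n / \<delta>\<^sup>2"
    using rank_second_moment[OF q i] by (intro divide_right_mono) auto
  finally show ?thesis by simp
qed

lemma projection_near:
  assumes q: "uniform_projection q" and "0 < \<delta>"
  shows "P.prob {z. \<bar>q (z i) - u\<bar> \<le> \<delta>} \<le> 2 * \<delta>"
proof -
  note [measurable] = measurable_uniform_projection[OF q]
  have "P.prob {z. \<bar>q (z i) - u\<bar> \<le> \<delta>} = measure (distr P \<mu> (\<lambda>z. z i)) {x. q x \<in> {u - \<delta>..u + \<delta>}}"
  proof (subst measure_distr)
    show "{x. q x \<in> {u - \<delta>..u + \<delta>}} \<in> sets \<mu>"
      using measurable_sets[of q \<mu> borel "{u - \<delta>..u + \<delta>}"] by (simp add: space_base vimage_def)
  qed (auto intro!: arg_cong[of _ _ P.prob] simp: abs_le_iff)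
  also have "\<dots> = measure lborel ({0..1} \<inter> {u - \<delta>..u + \<delta>})"
    by (simp only: distr_coord) (rule measure_uniform_projection[OF q], simp)
  also have "\<dots> \<le> measure lborel {u - \<delta>..u + \<delta>}"
    by (rule measure_mono_fmeasurable) (auto intro!: fmeasurableI simp: emeasure_lborel_Icc_eq)
  also have "\<dots> = 2 * \<delta>" using \<open>0 < \<delta>\<close> by simp
  finally show ?thesis .
qed

text \<open>Unless a coordinate lies within \<delta> of its threshold or its normalised rank misses
  it by \<delta>, rank and coordinate fall on the same side of the threshold. Each of the two near
  events costs 2 \<delta>, each of the two rank events 1 / (n \<delta>^2).\<close>

lemma rank_cdf_approx:
  assumes i: "i < n" and "0 < \<delta>"
  defines "R q z \<equiv> real (rank_in (\<lambda>j. q (z j)) {..<n} i)"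
  shows "\<bar>P.prob {z. R fst z \<le> real n * u \<and> R snd z \<le> real n * v} - copula_cdf \<mu> u v\<bar>
    \<le> 4 * \<delta> + 2 / (real n * \<delta>\<^sup>2)"
proof -
  define A where "A = {z. R fst z \<le> real n * u \<and> R snd z \<le> real n * v}"
  define B where "B = {z :: nat \<Rightarrow> real \<times> real. fst (z i) \<le> u \<and> snd (z i) \<le> v}"
  define N where "N q t = {z :: nat \<Rightarrow> real \<times> real. \<bar>q (z i) - t\<bar> \<le> \<delta>}" for q and t :: real
  define F where "F q = {z. \<delta> \<le> \<bar>R q z / real n - q (z i)\<bar>}" for q :: "real \<times> real \<Rightarrow> real"
  define D where "D = (N fst u \<union> N snd v) \<union> (F fst \<union> F snd)"
  note up = uniform_projection_fst uniform_projection_snd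
  note q_meas = measurable_uniform_projection(3)[OF up(1)] measurable_uniform_projection(3)[OF up(2)]
  note [measurable] = q_meas
  have R_meas: "R q \<in> borel_measurable P" if "uniform_projection q" for q
  proof -
    note [measurable] = measurable_uniform_projection[OF that]
    have R_sum: "R q = (\<lambda>z. \<Sum>j<n. of_bool (q (z j) < q (z i)))"
      by (simp add: fun_eq_iff R_def rank_in_def of_bool_def sum.If_cases Int_def)
    show ?thesis unfolding R_sum by measurable
  qed
  note [measurable] = R_meas[OF up(1)] R_meas[OF up(2)]
  have sets: "A \<in> sets P" "B \<in> sets P" "N fst u \<in> sets P" "N snd v \<in> sets P" "F fst \<in> sets P" "F snd \<in> sets P"
    unfolding A_def B_def N_def F_def by (rule sets_Collect_P; measurable)+
  have n: "0 < real n" using i by simp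
  have iff: "R q z \<le> real n * t \<longleftrightarrow> q (z i) \<le> t" if "z \<notin> N q t" "z \<notin> F q" for q t z
  proof -
    have "R q z \<le> real n * t \<longleftrightarrow> R q z / real n \<le> t" using n by (simp add: divide_le_eq mult.commute)
    also have "\<dots> \<longleftrightarrow> q (z i) \<le> t" using that by (auto simp: N_def F_def)
    finally show ?thesis .
  qed
  have AB: "A \<subseteq> B \<union> D" "B \<subseteq> A \<union> D"
    using iff[of _ fst u] iff[of _ snd v] by (auto simp: A_def B_def D_def)
  have "P.prob D \<le> (P.prob (N fst u) + P.prob (N snd v)) + (P.prob (F fst) + P.prob (F snd))"
    unfolding D_def using sets
    by (intro order_trans[OF measure_Un_le] add_mono measure_Un_le sets.Un)
  also have "\<dots> \<le> (2 * \<delta> + 2 * \<delta>) + (1 / (real n * \<delta>\<^sup>2) + 1 / (real n * \<delta>\<^sup>2))"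
    unfolding N_def F_def R_def
    by (intro add_mono projection_near rank_close up i \<open>0 < \<delta>\<close>)
  finally have D: "P.prob D \<le> 4 * \<delta> + 2 / (real n * \<delta>\<^sup>2)" by simp
  have D_sets: "D \<in> sets P" using sets by (auto simp: D_def)
  have "P.prob A \<le> P.prob (B \<union> D)" using AB sets D_sets by (intro P.finite_measure_mono) auto
  also have "\<dots> \<le> P.prob B + P.prob D" using sets D_sets by (intro measure_Un_le)
  finally have 1: "P.prob A \<le> P.prob B + P.prob D" .
  have "P.prob B \<le> P.prob (A \<union> D)" using AB sets D_sets by (intro P.finite_measure_mono) auto
  also have "\<dots> \<le> P.prob A + P.prob D" using sets D_sets by (intro measure_Un_le)
  finally have 2: "P.prob B \<le> P.prob A + P.prob D" .
  have "P.prob B = measure (distr P \<mu> (\<lambda>z. z i)) ({..u} \<times> {..v})"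
  proof (subst measure_distr)
    show "{..u} \<times> {..v} \<in> sets \<mu>" by (simp add: sets_mu borel_Times)
  qed (auto intro!: arg_cong[of _ _ P.prob] simp: B_def mem_Times_iff)
  then have "P.prob B = copula_cdf \<mu> u v" by (simp add: distr_coord copula_cdf_def)
  with 1 2 D show ?thesis unfolding A_def[symmetric] by linarith
qed

lemma AE_pattern_iff: "\<sigma> \<in> perms k \<Longrightarrow> AE z in P. pattern k z = \<sigma> \<longleftrightarrow> occ \<sigma> {..<k} z"
  by (rule eventually_mono[OF AE_tie_free[of "{..<k}"]]) (simp_all add: pattern_eq_iff)

lemma prob_pattern:
  assumes "\<sigma> \<in> perms k"
  shows "P.prob {z. pattern k z = \<sigma>} = \<theta> \<sigma>"
proof -
  have "length \<sigma> = k" using assms by (simp add: perms_def)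
  moreover have "P.prob {z. pattern k z = \<sigma>} = P.prob {z. occ \<sigma> {..<k} z}"
  proof (rule P.finite_measure_eq_AE)
    show "{z. pattern k z = \<sigma>} \<in> sets P"
      by (intro sets_Collect_P pred_eq_const1[where N = "count_space UNIV"]) auto
    show "{z. occ \<sigma> {..<k} z} \<in> sets P"
      by (intro sets_Collect_P measurable_occ_P) auto
  qed (use AE_pattern_iff[OF assms] in auto)
  ultimately show ?thesis by (simp add: \<theta>_def)
qed

text \<open>The sum involves \<mu> only through \<theta>. It is the expectation of
  \<open>grid_mass\<close> at the pattern of the sample, which is the average over i of the
  probabilities that the normalised ranks of point i satisfy the bounds u and v.\<close>

lemma pattern_density_cdf_approx:
  assumes n: "1 \<le> n" and "0 < \<delta>"
  shows "\<bar>(\<Sum>\<pi>\<in>perms n. \<theta> \<pi> * grid_mass n u v \<pi>) - copula_cdf \<mu> u v\<bar> \<le> 4 * \<delta> + 2 / (real n * \<delta>\<^sup>2)"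
proof -
  define A where "A i = {z. real (rank_in (\<lambda>j. fst (z j)) {..<n} i) \<le> real n * u \<and>
    real (rank_in (\<lambda>j. snd (z j)) {..<n} i) \<le> real n * v}" for i
  have A_sets: "A i \<in> sets P" for i
  proof -
    note [measurable] = measurable_uniform_projection[OF uniform_projection_fst] measurable_uniform_projection[OF uniform_projection_snd]
    have "A i = {z. (\<Sum>j<n. of_bool (fst (z j) < fst (z i))) \<le> real n * u \<and> (\<Sum>j<n. of_bool (snd (z j) < snd (z i))) \<le> real n * v}"
      by (simp add: A_def rank_in_def of_bool_def sum.If_cases Int_def)
    then show ?thesis by (simp only:) (rule sets_Collect_P, measurable)
  qed
  have ind: "integrable P (\<lambda>z. of_bool (pattern n z = \<pi>) * c)" for \<pi> and c :: real
    by (rule P.integrable_const_bound[of _ "\<bar>c\<bar>"]) auto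
  have "(\<Sum>\<pi>\<in>perms n. \<theta> \<pi> * grid_mass n u v \<pi>) = (\<Sum>\<pi>\<in>perms n. \<integral>z. of_bool (pattern n z = \<pi>) * grid_mass n u v \<pi> \<partial>P)"
  proof (rule sum.cong)
    fix \<pi> assume "\<pi> \<in> perms n"
    have "(\<integral>z. of_bool (pattern n z = \<pi>) \<partial>P) = (\<integral>z. indicator {z. pattern n z = \<pi>} z \<partial>P)"
      by (intro Bochner_Integration.integral_cong) (auto simp: indicator_def)
    also have "\<dots> = P.prob {z. pattern n z = \<pi>}"
      by (subst Bochner_Integration.integral_indicator) simp_all
    also have "\<dots> = \<theta> \<pi>" by (rule prob_pattern[OF \<open>\<pi> \<in> perms n\<close>])
    finally have "(\<integral>z. of_bool (pattern n z = \<pi>) \<partial>P) = \<theta> \<pi>" .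
    then show "\<theta> \<pi> * grid_mass n u v \<pi> = (\<integral>z. of_bool (pattern n z = \<pi>) * grid_mass n u v \<pi> \<partial>P)" by simp
  qed simp
  also have "\<dots> = (\<integral>z. (\<Sum>\<pi>\<in>perms n. of_bool (pattern n z = \<pi>) * grid_mass n u v \<pi>) \<partial>P)"
    by (rule Bochner_Integration.integral_sum[symmetric]) (rule ind)
  also have "\<dots> = (\<integral>z. (\<Sum>i<n. indicator (A i) z) / real n \<partial>P)"
  proof (rule integral_cong_AE)
    show "AE z in P. (\<Sum>\<pi>\<in>perms n. of_bool (pattern n z = \<pi>) * grid_mass n u v \<pi>) = (\<Sum>i<n. indicator (A i) z) / real n"
      using AE_tie_free[of "{..<n}", simplified]
    proof eventually_elim
      fix z assume z: "tie_free {..<n} z"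
      have "(\<Sum>\<pi>\<in>perms n. of_bool (pattern n z = \<pi>) * grid_mass n u v \<pi>)
          = (\<Sum>\<pi>\<in>perms n. if pattern n z = \<pi> then grid_mass n u v \<pi> else 0)"
        by (intro sum.cong) auto
      also have "\<dots> = grid_mass n u v (pattern n z)"
        using pattern_tie_free(1)[OF z] finite_perms by (simp add: sum.delta)
      also have "\<dots> = (\<Sum>i<n. indicator (A i) z) / real n"
        by (simp add: grid_mass_pattern[OF z] A_def indicator_def)
      finally show "(\<Sum>\<pi>\<in>perms n. of_bool (pattern n z = \<pi>) * grid_mass n u v \<pi>) = (\<Sum>i<n. indicator (A i) z) / real n" .
    qed
    show "(\<lambda>z. \<Sum>\<pi>\<in>perms n. of_bool (pattern n z = \<pi>) * grid_mass n u v \<pi>) \<in> borel_measurable P"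
      using ind by (intro borel_measurable_sum borel_measurable_integrable)
    show "(\<lambda>z. (\<Sum>i<n. indicator (A i) z) / real n) \<in> borel_measurable P"
      using A_sets by measurable
  qed
  also have "\<dots> = (\<Sum>i<n. P.prob (A i)) / real n"
    using A_sets by (simp add: P.emeasure_eq_measure)
  finally have eq: "(\<Sum>\<pi>\<in>perms n. \<theta> \<pi> * grid_mass n u v \<pi>) = (\<Sum>i<n. P.prob (A i)) / real n" .
  have "\<bar>(\<Sum>i<n. P.prob (A i) - copula_cdf \<mu> u v)\<bar> \<le> (\<Sum>i<n. 4 * \<delta> + 2 / (real n * \<delta>\<^sup>2))"
    unfolding A_def by (rule order_trans[OF sum_abs]) (intro sum_mono rank_cdf_approx, use \<open>0 < \<delta>\<close> in auto)
  then have "\<bar>(\<Sum>i<n. P.prob (A i)) - real n * copula_cdf \<mu> u v\<bar> \<le> real n * (4 * \<delta> + 2 / (real n * \<delta>\<^sup>2))"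
    by (simp add: sum_subtractf)
  moreover have "(\<Sum>i<n. P.prob (A i)) / real n - copula_cdf \<mu> u v = ((\<Sum>i<n. P.prob (A i)) - real n * copula_cdf \<mu> u v) / real n"
    using n by (simp add: diff_divide_distrib)
  ultimately show ?thesis unfolding eq using n by (simp add: abs_divide divide_le_eq mult.commute)
qed

end

text \<open>Equal pattern probabilities give the same sum over \<open>perms n\<close>, and this one
  number approximates both distribution functions.\<close>

lemma copula_cdf_eqI:
  assumes "copula_sample \<mu>" "copula_sample \<nu>"
    and eq: "\<And>n \<pi>. 1 \<le> n \<Longrightarrow> \<pi> \<in> perms n \<Longrightarrow> copula_sample.\<theta> \<mu> \<pi> = copula_sample.\<theta> \<nu> \<pi>"
  shows "copula_cdf \<mu> = copula_cdf \<nu>"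
proof (intro ext)
  fix u v
  interpret m: copula_sample \<mu> by fact
  interpret n: copula_sample \<nu> by fact
  have "\<bar>copula_cdf \<mu> u v - copula_cdf \<nu> u v\<bar> \<le> 0 + e" if "0 < e" for e
  proof -
    \<comment> \<open>The two errors 4 \<delta> then add up to e / 2, and n is taken so large that
      the rank errors contribute at most the other half.\<close>
    define \<delta> where "\<delta> = e / 16"
    have \<delta>: "0 < \<delta>" using that by (simp add: \<delta>_def)
    obtain n :: nat where n: "8 / (e * \<delta>\<^sup>2) < real n" using reals_Archimedean2 by blast
    have "0 < 8 / (e * \<delta>\<^sup>2)" using that \<delta> by simp
    then have n0: "1 \<le> n" using n by (cases n) auto
    have "4 / (real n * \<delta>\<^sup>2) \<le> e / 2"
      using n n0 that \<delta> by (simp add: field_simps)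
    moreover have "\<bar>copula_cdf \<mu> u v - copula_cdf \<nu> u v\<bar> \<le> 2 * (4 * \<delta> + 2 / (real n * \<delta>\<^sup>2))"
    proof -
      have s: "(\<Sum>\<pi>\<in>perms n. m.\<theta> \<pi> * grid_mass n u v \<pi>) = (\<Sum>\<pi>\<in>perms n. n.\<theta> \<pi> * grid_mass n u v \<pi>)"
        using eq[OF n0] by (intro sum.cong) auto
      have "\<bar>a - b\<bar> \<le> 2 * c" if "\<bar>x - a\<bar> \<le> c" "\<bar>x - b\<bar> \<le> c" for a b c x :: real
        using that by linarith
      then show ?thesis
        using m.pattern_density_cdf_approx[OF n0 \<delta>, of u v] n.pattern_density_cdf_approx[OF n0 \<delta>, of u v]
        unfolding s by blast
    qed
    ultimately show ?thesis by (simp add: \<delta>_def)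
  qed
  then have "\<bar>copula_cdf \<mu> u v - copula_cdf \<nu> u v\<bar> \<le> 0" by (rule field_le_epsilon)
  then show "copula_cdf \<mu> u v = copula_cdf \<nu> u v" by simp
qed

section \<open>The Kolmogorov--Smirnov statistic\<close>


lemma gamma_w_pos: "0 < gamma_w"
  unfolding gamma_w_def by (intro divide_pos_pos) auto

lemma weight_pos: "0 < weight \<sigma>"
  unfolding weight_def using gamma_w_pos by simp

definition stat_patterns :: "nat \<Rightarrow> nat list set" where
  "stat_patterns n = (\<Union>j\<in>{1..n}. perms j)"

lemma finite_stat_patterns: "finite (stat_patterns n)"
  by (auto simp: stat_patterns_def finite_perms)

lemma stat_patterns_iff: "\<sigma> \<in> stat_patterns n \<longleftrightarrow> 1 \<le> length \<sigma> \<and> length \<sigma> \<le> n \<and> \<sigma> \<in> perms (length \<sigma>)"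
  by (auto simp: stat_patterns_def perms_def)

lemma stat_patterns_nonempty: "1 \<le> n \<Longrightarrow> stat_patterns n \<noteq> {}"
proof -
  assume "1 \<le> n"
  then have "[0] \<in> stat_patterns n" by (simp add: stat_patterns_iff perms_def lessThan_Suc)
  then show ?thesis by auto
qed

definition coef :: "nat list \<Rightarrow> real" where
  "coef \<sigma> = sqrt (weight \<sigma>) / real (length \<sigma>)"

lemma coef_pos: "1 \<le> length \<sigma> \<Longrightarrow> 0 < coef \<sigma>"
  unfolding coef_def using weight_pos[of \<sigma>] by (intro divide_pos_pos) auto

lemma coef_squared: "(coef \<sigma>)\<^sup>2 = weight \<sigma> / (real (length \<sigma>))\<^sup>2"
  using weight_pos[of \<sigma>] by (simp add: coef_def power_divide)

text \<open>There are j! permutations of length j and each weight carries j!^-2, so one length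
  contributes at most \<open>gamma_w\<close> times 2^-j, and a geometric tail remains.\<close>

lemma sum_weight_tail: "(\<Sum>\<sigma>\<in>stat_patterns n - stat_patterns K. weight \<sigma>) \<le> gamma_w * (1 / 2) ^ K"
proof -
  have "stat_patterns n - stat_patterns K = (\<Union>j\<in>{K+1..n}. perms j)"
  proof (intro set_eqI iffI)
    fix \<sigma> assume "\<sigma> \<in> stat_patterns n - stat_patterns K"
    then have "length \<sigma> \<in> {K+1..n}" "\<sigma> \<in> perms (length \<sigma>)" by (auto simp: stat_patterns_iff)
    then show "\<sigma> \<in> (\<Union>j\<in>{K+1..n}. perms j)" by blast
  next
    fix \<sigma> assume "\<sigma> \<in> (\<Union>j\<in>{K+1..n}. perms j)"
    then have "length \<sigma> \<in> {K+1..n}" "\<sigma> \<in> perms (length \<sigma>)" by (auto simp: perms_def)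
    then show "\<sigma> \<in> stat_patterns n - stat_patterns K" by (simp add: stat_patterns_iff)
  qed
  then have "(\<Sum>\<sigma>\<in>stat_patterns n - stat_patterns K. weight \<sigma>) = (\<Sum>j\<in>{K+1..n}. \<Sum>\<sigma>\<in>perms j. weight \<sigma>)"
    by (simp only:) (rule sum.UNION_disjoint, simp, simp add: finite_perms, auto simp: perms_def)
  also have "\<dots> \<le> (\<Sum>j\<in>{K+1..n}. gamma_w * (1 / 2) ^ j)"
  proof (rule sum_mono)
    fix j
    have "(\<Sum>\<sigma>\<in>perms j. weight \<sigma>) = (\<Sum>\<sigma>\<in>perms j. gamma_w / ((fact j)\<^sup>2 * 2 ^ j))"
      by (rule sum.cong) (auto simp: weight_def perms_def)
    also have "\<dots> = gamma_w / 2 ^ j / fact j"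
      by (simp add: card_perms power2_eq_square)
    also have "\<dots> \<le> gamma_w / 2 ^ j / 1"
      using gamma_w_pos by (intro divide_left_mono fact_ge_1) auto
    finally show "(\<Sum>\<sigma>\<in>perms j. weight \<sigma>) \<le> gamma_w * (1 / 2) ^ j" by (simp add: power_divide)
  qed
  also have "\<dots> = gamma_w * (\<Sum>j\<in>{K+1..n}. (1 / 2) ^ j)" by (simp add: sum_distrib_left)
  also have "\<dots> \<le> gamma_w * (1 / 2) ^ K"
  proof (intro mult_left_mono)
    \<comment> \<open>The subtracted term makes the induction go through; the maximum covers n < K,
      where the sum is empty.\<close>
    have "(\<Sum>j\<in>{K+1..n}. (1 / 2 :: real) ^ j) \<le> (1 / 2) ^ K - (1 / 2) ^ max n K"
    proof (induction n)
      case (Suc n)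
      show ?case
      proof (cases "K + 1 \<le> Suc n")
        case True
        then have "{K+1..Suc n} = insert (Suc n) {K+1..n}" by auto
        moreover have "max (Suc n) K = Suc n" "max n K = n" using True by auto
        ultimately show ?thesis using Suc.IH by simp
      qed simp
    qed simp
    then show "(\<Sum>j\<in>{K+1..n}. (1 / 2 :: real) ^ j) \<le> (1 / 2) ^ K"
      using zero_le_power[of "1 / 2 :: real" "max n K"] by linarith
  qed (use gamma_w_pos in simp)
  finally show ?thesis .
qed

context copula_sample
begin

text \<open>A single term of the maximum. C is the copula of the hypothesis, which may differ from
  the one that generates the sample.\<close>

definition dev :: "(real \<Rightarrow> real \<Rightarrow> real) \<Rightarrow> nat list \<Rightarrow> nat \<Rightarrow> (nat \<Rightarrow> real \<times> real) \<Rightarrow> real" where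
  "dev C \<sigma> n z = sqrt (real n) * (coef \<sigma> * \<bar>ustat \<sigma> n z - CS C \<sigma>\<bar>)"

lemma measurable_dev [measurable]: "dev C \<sigma> n \<in> borel_measurable P"
  unfolding dev_def[abs_def] by measurable

lemma KS_tie_free:
  assumes "tie_free {..<n} z" "1 \<le> n"
  shows KS_attained: "\<exists>\<sigma>\<in>stat_patterns n. KS C n (pattern n z) = dev C \<sigma> n z"
    and dev_le_KS: "\<sigma> \<in> stat_patterns n \<Longrightarrow> dev C \<sigma> n z \<le> KS C n (pattern n z)"
proof -
  let ?f = "\<lambda>\<sigma>. sqrt (weight \<sigma>) / real (length \<sigma>) * \<bar>pdens (pattern n z) \<sigma> - CS C \<sigma>\<bar>"
  have dev: "sqrt (real n) * ?f \<sigma> = dev C \<sigma> n z" if "\<sigma> \<in> stat_patterns n" for \<sigma>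
    using pdens_pattern[OF assms(1), of \<sigma> "length \<sigma>"] that
    by (simp add: dev_def coef_def ustat_def hit_def stat_patterns_iff)
  have KS: "KS C n (pattern n z) = sqrt (real n) * Max (?f ` stat_patterns n)"
    by (simp add: KS_def stat_patterns_def)
  have fin: "finite (?f ` stat_patterns n)" using finite_stat_patterns by blast
  have "Max (?f ` stat_patterns n) \<in> ?f ` stat_patterns n"
    using stat_patterns_nonempty[OF assms(2)] fin by (intro Max_in) auto
  then show "\<exists>\<sigma>\<in>stat_patterns n. KS C n (pattern n z) = dev C \<sigma> n z"
    using KS dev by auto
  show "dev C \<sigma> n z \<le> KS C n (pattern n z)" if "\<sigma> \<in> stat_patterns n"
    unfolding KS dev[OF that, symmetric] using fin that by (intro mult_left_mono Max_ge) auto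
qed

lemma measurable_KS [measurable]: "(\<lambda>z. KS C n (pattern n z)) \<in> borel_measurable P"
  by (rule measurable_compose[OF measurable_pattern_P]) simp

lemma prob_le_of_tie_free:
  assumes "A \<in> sets P" "B \<in> sets P" "\<And>z. tie_free {..<n} z \<Longrightarrow> z \<in> A \<Longrightarrow> z \<in> B"
  shows "P.prob A \<le> P.prob B"
  by (rule P.finite_measure_mono_AE[OF eventually_mono[OF AE_tie_free[of "{..<n}"]]]) (use assms in auto)

lemma ustat_deviation:
  assumes "1 \<le> length \<sigma>" "length \<sigma> \<le> n" "0 < \<delta>" "0 \<le> c"
  shows "P.prob {z. \<delta> \<le> c * \<bar>ustat \<sigma> n z - \<theta> \<sigma>\<bar>} \<le> c\<^sup>2 * ((real (length \<sigma>))\<^sup>2 / real n) / \<delta>\<^sup>2"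
proof -
  have "\<bar>ustat \<sigma> n z - \<theta> \<sigma>\<bar> \<le> 1" for z
    using ustat_bounds[of \<sigma> n z] theta_bounds[of \<sigma>] by linarith
  then have int: "integrable P (\<lambda>z. (ustat \<sigma> n z - \<theta> \<sigma>)\<^sup>2)"
    by (intro P.integrable_const_bound[of _ 1]) (auto simp: abs_square_le_1)
  have "P.prob {z. \<delta> \<le> c * \<bar>ustat \<sigma> n z - \<theta> \<sigma>\<bar>} = P.prob {z \<in> space P. \<delta> \<le> \<bar>c * (ustat \<sigma> n z - \<theta> \<sigma>)\<bar>}"
    using assms(4) by (simp add: abs_mult)
  also have "\<dots> \<le> (\<integral>z. (c * (ustat \<sigma> n z - \<theta> \<sigma>))\<^sup>2 \<partial>P) / \<delta>\<^sup>2"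
    using assms(3) int by (intro P.prob_abs_ge_second_moment) (auto simp: power_mult_distrib)
  also have "(\<integral>z. (c * (ustat \<sigma> n z - \<theta> \<sigma>))\<^sup>2 \<partial>P) = c\<^sup>2 * (\<integral>z. (ustat \<sigma> n z - \<theta> \<sigma>)\<^sup>2 \<partial>P)"
    by (simp add: power_mult_distrib)
  also have "\<dots> / \<delta>\<^sup>2 \<le> c\<^sup>2 * ((real (length \<sigma>))\<^sup>2 / real n) / \<delta>\<^sup>2"
    using second_moment_ustat[OF assms(1,2)] by (intro divide_right_mono mult_left_mono) auto
  finally show ?thesis .
qed

end

text \<open>\<open>copula_law\<close> picks a measure by choice. Naming its value \<mu> carries the
  results over to \<open>sample\<close>, \<open>CS\<close> and \<open>CS2\<close>; the locale serves
  both the hypothesis and the alternative.\<close>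

locale copula_model = copula_sample +
  fixes C :: "real \<Rightarrow> real \<Rightarrow> real"
  assumes law: "copula_law C = \<mu>"
begin

lemma sample_eq: "sample n C = PiM {..<n} (\<lambda>_. \<mu>)"
  by (simp add: sample_def law)

lemma CS_eq_theta: "\<sigma> \<in> perms (length \<sigma>) \<Longrightarrow> CS C \<sigma> = \<theta> \<sigma>"
  unfolding CS_def using measure_pattern[OF sample_eq, of "length \<sigma>" "\<lambda>\<pi>. \<pi> = \<sigma>"]
  by (simp add: prob_pattern)

lemma CS2_eq:
  assumes \<sigma>: "\<sigma> \<in> perms (length \<sigma>)" "1 \<le> length \<sigma>"
  shows "CS2 C \<sigma> \<sigma> = \<kappa> \<sigma> + (\<theta> \<sigma>)\<^sup>2"
proof -
  define k where "k = length \<sigma>"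
  define \<phi> where "\<phi> i = (if i = 0 then 0 else k + i - 1)" for i :: nat
  define S where "S = sample (k + k) C"
  have S: "S = PiM {..<k + k} (\<lambda>_. \<mu>)" by (simp add: S_def sample_eq)
  have comp: "(\<lambda>i. if i = 0 then z 0 else z (k + i - 1)) = z \<circ> \<phi>" for z :: "nat \<Rightarrow> real \<times> real"
    by (auto simp: \<phi>_def)
  have lt: "\<phi> i < k + k" if "i < k" for i using that by (auto simp: \<phi>_def)
  have coord: "(\<lambda>z. z i) \<in> borel_measurable S" if "i < k + k" for i
  proof -
    have "(\<lambda>z. z i) \<in> measurable S \<mu>" using that by (simp add: S)
    then show ?thesis by (simp add: measurable_cong_sets[OF refl sets_mu])
  qed
  have [measurable]: "pattern k \<in> measurable S (count_space UNIV)"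
    by (rule measurable_pattern) (simp add: coord)
  have [measurable]: "(\<lambda>z. pattern k (z \<circ> \<phi>)) \<in> measurable S (count_space UNIV)"
  proof -
    \<comment> \<open>\<open>z \<circ> \<phi>\<close> may address coordinates outside the index set
      of S, so it is first cut to \<open>{..<k}\<close>, which is all that \<open>pattern k\<close>
      reads.\<close>
    have "(\<lambda>z. \<lambda>i\<in>{..<k}. z (\<phi> i)) \<in> measurable S (PiM {..<k} (\<lambda>_. borel))"
      using lt coord by (intro measurable_restrict) auto
    moreover have "pattern k \<in> measurable (PiM {..<k} (\<lambda>_. borel)) (count_space UNIV)"
      by (rule measurable_pattern) auto
    ultimately have "(\<lambda>z. pattern k (\<lambda>i\<in>{..<k}. z (\<phi> i))) \<in> measurable S (count_space UNIV)"
      by (rule measurable_compose)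
    moreover have "pattern k (\<lambda>i\<in>{..<k}. z (\<phi> i)) = pattern k (z \<circ> \<phi>)" for z
      by (rule pattern_cong) simp
    ultimately show ?thesis by simp
  qed
  have "CS2 C \<sigma> \<sigma> = measure S {z \<in> space S. pattern k z = \<sigma> \<and> pattern k (z \<circ> \<phi>) = \<sigma>}"
    unfolding CS2_def Let_def S_def k_def[symmetric] comp ..
  also have "\<dots> = P.prob {z. pattern k z = \<sigma> \<and> pattern k (z \<circ> \<phi>) = \<sigma>}"
  proof (rule measure_finite_sample[OF S])
    show "Measurable.pred S (\<lambda>z. pattern k z = \<sigma> \<and> pattern k (z \<circ> \<phi>) = \<sigma>)"
      by (intro pred_intros_logic pred_eq_const1[where N = "count_space UNIV"]) auto
    fix z :: "nat \<Rightarrow> real \<times> real"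
    have "pattern k (restrict z {..<k + k}) = pattern k z" by (rule pattern_cong) simp
    moreover have "pattern k (restrict z {..<k + k} \<circ> \<phi>) = pattern k (z \<circ> \<phi>)"
      by (rule pattern_cong) (simp add: lt)
    ultimately show "(pattern k (restrict z {..<k + k}) = \<sigma> \<and> pattern k (restrict z {..<k + k} \<circ> \<phi>) = \<sigma>) \<longleftrightarrow>
        (pattern k z = \<sigma> \<and> pattern k (z \<circ> \<phi>) = \<sigma>)" by simp
  qed
  also have "\<dots> = \<kappa> \<sigma> + (\<theta> \<sigma>)\<^sup>2"
    using prob_double_pattern[OF \<sigma>] unfolding k_def[symmetric] comp .
  finally show ?thesis .
qed

section \<open>Tails and atoms of the statistic\<close>

lemma dev_eq: "\<sigma> \<in> perms (length \<sigma>) \<Longrightarrow> dev C \<sigma> n z = sqrt (real n) * coef \<sigma> * \<bar>ustat \<sigma> n z - \<theta> \<sigma>\<bar>"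
  by (simp add: dev_def CS_eq_theta)

text \<open>Chebyshev's inequality for each pattern, and summation of the weights. The bound is
  uniform in n: K = 0 yields tightness of the statistic, and a large K removes the long
  patterns.\<close>

lemma prob_dev_tail:
  assumes "0 < \<delta>"
  shows "P.prob {z. \<exists>\<sigma>\<in>stat_patterns n - stat_patterns K. \<delta> \<le> dev C \<sigma> n z} \<le> gamma_w * (1 / 2) ^ K / \<delta>\<^sup>2"
proof -
  let ?I = "stat_patterns n - stat_patterns K"
  have "P.prob {z. \<exists>\<sigma>\<in>?I. \<delta> \<le> dev C \<sigma> n z} = P.prob (\<Union>\<sigma>\<in>?I. {z. \<delta> \<le> dev C \<sigma> n z})"
    by (rule arg_cong[of _ _ P.prob]) auto
  also have "\<dots> \<le> (\<Sum>\<sigma>\<in>?I. P.prob {z. \<delta> \<le> dev C \<sigma> n z})"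
  proof (rule measure_UNION_le)
    show "{z. \<delta> \<le> dev C \<sigma> n z} \<in> sets P" for \<sigma> by (rule sets_Collect_P) measurable
  qed (simp add: finite_stat_patterns)
  also have "\<dots> \<le> (\<Sum>\<sigma>\<in>?I. weight \<sigma> / \<delta>\<^sup>2)"
  proof (rule sum_mono)
    fix \<sigma> assume "\<sigma> \<in> ?I"
    then have \<sigma>: "1 \<le> length \<sigma>" "length \<sigma> \<le> n" "\<sigma> \<in> perms (length \<sigma>)" by (auto simp: stat_patterns_iff)
    have "P.prob {z. \<delta> \<le> dev C \<sigma> n z} \<le> (sqrt (real n) * coef \<sigma>)\<^sup>2 * ((real (length \<sigma>))\<^sup>2 / real n) / \<delta>\<^sup>2"
      unfolding dev_eq[OF \<sigma>(3)] using \<sigma> assms coef_pos[OF \<sigma>(1)] by (intro ustat_deviation) auto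
    also have "(sqrt (real n) * coef \<sigma>)\<^sup>2 * ((real (length \<sigma>))\<^sup>2 / real n) = weight \<sigma>"
    proof -
      have "\<sigma> \<noteq> []" "n \<noteq> 0" using \<sigma> by auto
      then show ?thesis by (simp add: power_mult_distrib coef_squared)
    qed
    finally show "P.prob {z. \<delta> \<le> dev C \<sigma> n z} \<le> weight \<sigma> / \<delta>\<^sup>2" .
  qed
  also have "\<dots> = (\<Sum>\<sigma>\<in>?I. weight \<sigma>) / \<delta>\<^sup>2" by (simp add: sum_divide_distrib)
  also have "\<dots> \<le> gamma_w * (1 / 2) ^ K / \<delta>\<^sup>2"
    by (intro divide_right_mono sum_weight_tail) simp
  finally show ?thesis .
qed

lemma prob_KS_gt:
  assumes "1 \<le> n" "0 < t"
  shows "P.prob {z. t < KS C n (pattern n z)} \<le> gamma_w / t\<^sup>2"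
proof -
  have "P.prob {z. t < KS C n (pattern n z)} \<le> P.prob {z. \<exists>\<sigma>\<in>stat_patterns n - stat_patterns 0. t \<le> dev C \<sigma> n z}"
  proof (rule prob_le_of_tie_free)
    show "{z. t < KS C n (pattern n z)} \<in> sets P" by (rule sets_Collect_P) measurable
    show "{z. \<exists>\<sigma>\<in>stat_patterns n - stat_patterns 0. t \<le> dev C \<sigma> n z} \<in> sets P"
      by (intro sets_Collect_P pred_intros_finite) (auto simp: finite_stat_patterns)
    fix z assume "tie_free {..<n} z" "z \<in> {z. t < KS C n (pattern n z)}"
    then show "z \<in> {z. \<exists>\<sigma>\<in>stat_patterns n - stat_patterns 0. t \<le> dev C \<sigma> n z}"
      using KS_attained[of n z C] assms(1) by (force simp: stat_patterns_def)
  qed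
  also have "\<dots> \<le> gamma_w * (1 / 2) ^ 0 / t\<^sup>2" by (rule prob_dev_tail) (rule assms)
  finally show ?thesis by simp
qed

text \<open>The window around x = 0, rescaled by the coefficient. Since the statistic dominates each
  of its terms, this keeps the whole maximum away from 0.\<close>

lemma dev_small_ball:
  assumes \<sigma>: "1 \<le> length \<sigma>" "\<sigma> \<in> perms (length \<sigma>)" "\<kappa> \<sigma> > 0" and "0 < \<eta>"
  shows "\<exists>\<delta>>0. \<forall>\<^sub>F n in sequentially. P.prob {z. dev C \<sigma> n z \<le> \<delta>} \<le> \<eta>"
proof -
  obtain \<delta> where \<delta>: "\<delta> > 0"
    "\<forall>\<^sub>F n in sequentially. \<forall>x. P.prob {z. \<bar>sqrt (real n) * (ustat \<sigma> n z - \<theta> \<sigma>) - x\<bar> \<le> \<delta>} \<le> \<eta>"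
    using ustat_concentration[OF \<sigma>(1,3) assms(4)] by blast
  note c = coef_pos[OF \<sigma>(1)]
  have "dev C \<sigma> n z \<le> coef \<sigma> * \<delta> \<longleftrightarrow> \<bar>sqrt (real n) * (ustat \<sigma> n z - \<theta> \<sigma>) - 0\<bar> \<le> \<delta>" for n z
  proof -
    have "dev C \<sigma> n z = coef \<sigma> * \<bar>sqrt (real n) * (ustat \<sigma> n z - \<theta> \<sigma>) - 0\<bar>"
      by (simp add: dev_eq[OF \<sigma>(2)] abs_mult)
    then show ?thesis using c by (simp only: mult_le_cancel_left_pos)
  qed
  moreover have "\<forall>\<^sub>F n in sequentially. P.prob {z. \<bar>sqrt (real n) * (ustat \<sigma> n z - \<theta> \<sigma>) - 0\<bar> \<le> \<delta>} \<le> \<eta>"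
    using \<delta>(2) by (rule eventually_mono) (erule spec)
  ultimately have "\<forall>\<^sub>F n in sequentially. P.prob {z. dev C \<sigma> n z \<le> coef \<sigma> * \<delta>} \<le> \<eta>"
    by (simp only:)
  then show ?thesis using c \<delta>(1) by (intro exI[of _ "coef \<sigma> * \<delta>"]) simp
qed

text \<open>An absolute value equals s only at s and -s, so two windows are needed and each may cost
  \<eta>/2. The bound holds for all t simultaneously because t will be a quantile that depends on
  n.\<close>

lemma dev_atoms:
  assumes \<sigma>: "1 \<le> length \<sigma>" "\<sigma> \<in> perms (length \<sigma>)" "\<kappa> \<sigma> > 0" and "0 < \<eta>"
  shows "\<forall>\<^sub>F n in sequentially. \<forall>t. P.prob {z. dev C \<sigma> n z = t} \<le> \<eta>"
proof -
  obtain \<delta> where \<delta>: "\<delta> > 0"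
    "\<forall>\<^sub>F n in sequentially. \<forall>x. P.prob {z. \<bar>sqrt (real n) * (ustat \<sigma> n z - \<theta> \<sigma>) - x\<bar> \<le> \<delta>} \<le> \<eta> / 2"
    using ustat_concentration[OF \<sigma>(1,3), of "\<eta> / 2"] assms(4) by auto
  note c = coef_pos[OF \<sigma>(1)]
  from \<delta>(2) show ?thesis
  proof eventually_elim
    case (elim n)
    define N where "N x = {z. \<bar>sqrt (real n) * (ustat \<sigma> n z - \<theta> \<sigma>) - x\<bar> \<le> \<delta>}" for x
    have N: "N x \<in> sets P" for x unfolding N_def by (rule sets_Collect_P) measurable
    show ?case
    proof
      fix t
      have "{z. dev C \<sigma> n z = t} \<subseteq> N (t / coef \<sigma>) \<union> N (- (t / coef \<sigma>))"
      proof
        fix z assume "z \<in> {z. dev C \<sigma> n z = t}"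
        then have "\<bar>sqrt (real n) * (ustat \<sigma> n z - \<theta> \<sigma>)\<bar> = t / coef \<sigma>"
          using c by (simp add: dev_eq[OF \<sigma>(2)] abs_mult eq_divide_eq mult_ac)
        then show "z \<in> N (t / coef \<sigma>) \<union> N (- (t / coef \<sigma>))"
          using \<delta>(1) by (auto simp: N_def abs_if split: if_splits)
      qed
      then have "P.prob {z. dev C \<sigma> n z = t} \<le> P.prob (N (t / coef \<sigma>) \<union> N (- (t / coef \<sigma>)))"
        using N by (intro P.finite_measure_mono) auto
      also have "\<dots> \<le> P.prob (N (t / coef \<sigma>)) + P.prob (N (- (t / coef \<sigma>)))"
        using N by (intro measure_Un_le)
      also have "\<dots> \<le> \<eta> / 2 + \<eta> / 2" unfolding N_def by (intro add_mono elim[rule_format])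
      finally show "P.prob {z. dev C \<sigma> n z = t} \<le> \<eta>" by simp
    qed
  qed
qed

lemma KS_atoms:
  assumes \<sigma>0: "1 \<le> length \<sigma>0" "\<sigma>0 \<in> perms (length \<sigma>0)" "\<kappa> \<sigma>0 > 0" and \<eta>: "0 < \<eta>"
  shows "\<forall>\<^sub>F n in sequentially. \<forall>t. P.prob {z. KS C n (pattern n z) = t} \<le> \<eta>"
proof -
  \<comment> \<open>One quarter for each of the events A, B, D and E below.\<close>
  define e where "e = \<eta> / 4"
  have e: "0 < e" using \<eta> by (simp add: e_def)
  obtain \<delta> where \<delta>: "\<delta> > 0" and small: "\<forall>\<^sub>F n in sequentially. P.prob {z. dev C \<sigma>0 n z \<le> \<delta>} \<le> e"
    using dev_small_ball[OF \<sigma>0 e] by blast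
  have "(\<lambda>K. gamma_w * (1 / 2) ^ K / \<delta>\<^sup>2) \<longlonglongrightarrow> gamma_w * 0 / \<delta>\<^sup>2"
    using \<delta> by (intro tendsto_intros LIMSEQ_realpow_zero) auto
  then have "\<forall>\<^sub>F K in sequentially. gamma_w * (1 / 2) ^ K / \<delta>\<^sup>2 < e"
    by (rule order_tendstoD(2)) (use e in simp)
  then obtain K where K: "gamma_w * (1 / 2) ^ K / \<delta>\<^sup>2 < e" by (auto simp: eventually_sequentially)
  define Dg where "Dg = {\<sigma> \<in> stat_patterns K. \<kappa> \<sigma> = 0}"
  define Nd where "Nd = {\<sigma> \<in> stat_patterns K. \<kappa> \<sigma> > 0}"
  have fin: "finite Dg" "finite Nd" by (auto simp: Dg_def Nd_def finite_stat_patterns)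
  have "(\<lambda>n. \<Sum>\<sigma>\<in>Dg. P.prob {z. \<delta> \<le> dev C \<sigma> n z}) \<longlonglongrightarrow> (\<Sum>\<sigma>\<in>Dg. 0)"
  proof (rule tendsto_sum)
    fix \<sigma> assume "\<sigma> \<in> Dg"
    then have \<sigma>: "1 \<le> length \<sigma>" "\<sigma> \<in> perms (length \<sigma>)" "\<kappa> \<sigma> = 0" by (auto simp: Dg_def stat_patterns_iff)
    note c = coef_pos[OF \<sigma>(1)]
    have "\<delta> \<le> dev C \<sigma> n z \<longleftrightarrow> \<delta> / coef \<sigma> \<le> \<bar>sqrt (real n) * (ustat \<sigma> n z - \<theta> \<sigma>)\<bar>" for n z
      using c by (simp add: dev_eq[OF \<sigma>(2)] abs_mult pos_divide_le_eq mult_ac)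
    then show "(\<lambda>n. P.prob {z. \<delta> \<le> dev C \<sigma> n z}) \<longlonglongrightarrow> 0"
      using ustat_degenerate[OF \<sigma>(1,3), of "\<delta> / coef \<sigma>"] c \<delta> by simp
  qed
  then have degenerate: "\<forall>\<^sub>F n in sequentially. (\<Sum>\<sigma>\<in>Dg. P.prob {z. \<delta> \<le> dev C \<sigma> n z}) < e"
    by (rule order_tendstoD(2)) (use e in simp)
  \<comment> \<open>The added 1 keeps e' positive when \<open>Nd\<close> is empty, which can happen
    because K is chosen without regard to the length of \<sigma>0.\<close>
  define e' where "e' = e / (real (card Nd) + 1)"
  have "real (card Nd) / (real (card Nd) + 1) \<le> 1" by simp
  then have e': "0 < e'" "real (card Nd) * e' \<le> e"
    using e mult_left_mono[of "real (card Nd) / (real (card Nd) + 1)" 1 e] by (simp_all add: e'_def mult.commute)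
  have "\<forall>\<^sub>F n in sequentially. \<forall>\<sigma>\<in>Nd. \<forall>t. P.prob {z. dev C \<sigma> n z = t} \<le> e'"
    by (intro eventually_ball_finite ballI dev_atoms fin e') (auto simp: Nd_def stat_patterns_iff)
  with small degenerate eventually_ge_at_top[of "max 1 (length \<sigma>0)"] show ?thesis
  proof eventually_elim
    case (elim n)
    then have n: "1 \<le> n" and \<sigma>0_in: "\<sigma>0 \<in> stat_patterns n" using \<sigma>0 by (auto simp: stat_patterns_iff)
    show ?case
    proof
      fix t
      \<comment> \<open>Outside A the maximum exceeds \<delta>. A pattern attaining it that is long
        or degenerate then puts z into B or D; any other one takes the value t and puts z into
        E.\<close>
      define A where "A = {z. dev C \<sigma>0 n z \<le> \<delta>}"
      define B where "B = {z. \<exists>\<sigma>\<in>stat_patterns n - stat_patterns K. \<delta> \<le> dev C \<sigma> n z}"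
      define D where "D = (\<Union>\<sigma>\<in>Dg. {z. \<delta> \<le> dev C \<sigma> n z})"
      define E where "E = (\<Union>\<sigma>\<in>Nd. {z. dev C \<sigma> n z = t})"
      have dev_sets: "{z. \<delta> \<le> dev C \<sigma> n z} \<in> sets P" "{z. dev C \<sigma> n z = t} \<in> sets P" for \<sigma>
        by (rule sets_Collect_P; measurable)+
      have sets: "A \<in> sets P" "B \<in> sets P" "D \<in> sets P" "E \<in> sets P"
      proof -
        show "A \<in> sets P" unfolding A_def by (rule sets_Collect_P) measurable
        show "B \<in> sets P" unfolding B_def
          by (intro sets_Collect_P pred_intros_finite) (auto simp: finite_stat_patterns)
        show "D \<in> sets P" "E \<in> sets P" unfolding D_def E_def using fin dev_sets
          by (auto intro!: sets.finite_UN)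
      qed
      have "P.prob {z. KS C n (pattern n z) = t} \<le> P.prob ((A \<union> B) \<union> (D \<union> E))"
      proof (rule prob_le_of_tie_free)
        show "{z. KS C n (pattern n z) = t} \<in> sets P" by (rule sets_Collect_P) measurable
        fix z assume z: "tie_free {..<n} z" "z \<in> {z. KS C n (pattern n z) = t}"
        obtain \<sigma> where \<sigma>: "\<sigma> \<in> stat_patterns n" "KS C n (pattern n z) = dev C \<sigma> n z"
          using KS_attained[OF z(1) n] by blast
        have "dev C \<sigma>0 n z \<le> dev C \<sigma> n z" using dev_le_KS[OF z(1) n \<sigma>0_in, of C] \<sigma>(2) by simp
        then have "z \<in> A \<or> \<delta> \<le> dev C \<sigma> n z" by (auto simp: A_def)
        moreover have "\<sigma> \<notin> stat_patterns K \<or> \<sigma> \<in> Dg \<or> \<sigma> \<in> Nd"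
          using kappa_nonneg[of \<sigma>] by (auto simp: Dg_def Nd_def less_le)
        moreover have "dev C \<sigma> n z = t" using \<sigma>(2) z(2) by simp
        ultimately show "z \<in> (A \<union> B) \<union> (D \<union> E)"
          using \<sigma>(1) unfolding B_def D_def E_def by blast
      qed (use sets in auto)
      also have "\<dots> \<le> (P.prob A + P.prob B) + (P.prob D + P.prob E)"
        using sets by (intro order_trans[OF measure_Un_le] add_mono measure_Un_le sets.Un)
      also have "\<dots> \<le> (e + e) + (e + e)"
      proof (intro add_mono)
        show "P.prob A \<le> e" using elim by (simp add: A_def)
        show "P.prob B \<le> e" unfolding B_def using prob_dev_tail[OF \<delta>, of n K] K by linarith
        have "P.prob D \<le> (\<Sum>\<sigma>\<in>Dg. P.prob {z. \<delta> \<le> dev C \<sigma> n z})"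
          unfolding D_def using fin dev_sets by (intro measure_UNION_le)
        then show "P.prob D \<le> e" using elim by linarith
        have "P.prob E \<le> (\<Sum>\<sigma>\<in>Nd. P.prob {z. dev C \<sigma> n z = t})"
          unfolding E_def using fin dev_sets by (intro measure_UNION_le)
        also have "\<dots> \<le> (\<Sum>\<sigma>\<in>Nd. e')" using elim by (intro sum_mono) auto
        also have "\<dots> \<le> e" using e' by simp
        finally show "P.prob E \<le> e" .
      qed
      finally show "P.prob {z. KS C n (pattern n z) = t} \<le> \<eta>" by (simp add: e_def)
    qed
  qed
qed

section \<open>Level and power of the test\<close>

lemma ks_prob_eq:
  "ks_prob_gt C0 C n t = P.prob {z. t < KS C0 n (pattern n z)}"
  "ks_prob_ge C0 C n t = P.prob {z. t \<le> KS C0 n (pattern n z)}"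
  unfolding ks_prob_gt_def ks_prob_ge_def
  using measure_pattern[OF sample_eq, of n "\<lambda>\<pi>. t < KS C0 n \<pi>"] measure_pattern[OF sample_eq, of n "\<lambda>\<pi>. t \<le> KS C0 n \<pi>"]
  by simp_all

lemma ks_quantile_bounds:
  assumes "0 < \<alpha>" "\<alpha> < 1"
  shows "ks_prob_gt C C n (ks_quantile C \<alpha> n) \<le> \<alpha>" "\<alpha> \<le> ks_prob_ge C C n (ks_quantile C \<alpha> n)"
    "ks_prob_gt C C n t \<le> \<alpha> \<Longrightarrow> ks_quantile C \<alpha> n \<le> t"
  using P.prob_gt_quantile[OF measurable_KS[of C n] assms] P.prob_ge_quantile[OF measurable_KS[of C n] assms]
    P.quantile_le[OF measurable_KS[of C n] assms, of t]
  by (simp_all add: ks_quantile_def ks_prob_eq)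

lemma level_tendsto:
  assumes "1 \<le> length \<sigma>" "\<sigma> \<in> perms (length \<sigma>)" "\<kappa> \<sigma> > 0" and \<alpha>: "0 < \<alpha>" "\<alpha> < 1"
  shows "(\<lambda>n. ks_prob_ge C C n (ks_quantile C \<alpha> n)) \<longlonglongrightarrow> \<alpha>"
proof (rule LIMSEQ_I)
  fix r :: real assume r: "0 < r"
  have "\<forall>\<^sub>F n in sequentially. \<forall>t. P.prob {z. KS C n (pattern n z) = t} \<le> r / 2"
    using r by (intro KS_atoms[OF assms(1-3)]) simp
  then obtain N where N: "\<And>n t. N \<le> n \<Longrightarrow> P.prob {z. KS C n (pattern n z) = t} \<le> r / 2"
    by (auto simp: eventually_sequentially)
  have "\<bar>ks_prob_ge C C n (ks_quantile C \<alpha> n) - \<alpha>\<bar> < r" if "N \<le> n" for n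
  proof -
    let ?q = "ks_quantile C \<alpha> n" and ?X = "\<lambda>z. KS C n (pattern n z)"
    have "{z. ?q \<le> ?X z} = {z. ?q < ?X z} \<union> {z. ?X z = ?q}" by auto
    then have "P.prob {z. ?q \<le> ?X z} \<le> P.prob {z. ?q < ?X z} + P.prob {z. ?X z = ?q}"
      by (simp only:) (intro measure_Un_le sets_Collect_P, measurable)
    also have "\<dots> \<le> \<alpha> + r / 2"
      using N[OF that, of ?q] ks_quantile_bounds(1)[OF \<alpha>, of n] by (simp add: ks_prob_eq)
    finally show ?thesis
      using ks_quantile_bounds(2)[OF \<alpha>, of n] r by (simp add: ks_prob_eq)
  qed
  then show "\<exists>N. \<forall>n\<ge>N. norm (ks_prob_ge C C n (ks_quantile C \<alpha> n) - \<alpha>) < r" by auto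
qed

text \<open>The right-hand side is the t at which the bound \<open>gamma_w / t\<^sup>2\<close> of
  \<open>prob_KS_gt\<close> equals \<alpha>, for every n.\<close>

lemma ks_quantile_bounded:
  assumes \<alpha>: "0 < \<alpha>" "\<alpha> < 1" and "1 \<le> n"
  shows "ks_quantile C \<alpha> n \<le> sqrt (gamma_w / \<alpha>)"
proof (rule ks_quantile_bounds(3)[OF \<alpha>])
  have "ks_prob_gt C C n (sqrt (gamma_w / \<alpha>)) \<le> gamma_w / (sqrt (gamma_w / \<alpha>))\<^sup>2"
    unfolding ks_prob_eq using assms gamma_w_pos by (intro prob_KS_gt) auto
  also have "\<dots> = \<alpha>" using \<alpha> gamma_w_pos by simp
  finally show "ks_prob_gt C C n (sqrt (gamma_w / \<alpha>)) \<le> \<alpha>" .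
qed

text \<open>The statistic dominates the term of \<sigma>, whose gap to the hypothesis stays fixed
  while the factor sqrt n grows past every bound on the critical values.\<close>

lemma power_tendsto:
  assumes \<sigma>: "1 \<le> length \<sigma>" "\<sigma> \<in> perms (length \<sigma>)" and ne: "\<theta> \<sigma> \<noteq> CS C0 \<sigma>"
    and bd: "\<And>n. 1 \<le> n \<Longrightarrow> q n \<le> B"
  shows "(\<lambda>n. ks_prob_ge C0 C n (q n)) \<longlonglongrightarrow> 1"
proof -
  \<comment> \<open>Half the gap: an estimate within d of \<theta> is at least d away from the value
    under the hypothesis.\<close>
  define d where "d = \<bar>\<theta> \<sigma> - CS C0 \<sigma>\<bar> / 2"
  have d: "0 < d" using ne by (simp add: d_def)
  note c = coef_pos[OF \<sigma>(1)]
  define b where "b n = (real (length \<sigma>))\<^sup>2 / real n / d\<^sup>2" for n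
  have "filterlim (\<lambda>n. coef \<sigma> * d * sqrt (real n)) at_top sequentially"
    using c d by (intro filterlim_tendsto_pos_mult_at_top[OF tendsto_const]
        filterlim_compose[OF sqrt_at_top filterlim_real_sequentially]) auto
  then have "\<forall>\<^sub>F n in sequentially. B \<le> coef \<sigma> * d * sqrt (real n)"
    by (simp add: filterlim_at_top)
  then have lower: "\<forall>\<^sub>F n in sequentially. 1 - b n \<le> ks_prob_ge C0 C n (q n)"
    using eventually_ge_at_top[of "length \<sigma>"]
  proof eventually_elim
    case (elim n)
    then have n: "1 \<le> n" and \<sigma>_in: "\<sigma> \<in> stat_patterns n" using \<sigma> by (auto simp: stat_patterns_iff)
    let ?A = "{z. d \<le> 1 * \<bar>ustat \<sigma> n z - \<theta> \<sigma>\<bar>}"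
    have A: "?A \<in> sets P" by (rule sets_Collect_P) measurable
    have "P.prob ?A \<le> 1\<^sup>2 * ((real (length \<sigma>))\<^sup>2 / real n) / d\<^sup>2"
      using \<sigma> elim d by (intro ustat_deviation) auto
    then have "1 - b n \<le> 1 - P.prob ?A" by (simp add: b_def)
    also have "\<dots> = P.prob (space P - ?A)" by (rule P.prob_compl[symmetric]) (rule A)
    also have "\<dots> \<le> P.prob {z. q n \<le> KS C0 n (pattern n z)}"
    proof (rule prob_le_of_tie_free)
      show "{z. q n \<le> KS C0 n (pattern n z)} \<in> sets P" by (rule sets_Collect_P) measurable
      fix z assume z: "tie_free {..<n} z" "z \<in> space P - ?A"
      then have "\<bar>ustat \<sigma> n z - \<theta> \<sigma>\<bar> < d" by simp
      then have "d \<le> \<bar>ustat \<sigma> n z - CS C0 \<sigma>\<bar>"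
        using abs_triangle_ineq4[of "ustat \<sigma> n z - CS C0 \<sigma>" "ustat \<sigma> n z - \<theta> \<sigma>"] by (simp add: d_def)
      then have "coef \<sigma> * d * sqrt (real n) \<le> dev C0 \<sigma> n z"
        using c mult_left_mono[OF \<open>d \<le> \<bar>ustat \<sigma> n z - CS C0 \<sigma>\<bar>\<close>, of "sqrt (real n) * coef \<sigma>"]
        by (simp add: dev_def mult_ac)
      also have "\<dots> \<le> KS C0 n (pattern n z)" by (rule dev_le_KS[OF z(1) n \<sigma>_in])
      finally show "z \<in> {z. q n \<le> KS C0 n (pattern n z)}" using elim bd[OF n] by simp
    qed (rule sets.compl_sets[OF A])
    finally show ?case by (simp add: ks_prob_eq)
  qed
  have "(\<lambda>n. 1 - b n) \<longlonglongrightarrow> 1 - 0"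
    unfolding b_def by (intro tendsto_diff tendsto_const tendsto_divide_zero lim_const_over_n)
  then have lim: "(\<lambda>n. 1 - b n) \<longlonglongrightarrow> 1" by simp
  show ?thesis
    by (rule tendsto_sandwich[OF lower _ lim tendsto_const]) (simp add: ks_prob_eq)
qed

end

lemma copula_law_props:
  assumes "is_copula C"
  shows "copula_model (copula_law C) C" "copula_cdf (copula_law C) = C"
proof -
  have "copula_measure (copula_law C) \<and> C = copula_cdf (copula_law C)"
    unfolding copula_law_def using assms unfolding is_copula_def by (rule someI_ex)
  then show "copula_model (copula_law C) C" "copula_cdf (copula_law C) = C"
    by (auto simp: copula_model_def copula_sample_def copula_model_axioms_def)
qed

theorem theorem4p3:
  fixes C0 :: "real \<Rightarrow> real \<Rightarrow> real" and \<alpha> :: real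
  assumes "is_copula C0"
    and "\<exists>\<sigma>. length \<sigma> \<ge> 1 \<and> \<sigma> \<in> perms (length \<sigma>) \<and> CS2 C0 \<sigma> \<sigma> - (CS C0 \<sigma>)\<^sup>2 \<noteq> 0"
    and "0 < \<alpha>" and "\<alpha> < 1"
  shows "(\<lambda>n. ks_prob_ge C0 C0 n (ks_quantile C0 \<alpha> n)) \<longlonglongrightarrow> \<alpha> \<and>
         (\<forall>C. is_copula C \<and> C \<noteq> C0 \<longrightarrow>
            (\<lambda>n. ks_prob_ge C0 C n (ks_quantile C0 \<alpha> n)) \<longlonglongrightarrow> 1)"
proof (intro conjI allI impI)
  interpret null: copula_model "copula_law C0" C0 by (rule copula_law_props) fact
  obtain \<sigma> where \<sigma>: "1 \<le> length \<sigma>" "\<sigma> \<in> perms (length \<sigma>)" "CS2 C0 \<sigma> \<sigma> - (CS C0 \<sigma>)\<^sup>2 \<noteq> 0"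
    using assms(2) by blast
  \<comment> \<open>The difference in the nondegeneracy condition is the variance \<kappa>, so being
    nonzero means being positive.\<close>
  then have "null.\<kappa> \<sigma> > 0"
    using null.kappa_nonneg[of \<sigma>] by (simp add: null.CS2_eq null.CS_eq_theta)
  then show "(\<lambda>n. ks_prob_ge C0 C0 n (ks_quantile C0 \<alpha> n)) \<longlonglongrightarrow> \<alpha>"
    using \<sigma> assms(3,4) by (intro null.level_tendsto)
  fix C assume C: "is_copula C \<and> C \<noteq> C0"
  then interpret alt: copula_model "copula_law C" C by (intro copula_law_props) simp
  have "\<exists>n \<pi>. 1 \<le> n \<and> \<pi> \<in> perms n \<and> alt.\<theta> \<pi> \<noteq> null.\<theta> \<pi>"
  proof (rule ccontr)
    assume "\<nexists>n \<pi>. 1 \<le> n \<and> \<pi> \<in> perms n \<and> alt.\<theta> \<pi> \<noteq> null.\<theta> \<pi>"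
    then have "copula_cdf (copula_law C) = copula_cdf (copula_law C0)"
      by (intro copula_cdf_eqI alt.copula_sample_axioms null.copula_sample_axioms) blast
    then show False using C assms(1) by (simp add: copula_law_props)
  qed
  then obtain \<pi> where \<pi>: "1 \<le> length \<pi>" "\<pi> \<in> perms (length \<pi>)" "alt.\<theta> \<pi> \<noteq> null.\<theta> \<pi>"
    by (auto simp: perms_def)
  show "(\<lambda>n. ks_prob_ge C0 C n (ks_quantile C0 \<alpha> n)) \<longlonglongrightarrow> 1"
    using \<pi> null.ks_quantile_bounded[OF assms(3,4)]
    by (intro alt.power_tendsto[of \<pi>]) (auto simp: null.CS_eq_theta)
qed

end
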